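(* Let $n\geq 2$ be an integer and let $G_n$ be the metric graph of genus $n+3$ described in the context (a theta graph with edges of mutually different lengths and with $n+1$ loops attached). There does not exist a tropical modification $G'_n$ of $G_n$ such that there exist a metric graph $E$ with $g(E)=1$ and a finite harmonic morphism $\phi : G'_n \rightarrow E$ of degree $2$.
   Context: **The graph $G_n$.** $G_0$ is the metric graph of genus 2 having exactly two points $v_1,v_2$ of valence 3 (all other points have valence 2), connected by three edges $e_0,e_1,e_2$ of mutually different finite lengths. For $0\leq i\leq 2$, $m_i$ is the midpoint of $e_i$. Put $q_0=m_0$. Fix a point $q_1$ in the open segment $]v_1,m_1[\subset e_1$ and a point $q_2$ in the open segment $]v_2,m_2[\subset e_2$. For $n\geq 2$ fix further general different points $q_3,\dots,q_n$ on $G_0$ (i.e. $v_1,v_2,m_0,m_1,m_2,q_1,q_2,q_3,\dots,q_n$ are pairwise distinct). $G_n$ is obtained from $G_0$ by attaching, for each $0\leq i\leq n$, a loop $\gamma_i$ (a circle of some finite positive length) at $q_i$. **Metric graphs.** A (finite) topological graph is a compact connected topological space in which every point $P$ has a neighborhood $U_P$ homeomorphic to a star with $n_P$ branches centered at $P$ ($n_P$ is the valence of $P$), with only finitely many $P$ having $n_P\neq 2$ (the essential vertices). The tangent space $T_P(\Gamma)$ is the set of the $n_P$ connected components of $U_P\setminus\{P\}$ (germs of branches at $P$). A metric graph $\Gamma$ is such a graph together with a finite set $V_\infty(\Gamma)$ of 1-valent points and a complete metric on $\Gamma\setminus V_\infty(\Gamma)$. A vertex set $V$ is a finite subset containing all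 essential vertices, chosen such that each edge (connected component of $\Gamma\setminus V$) has two different end vertices. Each edge has a length in $\mathbb{R}_{>0}\cup\{\infty\}$, which is infinite iff an end vertex is in $V_\infty(\Gamma)$. The genus is $g(\Gamma)=|E(\Gamma,V)|-|V|+1$, where $E(\Gamma,V)$ is the set of edges. **Tropical modifications.** An elementary tropical modification of $\Gamma$ is obtained by attaching an infinite closed edge at a point $P\in\Gamma\setminus V_\infty(\Gamma)$. A tropical modification is a composition of finitely many elementary ones. **Harmonic morphisms.** A continuous map $\phi:\Gamma'\to\Gamma$ of metric graphs is a morphism if there are vertex sets $V'$ of $\Gamma'$ and $V$ of $\Gamma$ with $\phi(V')\subset V$ such that, for each $e\in E(\Gamma,V)$, $\phi^{-1}(\overline e)$ is a union of closures of edges of $(\Gamma',V')$ (and vertices), and each edge $e'\subset\phi^{-1}(\overline e)$ is either mapped to a vertex in $V$ (then put $d_{e'}(\phi)=0$) or mapped onto $e$ by a dilation with factor $d_{e'}(\phi)\in\mathbb{Z}_{>0}$. It is finite if $d_{e'}(\phi)>0$ for all edges $e'$. For $v'\in T_{P'}(\Gamma')$ defined by the edge $e'$ put $d_{v'}(\phi)=d_{e'}(\phi)$; when this is nonzero, $v'$ has an image direction $d_\phi(P')(v')\in T_{\phi(P')}(\Gamma)$. $\phi$ is harmonic at $P'$ if for $v\in T_{\phi(P')}(\Gamma)$ the sum of $d_{v'}(\phi)$ over all $v'\in T_{P'}(\Gamma')$ with $d_\phi(P')(v')=v$ is independent of $v$; this number is $d_{P'}(\phi)$. $\phi$ is harmonic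 if it is surjective and harmonic at each point. Its degree is $\sum_{P'\in\phi^{-1}(P)}d_{P'}(\phi)$, which is independent of $P\in\Gamma$. *)

theory Defs
  imports "HOL-Analysis.Analysis"
begin

section \<open>Topological graphs\<close>

text \<open>The star with n open branches, centred at 0.  It is the point 0 for n = 0, a half-open
  interval for n = 1 and an open interval for n = 2.\<close>

definition star :: "nat \<Rightarrow> complex set" where
  "star n = insert 0 {of_real \<rho> * cis (2 * pi * real k / real n) | \<rho> k. 0 \<le> \<rho> \<and> \<rho> < 1 \<and> k < n}"

definition star_nbhd :: "'a topology \<Rightarrow> 'a \<Rightarrow> 'a set \<Rightarrow> nat \<Rightarrow> bool" where
  "star_nbhd X P U n \<longleftrightarrow> openin X U \<and> P \<in> U \<and>
     (\<exists>f. homeomorphic_map (subtopology X U) (top_of_set (star n)) f \<and> f P = 0)"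

definition valence :: "'a topology \<Rightarrow> 'a \<Rightarrow> nat" where
  "valence X P = (THE n. \<exists>U. star_nbhd X P U n)"

definition essential_vertices :: "'a topology \<Rightarrow> 'a set" where
  "essential_vertices X = {P \<in> topspace X. valence X P \<noteq> 2}"

text \<open>Compact spaces are understood to be Hausdorff and nonempty.\<close>

definition topological_graph :: "'a topology \<Rightarrow> bool" where
  "topological_graph X \<longleftrightarrow> topspace X \<noteq> {} \<and> compact_space X \<and> Hausdorff_space X \<and>
     connected_space X \<and> (\<forall>P\<in>topspace X. \<exists>U n. star_nbhd X P U n) \<and> finite (essential_vertices X)"

text \<open>The directions at P are the components of a punctured star neighbourhood of P.  Which star
  neighbourhood is picked is immaterial: below, a direction is only ever used through its
  intersections with small neighbourhoods of P, that is, through its germ.\<close>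

definition directions :: "'a topology \<Rightarrow> 'a \<Rightarrow> 'a set set" where
  "directions X P =
     connected_components_of (subtopology X ((SOME U. \<exists>n. star_nbhd X P U n) - {P}))"


section \<open>Metric graphs\<close>

record 'a mgraph =
  mg_top :: "'a topology"
  mg_inf :: "'a set"
  mg_dist :: "'a \<Rightarrow> 'a \<Rightarrow> real"

definition points :: "'a mgraph \<Rightarrow> 'a set" where
  "points \<Gamma> = topspace (mg_top \<Gamma>)"

definition finite_points :: "'a mgraph \<Rightarrow> 'a set" where
  "finite_points \<Gamma> = points \<Gamma> - mg_inf \<Gamma>"

text \<open>The metric induces the topology away from the infinite points, is complete, and is the
  length (path) metric of the graph: since the space is locally compact and the metric complete,
  this means that any two points are joined by a path whose length is their distance.\<close>

definition metric_graph :: "'a mgraph \<Rightarrow> bool" where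
  "metric_graph \<Gamma> \<longleftrightarrow> topological_graph (mg_top \<Gamma>) \<and>
     finite (mg_inf \<Gamma>) \<and> mg_inf \<Gamma> \<subseteq> {P \<in> points \<Gamma>. valence (mg_top \<Gamma>) P = 1} \<and>
     Metric_space (finite_points \<Gamma>) (mg_dist \<Gamma>) \<and>
     Metric_space.mtopology (finite_points \<Gamma>) (mg_dist \<Gamma>)
       = subtopology (mg_top \<Gamma>) (finite_points \<Gamma>) \<and>
     Metric_space.mcomplete (finite_points \<Gamma>) (mg_dist \<Gamma>) \<and>
     (\<forall>x\<in>finite_points \<Gamma>. \<forall>y\<in>finite_points \<Gamma>.
        \<exists>c. c 0 = x \<and> c (mg_dist \<Gamma> x y) = y \<and> c ` {0..mg_dist \<Gamma> x y} \<subseteq> finite_points \<Gamma> \<and>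
            (\<forall>s\<in>{0..mg_dist \<Gamma> x y}. \<forall>t\<in>{0..mg_dist \<Gamma> x y}. mg_dist \<Gamma> (c s) (c t) = \<bar>s - t\<bar>))"

definition edges :: "'a mgraph \<Rightarrow> 'a set \<Rightarrow> 'a set set" where
  "edges \<Gamma> V = connected_components_of (subtopology (mg_top \<Gamma>) (points \<Gamma> - V))"

definition closed_edge :: "'a mgraph \<Rightarrow> 'a set \<Rightarrow> 'a set" where
  "closed_edge \<Gamma> e = mg_top \<Gamma> closure_of e"

definition end_vertices :: "'a mgraph \<Rightarrow> 'a set \<Rightarrow> 'a set" where
  "end_vertices \<Gamma> e = closed_edge \<Gamma> e - e"

definition vertex_set :: "'a mgraph \<Rightarrow> 'a set \<Rightarrow> bool" where
  "vertex_set \<Gamma> V \<longleftrightarrow> finite V \<and> V \<subseteq> points \<Gamma> \<and> essential_vertices (mg_top \<Gamma>) \<subseteq> V \<and>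
     (\<forall>e\<in>edges \<Gamma> V. card (end_vertices \<Gamma> e) = 2)"

text \<open>The genus does not depend on the vertex set.\<close>

definition genus :: "'a mgraph \<Rightarrow> int" where
  "genus \<Gamma> = (let V = (SOME V. vertex_set \<Gamma> V) in int (card (edges \<Gamma> V)) - int (card V) + 1)"

text \<open>A parametrisation by arc length of a closed arc of length L.  It is only a local isometry,
  as the distance between two far apart points of the arc may be realised outside the arc.\<close>

definition arclength_param :: "'a mgraph \<Rightarrow> real \<Rightarrow> (real \<Rightarrow> 'a) \<Rightarrow> bool" where
  "arclength_param \<Gamma> L h \<longleftrightarrow>
     homeomorphic_map (top_of_set {0..L}) (subtopology (mg_top \<Gamma>) (h ` {0..L})) h \<and>
     (\<forall>t\<in>{0..L}. \<exists>\<epsilon>>0. \<forall>s\<in>{0..L} \<inter> ball t \<epsilon>. \<forall>s'\<in>{0..L} \<inter> ball t \<epsilon>.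
        mg_dist \<Gamma> (h s) (h s') = \<bar>s - s'\<bar>)"


section \<open>Attaching loops and infinite edges\<close>

text \<open>The graph obtained from \<open>\<Gamma>\<close> by gluing the point c of a copy of C to the point P of \<open>\<Gamma>\<close>.
  The points of \<open>\<Gamma>\<close> remain points of the new graph and the new points are taken from
  the same type; as that type is arbitrary, this is no restriction.\<close>

definition attach :: "'a mgraph \<Rightarrow> 'a \<Rightarrow> 'c mgraph \<Rightarrow> 'c \<Rightarrow> 'a mgraph \<Rightarrow> bool" where
  "attach \<Gamma> P C c \<Gamma>' \<longleftrightarrow> metric_graph \<Gamma>' \<and>
     points \<Gamma> \<subseteq> points \<Gamma>' \<and> subtopology (mg_top \<Gamma>') (points \<Gamma>) = mg_top \<Gamma> \<and>
     (\<forall>x\<in>finite_points \<Gamma>. \<forall>y\<in>finite_points \<Gamma>. mg_dist \<Gamma>' x y = mg_dist \<Gamma> x y) \<and>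
     (\<exists>\<kappa>. embedding_map (mg_top C) (mg_top \<Gamma>') \<kappa> \<and>
        points \<Gamma> \<union> \<kappa> ` points C = points \<Gamma>' \<and> points \<Gamma> \<inter> \<kappa> ` points C = {P} \<and> \<kappa> c = P \<and>
        mg_inf \<Gamma>' = mg_inf \<Gamma> \<union> \<kappa> ` mg_inf C \<and>
        (\<forall>x\<in>finite_points C. \<forall>y\<in>finite_points C. mg_dist \<Gamma>' (\<kappa> x) (\<kappa> y) = mg_dist C x y) \<and>
        (\<forall>x\<in>finite_points \<Gamma>. \<forall>y\<in>finite_points C.
           mg_dist \<Gamma>' x (\<kappa> y) = mg_dist \<Gamma> x P + mg_dist C c y))"

text \<open>The circle of circumference L, as the interval [0,L) with the metric of R/LZ; the outer
  absolute value only matters outside that interval.\<close>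

definition circle_dist :: "real \<Rightarrow> real \<Rightarrow> real \<Rightarrow> real" where
  "circle_dist L s t = min \<bar>s - t\<bar> \<bar>L - \<bar>s - t\<bar>\<bar>"

definition circle :: "real \<Rightarrow> real mgraph" where
  "circle L = \<lparr>mg_top = Metric_space.mtopology {0..<L} (circle_dist L), mg_inf = {},
               mg_dist = circle_dist L\<rparr>"

definition infinite_edge :: "ereal mgraph" where
  "infinite_edge = \<lparr>mg_top = top_of_set {0..\<infinity>}, mg_inf = {\<infinity>},
                    mg_dist = (\<lambda>s t. \<bar>real_of_ereal s - real_of_ereal t\<bar>)\<rparr>"

definition elementary_tropical_modification :: "'a mgraph \<Rightarrow> 'a mgraph \<Rightarrow> bool" where
  "elementary_tropical_modification \<Gamma> \<Gamma>' \<longleftrightarrow>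
     (\<exists>P\<in>finite_points \<Gamma>. attach \<Gamma> P infinite_edge 0 \<Gamma>')"

text \<open>The empty composition is included.\<close>

definition tropical_modification :: "'a mgraph \<Rightarrow> 'a mgraph \<Rightarrow> bool" where
  "tropical_modification = elementary_tropical_modification\<^sup>*\<^sup>*"

text \<open>Attaching, for each \<open>i < k\<close>, a loop of length \<open>r i\<close> at the point \<open>q i\<close>.\<close>

primrec attach_loops ::
    "(nat \<Rightarrow> 'a) \<Rightarrow> (nat \<Rightarrow> real) \<Rightarrow> nat \<Rightarrow> 'a mgraph \<Rightarrow> 'a mgraph \<Rightarrow> bool" where
  "attach_loops q r 0 \<Gamma> \<Gamma>' \<longleftrightarrow> \<Gamma>' = \<Gamma>"
| "attach_loops q r (Suc k) \<Gamma> \<Gamma>' \<longleftrightarrow>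
     (\<exists>\<Delta>. attach_loops q r k \<Gamma> \<Delta> \<and> attach \<Delta> (q k) (circle (r k)) 0 \<Gamma>')"


section \<open>Harmonic morphisms\<close>

definition dilates_on :: "'a mgraph \<Rightarrow> 'b mgraph \<Rightarrow> ('a \<Rightarrow> 'b) \<Rightarrow> 'a set \<Rightarrow> nat \<Rightarrow> bool" where
  "dilates_on \<Gamma>' \<Gamma> \<phi> S k \<longleftrightarrow>
     (\<forall>x\<in>S. \<exists>N. openin (mg_top \<Gamma>') N \<and> x \<in> N \<and>
        (\<forall>y\<in>S \<inter> N. \<forall>z\<in>S \<inter> N. mg_dist \<Gamma> (\<phi> y) (\<phi> z) = real k * mg_dist \<Gamma>' y z))"

definition morphism_wrt ::
    "'a mgraph \<Rightarrow> 'b mgraph \<Rightarrow> ('a \<Rightarrow> 'b) \<Rightarrow> 'a set \<Rightarrow> 'b set \<Rightarrow> bool" where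
  "morphism_wrt \<Gamma>' \<Gamma> \<phi> V' V \<longleftrightarrow>
     continuous_map (mg_top \<Gamma>') (mg_top \<Gamma>) \<phi> \<and>
     vertex_set \<Gamma>' V' \<and> vertex_set \<Gamma> V \<and> \<phi> ` V' \<subseteq> V \<and>
     (\<forall>e\<in>edges \<Gamma> V.
        (\<exists>F\<subseteq>edges \<Gamma>' V'. \<exists>W\<subseteq>V'.
           {x \<in> points \<Gamma>'. \<phi> x \<in> closed_edge \<Gamma> e} = (\<Union>e'\<in>F. closed_edge \<Gamma>' e') \<union> W) \<and>
        (\<forall>e'\<in>edges \<Gamma>' V'. \<phi> ` e' \<subseteq> closed_edge \<Gamma> e \<longrightarrow>
           (\<exists>v\<in>V. \<phi> ` e' = {v}) \<or> (bij_betw \<phi> e' e \<and> (\<exists>k>0. dilates_on \<Gamma>' \<Gamma> \<phi> e' k))))"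

definition edge_degree :: "'a mgraph \<Rightarrow> 'b mgraph \<Rightarrow> ('a \<Rightarrow> 'b) \<Rightarrow> 'a set \<Rightarrow> nat" where
  "edge_degree \<Gamma>' \<Gamma> \<phi> e' =
     (if \<exists>v. \<phi> ` e' = {v} then 0 else (THE k. dilates_on \<Gamma>' \<Gamma> \<phi> e' k))"

definition morphism :: "'a mgraph \<Rightarrow> 'b mgraph \<Rightarrow> ('a \<Rightarrow> 'b) \<Rightarrow> bool" where
  "morphism \<Gamma>' \<Gamma> \<phi> \<longleftrightarrow> (\<exists>V' V. morphism_wrt \<Gamma>' \<Gamma> \<phi> V' V)"

definition finite_morphism :: "'a mgraph \<Rightarrow> 'b mgraph \<Rightarrow> ('a \<Rightarrow> 'b) \<Rightarrow> bool" where
  "finite_morphism \<Gamma>' \<Gamma> \<phi> \<longleftrightarrow>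
     (\<exists>V' V. morphism_wrt \<Gamma>' \<Gamma> \<phi> V' V \<and> (\<forall>e'\<in>edges \<Gamma>' V'. edge_degree \<Gamma>' \<Gamma> \<phi> e' > 0))"

definition direction_defined_by :: "'a mgraph \<Rightarrow> 'a \<Rightarrow> 'a set \<Rightarrow> 'a set \<Rightarrow> bool" where
  "direction_defined_by \<Gamma> P v e \<longleftrightarrow> (\<exists>N. openin (mg_top \<Gamma>) N \<and> P \<in> N \<and> v \<inter> N \<subseteq> e)"

text \<open>The degree along a direction is that of the edge defining it; it does not depend on
  the vertex sets.\<close>

definition direction_degree ::
    "'a mgraph \<Rightarrow> 'b mgraph \<Rightarrow> ('a \<Rightarrow> 'b) \<Rightarrow> 'a \<Rightarrow> 'a set \<Rightarrow> nat" where
  "direction_degree \<Gamma>' \<Gamma> \<phi> P' v' =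
     (THE d. \<exists>V' V. morphism_wrt \<Gamma>' \<Gamma> \<phi> V' V \<and>
        (\<exists>e'\<in>edges \<Gamma>' V'. direction_defined_by \<Gamma>' P' v' e' \<and> d = edge_degree \<Gamma>' \<Gamma> \<phi> e'))"

text \<open>The direction v at \<open>\<phi> P'\<close> is the image of the direction v' at P'.  This never holds
  if \<open>\<phi>\<close> is constant along v', as v does not contain \<open>\<phi> P'\<close>.\<close>

definition maps_direction ::
    "'a mgraph \<Rightarrow> ('a \<Rightarrow> 'b) \<Rightarrow> 'a \<Rightarrow> 'a set \<Rightarrow> 'b set \<Rightarrow> bool" where
  "maps_direction \<Gamma>' \<phi> P' v' v \<longleftrightarrow>
     (\<exists>N. openin (mg_top \<Gamma>') N \<and> P' \<in> N \<and> \<phi> ` (v' \<inter> N) \<subseteq> v)"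

definition degree_over ::
    "'a mgraph \<Rightarrow> 'b mgraph \<Rightarrow> ('a \<Rightarrow> 'b) \<Rightarrow> 'a \<Rightarrow> 'b set \<Rightarrow> nat" where
  "degree_over \<Gamma>' \<Gamma> \<phi> P' v =
     (\<Sum>v' | v' \<in> directions (mg_top \<Gamma>') P' \<and> maps_direction \<Gamma>' \<phi> P' v' v.
        direction_degree \<Gamma>' \<Gamma> \<phi> P' v')"

definition harmonic_at :: "'a mgraph \<Rightarrow> 'b mgraph \<Rightarrow> ('a \<Rightarrow> 'b) \<Rightarrow> 'a \<Rightarrow> bool" where
  "harmonic_at \<Gamma>' \<Gamma> \<phi> P' \<longleftrightarrow>
     (\<exists>d. \<forall>v\<in>directions (mg_top \<Gamma>) (\<phi> P'). degree_over \<Gamma>' \<Gamma> \<phi> P' v = d)"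

text \<open>Unspecified if the target is a single point, where there is no direction v.\<close>

definition local_degree :: "'a mgraph \<Rightarrow> 'b mgraph \<Rightarrow> ('a \<Rightarrow> 'b) \<Rightarrow> 'a \<Rightarrow> nat" where
  "local_degree \<Gamma>' \<Gamma> \<phi> P' =
     (THE d. \<forall>v\<in>directions (mg_top \<Gamma>) (\<phi> P'). degree_over \<Gamma>' \<Gamma> \<phi> P' v = d)"

definition harmonic_morphism :: "'a mgraph \<Rightarrow> 'b mgraph \<Rightarrow> ('a \<Rightarrow> 'b) \<Rightarrow> bool" where
  "harmonic_morphism \<Gamma>' \<Gamma> \<phi> \<longleftrightarrow> morphism \<Gamma>' \<Gamma> \<phi> \<and> \<phi> ` points \<Gamma>' = points \<Gamma> \<and>
     (\<forall>P'\<in>points \<Gamma>'. harmonic_at \<Gamma>' \<Gamma> \<phi> P')"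

text \<open>The sum over a fibre does not depend on the point P.\<close>

definition has_degree :: "'a mgraph \<Rightarrow> 'b mgraph \<Rightarrow> ('a \<Rightarrow> 'b) \<Rightarrow> nat \<Rightarrow> bool" where
  "has_degree \<Gamma>' \<Gamma> \<phi> d \<longleftrightarrow>
     (\<forall>P\<in>points \<Gamma>. (\<Sum>P' | P' \<in> points \<Gamma>' \<and> \<phi> P' = P. local_degree \<Gamma>' \<Gamma> \<phi> P') = d)"


section \<open>The theta graph\<close>

text \<open>The closed edge number i, of length \<open>len i\<close>, is parametrised by arc length by \<open>h i\<close>
  from \<open>v\<^sub>1\<close> to \<open>v\<^sub>2\<close>.\<close>

definition theta_graph ::
    "'a mgraph \<Rightarrow> 'a \<Rightarrow> 'a \<Rightarrow> (nat \<Rightarrow> real) \<Rightarrow> (nat \<Rightarrow> real \<Rightarrow> 'a) \<Rightarrow> bool" where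
  "theta_graph \<Gamma> v\<^sub>1 v\<^sub>2 len h \<longleftrightarrow> metric_graph \<Gamma> \<and> genus \<Gamma> = 2 \<and>
     v\<^sub>1 \<in> points \<Gamma> \<and> v\<^sub>2 \<in> points \<Gamma> \<and> v\<^sub>1 \<noteq> v\<^sub>2 \<and>
     valence (mg_top \<Gamma>) v\<^sub>1 = 3 \<and> valence (mg_top \<Gamma>) v\<^sub>2 = 3 \<and>
     (\<forall>P\<in>points \<Gamma> - {v\<^sub>1, v\<^sub>2}. valence (mg_top \<Gamma>) P = 2) \<and>
     bij_betw (\<lambda>i. h i ` {0<..<len i}) {0, 1, 2} (edges \<Gamma> {v\<^sub>1, v\<^sub>2}) \<and>
     (\<forall>i\<in>{0, 1, 2}. len i > 0 \<and> arclength_param \<Gamma> (len i) (h i) \<and> h i 0 = v\<^sub>1 \<and> h i (len i) = v\<^sub>2) \<and>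
     inj_on len {0, 1, 2}"

end

theory Submission
  imports Defs
begin

text \<open>Let \<open>\<phi>\<close> be a finite harmonic morphism of degree two from a tropical modification \<open>G'\<close> of \<open>G\<^sub>n\<close> to
a metric graph \<open>E\<close>. All local degrees are positive, so the fibres have one or two points, and
exchanging the two points of a fibre is an involution of \<open>G'\<close>, called \<open>swap\<close> below. It is continuous
because \<open>\<phi>\<close> is an open map (\<open>open_phi\<close>), which is the topological content of harmonicity. At all but
finitely many of the points that it moves it is a local isometry, because \<open>\<phi>\<close> has dilation factor 1
near both points of the fibre (\<open>swap_local_isometry\<close>).

The involution respects the decomposition of \<open>G\<^sub>n\<close> into the theta graph \<open>G\<^sub>0\<close> and the loops. Call a
connected set without cut points a block. A block of a graph glued at one point lies in one of the
two parts, and a segment contains no block; hence every block of \<open>G'\<close> lies in \<open>G\<^sub>0\<close> or in a loop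
(\<open>loops_decomposition\<close>, \<open>tropical_decomposition\<close>). Since \<open>G\<^sub>0\<close> and the loops are blocks, \<open>swap\<close>
permutes them; as \<open>G\<^sub>0\<close> is not a circle, it is mapped to itself, every loop goes into a loop, and
the points where loops are attached go to such points.

On \<open>G\<^sub>0\<close> the involution preserves valences, so it permutes the two branch points and the three edges,
and as a local isometry it preserves the lengths of the edges. These are different, so each edge is
mapped to itself: either \<open>swap\<close> is the identity on \<open>G\<^sub>0\<close>, or it reflects every edge in its midpoint
(\<open>involution_dichotomy\<close>). In the first case \<open>\<phi>\<close> is injective on \<open>G\<^sub>0\<close>, and \<open>E\<close> contains the images of
two different cycles of the theta graph. In the second case the points \<open>q 1\<close> and \<open>q 2\<close>, which are
not midpoints, are moved; the loops attached there are exchanged with two other loops, so \<open>\<phi>\<close> is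
injective on both of them and their images are different circles in \<open>E\<close>.

Both cases contradict genus 1, because a graph of genus 1 contains at most one circle
(\<open>genus_one_unique_circle\<close>): of two circles one could remove an edge of the first that is not in the
second, and then an edge of the second, and the graph would stay connected with two edges fewer than
vertices.\<close>

section \<open>Star neighbourhoods\<close>

lemma star_branch_inj:
  assumes "k < n" "l < n" "cis (2 * pi * real k / real n) = cis (2 * pi * real l / real n)"
  shows "k = l"
proof -
  have n: "n > 0" using assms by simp
  have "inj_on (\<lambda>k. cis (2 * pi * real k / real n)) {..<n}"
    using Complex.bij_betw_roots_unity[OF n] by (rule bij_betw_imp_inj_on)
  then show ?thesis using assms by (auto dest: inj_onD)
qed

text \<open>A star neighbourhood in coordinates: \<open>\<beta> k\<close> parametrises branch number \<open>k\<close> by the distance from the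
centre, and \<open>\<rho>\<close> is this distance.\<close>

locale branch_chart =
  fixes X :: "'a topology" and P :: 'a and U :: "'a set" and n :: nat
    and \<beta> :: "nat \<Rightarrow> real \<Rightarrow> 'a" and \<rho> :: "'a \<Rightarrow> real"
  assumes open_U: "openin X U"
    and cont_branch: "k < n \<Longrightarrow> continuous_map (top_of_set {0..<1}) X (\<beta> k)"
    and branch_0: "k < n \<Longrightarrow> \<beta> k 0 = P"
    and radius_branch: "k < n \<Longrightarrow> t \<in> {0..<1} \<Longrightarrow> \<rho> (\<beta> k t) = t"
    and radius_P: "\<rho> P = 0"
    and U_eq: "U = insert P (\<Union>k<n. \<beta> k ` {0<..<1})"
    and cont_radius: "continuous_map (subtopology X U) euclideanreal \<rho>"
    and open_branch: "k < n \<Longrightarrow> openin X (\<beta> k ` {0<..<1})"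
    and disjoint_branches: "k < n \<Longrightarrow> l < n \<Longrightarrow> k \<noteq> l \<Longrightarrow> \<beta> k ` {0<..<1} \<inter> \<beta> l ` {0<..<1} = {}"

lemma star_nbhd_imp_branch_chart:
  assumes "star_nbhd X P U n"
  obtains \<beta> \<rho> where "branch_chart X P U n \<beta> \<rho>"
proof -
  obtain f where U: "openin X U" "P \<in> U"
    and f: "homeomorphic_map (subtopology X U) (top_of_set (star n)) f" and f0: "f P = 0"
    using assms unfolding star_nbhd_def by blast
  have topU: "topspace (subtopology X U) = U"
    using openin_subset[OF U(1)] by auto
  obtain g where g: "homeomorphic_maps (subtopology X U) (top_of_set (star n)) f g"
    using f homeomorphic_map_maps by blast
  have gf: "g (f x) = x" if "x \<in> U" for x
    using g that unfolding homeomorphic_maps_def topU by auto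
  have fg: "f (g z) = z" "g z \<in> U" if "z \<in> star n" for z
    using g that unfolding homeomorphic_maps_def continuous_map_def topU by auto
  have fU: "f x \<in> star n" if "x \<in> U" for x
    using g that unfolding homeomorphic_maps_def continuous_map_def topU by auto
  define c where "c k = cis (2 * pi * real k / real n)" for k
  have nc: "norm (c k) = 1" for k by (simp add: c_def)
  define \<beta> where "\<beta> k t = g (of_real t * c k)" for k t
  define \<rho> where "\<rho> x = norm (f x)" for x
  have in_star: "of_real t * c k \<in> star n" if "k < n" "t \<in> {0..<1}" for k t
    using that unfolding star_def c_def by auto
  \<comment> \<open>A branch is open in the star, being the complement of finitely many closed rays.\<close>
  have ray_closed: "closed {z. z = of_real (norm z) * c k}" for k
    by (intro closed_Collect_eq continuous_intros)
  have branch_img: "\<beta> k ` {0<..<1} = {x \<in> U. f x \<in> - ({0} \<union> (\<Union>l\<in>{..<n}-{k}. {z. z = of_real (norm z) * c l}))}"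
    (is "?L = ?R") if k: "k < n" for k
  proof
    show "?L \<subseteq> ?R"
    proof
      fix x assume "x \<in> ?L"
      then obtain t where t: "0 < t" "t < 1" and x: "x = \<beta> k t" by auto
      have fx: "f x = of_real t * c k" "x \<in> U"
        using fg in_star[OF k, of t] t x by (auto simp: \<beta>_def)
      have "c k \<noteq> 0" using nc[of k] by force
      then have "f x \<noteq> 0" using fx t by simp
      moreover have "f x \<noteq> of_real (norm (f x)) * c l" if l: "l < n" "l \<noteq> k" for l
      proof
        assume "f x = of_real (norm (f x)) * c l"
        then have "of_real t * c k = of_real t * c l" using fx t nc by (simp add: norm_mult)
        then have "c k = c l" using t by simp
        then show False using star_branch_inj[OF k l(1)] l(2) by (simp add: c_def)
      qed
      ultimately show "x \<in> ?R" using fx(2) by auto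
    qed
    show "?R \<subseteq> ?L"
    proof
      fix x assume x: "x \<in> ?R"
      then have "f x \<in> star n" "f x \<noteq> 0" using fU by auto
      then obtain t l where t: "0 \<le> t" "t < 1" "l < n" "f x = of_real t * c l"
        unfolding star_def c_def by auto
      have "f x = of_real (norm (f x)) * c l" using t nc by (simp add: norm_mult)
      then have "l = k" using x t(3) by auto
      moreover have "t > 0" using t \<open>f x \<noteq> 0\<close> by (cases "t = 0") auto
      moreover have "x = g (f x)" using gf x by auto
      ultimately show "x \<in> ?L" using t unfolding \<beta>_def by (auto intro!: image_eqI[of _ _ t])
    qed
  qed
  have contf: "continuous_map (subtopology X U) euclidean f"
    using g unfolding homeomorphic_maps_def by (simp add: continuous_map_in_subtopology)
  have contg: "continuous_map (top_of_set (star n)) X g"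
    using g unfolding homeomorphic_maps_def by (simp add: continuous_map_in_subtopology)
  have "branch_chart X P U n \<beta> \<rho>"
  proof
    show "openin X U" by fact
    show "continuous_map (top_of_set {0..<1}) X (\<beta> k)" if "k < n" for k
    proof -
      have "continuous_map (top_of_set {0..<1}) (top_of_set (star n)) (\<lambda>t. of_real t * c k)"
        using in_star[OF that] by (auto simp: continuous_map_in_subtopology intro!: continuous_intros)
      from continuous_map_compose[OF this contg] show ?thesis
        by (simp add: \<beta>_def[abs_def] o_def)
    qed
    show "\<beta> k 0 = P" if "k < n" for k using gf[OF U(2)] f0 by (simp add: \<beta>_def)
    show "\<rho> (\<beta> k t) = t" if "k < n" "t \<in> {0..<1}" for k t
      using fg(1)[OF in_star[OF that]] that nc by (simp add: \<beta>_def \<rho>_def norm_mult)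
    show "\<rho> P = 0" by (simp add: \<rho>_def f0)
    show "U = insert P (\<Union>k<n. \<beta> k ` {0<..<1})"
    proof
      show "U \<subseteq> insert P (\<Union>k<n. \<beta> k ` {0<..<1})"
      proof
        fix x assume x: "x \<in> U"
        show "x \<in> insert P (\<Union>k<n. \<beta> k ` {0<..<1})"
        proof (cases "f x = 0")
          case True
          then show ?thesis using gf[OF x] gf[OF U(2)] f0 by simp
        next
          case False
          then obtain t l where t: "0 \<le> t" "t < 1" "l < n" "f x = of_real t * c l"
            using fU[OF x] unfolding star_def c_def by auto
          moreover have "t > 0" using t False by (cases "t = 0") auto
          ultimately show ?thesis using gf[OF x] by (auto simp: \<beta>_def intro!: bexI[of _ l] image_eqI[of _ _ t])
        qed
      qed
      show "insert P (\<Union>k<n. \<beta> k ` {0<..<1}) \<subseteq> U"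
        using branch_img U(2) by auto
    qed
    show "continuous_map (subtopology X U) euclideanreal \<rho>"
      unfolding \<rho>_def using contf by (rule continuous_map_norm)
    show "openin X (\<beta> k ` {0<..<1})" if "k < n" for k
    proof -
      have "open (- ({0} \<union> (\<Union>l\<in>{..<n}-{k}. {z. z = of_real (norm z) * c l})))"
        using ray_closed by (intro open_Compl closed_Un closed_UN) auto
      then have "openin (subtopology X U) {x \<in> topspace (subtopology X U). f x \<in> - ({0} \<union> (\<Union>l\<in>{..<n}-{k}. {z. z = of_real (norm z) * c l}))}"
        by (intro openin_continuous_map_preimage[OF contf]) auto
      then show ?thesis unfolding branch_img[OF that] topU
        using openin_trans_full U(1) by blast
    qed
    show "\<beta> k ` {0<..<1} \<inter> \<beta> l ` {0<..<1} = {}" if "k < n" "l < n" "k \<noteq> l" for k l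
    proof -
      have "c k \<noteq> c l" using star_branch_inj[OF that(1,2)] that(3) by (auto simp: c_def)
      have "\<beta> k s \<noteq> \<beta> l t" if st: "s \<in> {0<..<1}" "t \<in> {0<..<1}" for s t
      proof
        assume eq: "\<beta> k s = \<beta> l t"
        have "of_real s * c k = f (\<beta> k s)" "of_real t * c l = f (\<beta> l t)"
          using fg(1) in_star st \<open>k < n\<close> \<open>l < n\<close> by (auto simp: \<beta>_def)
        then have e: "of_real s * c k = of_real t * c l" using eq by simp
        then have "s = t" using nc st by (metis norm_mult norm_of_real mult.right_neutral abs_of_pos greaterThanLessThan_iff)
        then show False using e st \<open>c k \<noteq> c l\<close> by simp
      qed
      then show ?thesis by blast
    qed
  qed
  then show ?thesis by (rule that)
qed

context branch_chart
begin

text \<open>The smaller stars with the same centre; they are a base of connected open neighbourhoods of \<open>P\<close>.\<close>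

definition sball :: "real \<Rightarrow> 'a set" where
  "sball eps = insert P (\<Union>k<n. \<beta> k ` {0<..<eps})"

lemma branch_subset: "k < n \<Longrightarrow> eps \<le> 1 \<Longrightarrow> \<beta> k ` {0<..<eps} \<subseteq> U - {P}"
proof
  fix x assume a: "k < n" "eps \<le> 1" "x \<in> \<beta> k ` {0<..<eps}"
  then obtain t where t: "0 < t" "t < eps" "x = \<beta> k t" by auto
  then have "\<rho> x = t" using radius_branch[OF a(1), of t] a by auto
  then have "x \<noteq> P" using t radius_P by auto
  moreover have "x \<in> \<beta> k ` {0<..<1}" using t a by auto
  then have "x \<in> U" unfolding U_eq using a by blast
  ultimately show "x \<in> U - {P}" by simp
qed

lemma U_space: "U \<subseteq> topspace X" using open_U openin_subset by blast

lemma P_space: "P \<in> topspace X" using U_space U_eq by blast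

lemma branch_inj: "k < n \<Longrightarrow> inj_on (\<beta> k) {0..<1}"
  by (rule inj_on_inverseI[of _ \<rho>]) (rule radius_branch)

lemma sball_eq:
  assumes "eps \<le> 1" "0 < eps"
  shows "sball eps = {x \<in> U. \<rho> x < eps}"
proof
  show "sball eps \<subseteq> {x \<in> U. \<rho> x < eps}"
    using assms branch_subset radius_branch radius_P unfolding sball_def by (fastforce simp: U_eq)
  show "{x \<in> U. \<rho> x < eps} \<subseteq> sball eps"
    using radius_branch unfolding sball_def by (auto simp: U_eq)
qed

lemma open_sball:
  assumes "eps \<le> 1" "0 < eps"
  shows "openin X (sball eps)"
proof -
  have "openin (subtopology X U) {x \<in> topspace (subtopology X U). \<rho> x \<in> {..<eps}}"
    by (intro openin_continuous_map_preimage[OF cont_radius]) auto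
  moreover have "topspace (subtopology X U) = U" using U_space by (rule topspace_subtopology_subset)
  ultimately have "openin (subtopology X U) (sball eps)"
    unfolding sball_eq[OF assms] by (simp only: lessThan_iff)
  then show ?thesis using openin_trans_full open_U by blast
qed

lemma small_sball:
  assumes "openin X N" "P \<in> N"
  obtains eps where "0 < eps" "eps \<le> 1" "sball eps \<subseteq> N"
proof -
  have "\<exists>e. 0 < e \<and> e \<le> 1 \<and> \<beta> k ` {0<..<e} \<subseteq> N" if "k < n" for k
  proof -
    have "openin (top_of_set {0..<1}) {t \<in> topspace (top_of_set {0..<1}). \<beta> k t \<in> N}"
      using cont_branch[OF that] assms(1) by (rule openin_continuous_map_preimage)
    then obtain T where "open T" and T: "{t \<in> {0..<1}. \<beta> k t \<in> N} = {0..<1} \<inter> T"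
      by (auto simp: openin_open)
    have "0 \<in> {t \<in> {0..<1}. \<beta> k t \<in> N}" using branch_0[OF that] assms(2) by simp
    then have "0 \<in> T" unfolding T by simp
    then obtain e where "e > 0" "ball 0 e \<subseteq> T" using \<open>open T\<close> open_contains_ball by blast
    then have "{0<..<min e 1} \<subseteq> {0..<1} \<inter> T" by (auto simp: subset_iff)
    then have "\<beta> k ` {0<..<min e 1} \<subseteq> N" unfolding T[symmetric] by auto
    then show ?thesis using \<open>e > 0\<close> by (intro exI[of _ "min e 1"]) auto
  qed
  then obtain e where e: "\<And>k. k < n \<Longrightarrow> 0 < e k \<and> e k \<le> 1 \<and> \<beta> k ` {0<..<e k} \<subseteq> N" by metis
  define eps where "eps = Min (insert 1 (e ` {..<n}))"
  have "0 < eps" "eps \<le> 1" using e by (auto simp: eps_def)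
  moreover have "eps \<le> e k" if "k < n" for k using that by (auto simp: eps_def)
  then have "sball eps \<subseteq> N" using e assms(2) unfolding sball_def by fastforce
  ultimately show ?thesis using that by blast
qed

lemma connected_branch_image:
  assumes "k < n" "connected T" "T \<subseteq> {0..<1}"
  shows "connectedin X (\<beta> k ` T)"
  by (rule connectedin_continuous_map_image[OF cont_branch[OF assms(1)]])
     (use assms in \<open>auto simp: connectedin_subtopology\<close>)

lemma connected_branch: "k < n \<Longrightarrow> eps \<le> 1 \<Longrightarrow> connectedin X (\<beta> k ` {0<..<eps})"
  by (rule connected_branch_image) auto

lemma connected_sball:
  assumes "0 < eps" "eps \<le> 1"
  shows "connectedin X (sball eps)"
proof -
  have "sball eps = \<Union> (insert {P} ((\<lambda>k. \<beta> k ` {0..<eps}) ` {..<n}))"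
  proof -
    have "\<beta> k ` {0..<eps} = insert P (\<beta> k ` {0<..<eps})" if "k < n" for k
    proof -
      have "{0..<eps} = insert 0 {0<..<eps}" using assms by auto
      then show ?thesis using branch_0[OF that] by simp
    qed
    then show ?thesis unfolding sball_def by auto
  qed
  moreover have "connectedin X (\<Union> (insert {P} ((\<lambda>k. \<beta> k ` {0..<eps}) ` {..<n})))"
  proof (rule connectedin_Union)
    show "connectedin X S" if "S \<in> insert {P} ((\<lambda>k. \<beta> k ` {0..<eps}) ` {..<n})" for S
      using that assms P_space by (auto intro!: connected_branch_image)
    have "P \<in> \<Inter> (insert {P} ((\<lambda>k. \<beta> k ` {0..<eps}) ` {..<n}))"
      using branch_0 assms by (auto intro!: image_eqI[of P _ 0] dest: sym)
    then show "\<Inter> (insert {P} ((\<lambda>k. \<beta> k ` {0..<eps}) ` {..<n})) \<noteq> {}" by blast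
  qed
  ultimately show ?thesis by simp
qed

lemma branch_at_P: "k < n \<Longrightarrow> 0 < eps \<Longrightarrow> eps \<le> 1 \<Longrightarrow> P \<in> X closure_of (\<beta> k ` {0<..<eps})"
  unfolding in_closure_of
proof (intro conjI allI impI)
  fix N assume a: "k < n" "0 < eps" "eps \<le> 1" "P \<in> N \<and> openin X N"
  then obtain e where e: "0 < e" "sball e \<subseteq> N" using small_sball by blast
  define t where "t = min e eps / 2"
  have "0 < t" "t < e" "t < eps" using e a by (auto simp: t_def)
  then have "\<beta> k t \<in> \<beta> k ` {0<..<eps}" "\<beta> k t \<in> \<beta> k ` {0<..<e}" using \<open>0 < t\<close> by simp_all
  moreover from this(2) have "\<beta> k t \<in> N" using e(2) a(1) unfolding sball_def by blast
  ultimately show "\<exists>y. y \<in> \<beta> k ` {0<..<eps} \<and> y \<in> N" by blast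
qed (rule P_space)

lemma connected_in_branch:
  assumes "connectedin X C" "C \<subseteq> U - {P}" "C \<noteq> {}"
  obtains k where "k < n" "C \<subseteq> \<beta> k ` {0<..<1}"
proof -
  obtain x where "x \<in> C" using assms by blast
  then obtain k where k: "k < n" "x \<in> \<beta> k ` {0<..<1}" using assms U_eq by blast
  let ?A = "\<beta> k ` {0<..<1}" and ?B = "\<Union>l\<in>{..<n}-{k}. \<beta> l ` {0<..<1}"
  have "openin X ?A" "openin X ?B" using open_branch k by auto
  moreover have "C \<subseteq> ?A \<union> ?B" using assms(2) U_eq k by auto
  moreover have "?A \<inter> ?B \<inter> C = {}" using disjoint_branches k by blast
  moreover have "?A \<inter> C \<noteq> {}" using k \<open>x \<in> C\<close> by blast
  ultimately have "?B \<inter> C = {}" using assms(1) unfolding connectedin by blast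
  with \<open>C \<subseteq> ?A \<union> ?B\<close> have "C \<subseteq> ?A" by blast
  then show ?thesis by (rule that[OF k(1)])
qed

text \<open>The distances from the centre that are attained on \<open>C\<close> form an interval with infimum 0.\<close>

lemma germ_in_connected:
  assumes "k < n" "connectedin X C" "C \<subseteq> \<beta> k ` {0<..<1}" "P \<in> X closure_of C"
  obtains \<delta> where "0 < \<delta>" "\<delta> \<le> 1" "\<beta> k ` {0<..<\<delta>} \<subseteq> C"
proof -
  have CU: "C \<subseteq> U" using assms branch_subset by blast
  have "connectedin (subtopology X U) C" using assms(2) CU by (simp add: connectedin_subtopology)
  from connectedin_continuous_map_image[OF cont_radius this]
  have conn: "connected (\<rho> ` C)" by simp
  obtain x where x: "x \<in> C" using assms(4) by (metis closure_of_empty empty_iff ex_in_conv)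
  then obtain t where t: "x = \<beta> k t" "0 < t" "t < 1" using assms by auto
  have \<rho>x: "\<rho> x = t" using radius_branch[OF assms(1)] t by auto
  have "\<beta> k s \<in> C" if s: "0 < s" "s < t" for s
  proof -
    have "P \<in> sball s" by (simp add: sball_def)
    moreover have "openin X (sball s)" using s t by (intro open_sball) auto
    ultimately obtain y where y: "y \<in> C" "y \<in> sball s" using assms(4) unfolding in_closure_of by blast
    then have "\<rho> y < s" using sball_eq[of s] s t by auto
    then have "s \<in> \<rho> ` C" using conn y(1) x \<rho>x s by (metis connectedD_interval image_eqI less_imp_le)
    then obtain z where z: "z \<in> C" "\<rho> z = s" by auto
    then obtain u where "z = \<beta> k u" "0 < u" "u < 1" using assms by auto
    then show ?thesis using z radius_branch[OF assms(1)] by auto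
  qed
  then have "\<beta> k ` {0<..<t} \<subseteq> C" by auto
  then show ?thesis using that[of t] t by simp
qed

lemma components_branches:
  "connected_components_of (subtopology X (U - {P})) = (\<lambda>k. \<beta> k ` {0<..<1}) ` {..<n}"
proof -
  have top: "topspace (subtopology X (U - {P})) = U - {P}" using U_space by auto
  have comp: "\<beta> k ` {0<..<1} \<in> connected_components_of (subtopology X (U - {P}))" if k: "k < n" for k
  proof -
    have con: "connectedin (subtopology X (U - {P})) (\<beta> k ` {0<..<1})"
      using connected_branch[OF k] branch_subset[OF k] by (simp add: connectedin_subtopology)
    have "\<beta> k ` {0<..<1} \<subseteq> topspace (subtopology X (U - {P}))"
      unfolding top by (rule branch_subset[OF k]) simp
    moreover have "\<beta> k ` {0<..<1} \<noteq> {}" by simp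
    ultimately have "topspace (subtopology X (U - {P})) \<noteq> {}" by (metis subset_empty)
    then have "subtopology X (U - {P}) \<noteq> trivial_topology" by (metis null_topspace_iff_trivial)
    then obtain C where C: "C \<in> connected_components_of (subtopology X (U - {P}))" "\<beta> k ` {0<..<1} \<subseteq> C"
      using exists_connected_component_of_superset[OF con] by metis
    then have "connectedin (subtopology X (U - {P})) C" "C \<noteq> {}"
      using connectedin_connected_components_of nonempty_connected_components_of by blast+
    then obtain l where l: "l < n" "C \<subseteq> \<beta> l ` {0<..<1}"
      using connected_in_branch[of C] by (auto simp: connectedin_subtopology)
    have "\<beta> k (1/2) \<in> \<beta> k ` {0<..<1}" by simp
    then have "l = k" using disjoint_branches[OF l(1) k] C(2) l(2) by blast
    then show ?thesis using C l by (metis subset_antisym)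
  qed
  show ?thesis
  proof
    show "(\<lambda>k. \<beta> k ` {0<..<1}) ` {..<n} \<subseteq> connected_components_of (subtopology X (U - {P}))"
      using comp by auto
    show "connected_components_of (subtopology X (U - {P})) \<subseteq> (\<lambda>k. \<beta> k ` {0<..<1}) ` {..<n}"
    proof
      fix C assume C: "C \<in> connected_components_of (subtopology X (U - {P}))"
      then have "connectedin (subtopology X (U - {P})) C" "C \<noteq> {}"
        using connectedin_connected_components_of nonempty_connected_components_of by blast+
      then obtain l where l: "l < n" "C \<subseteq> \<beta> l ` {0<..<1}"
        using connected_in_branch[of C] by (auto simp: connectedin_subtopology)
      have "C = \<beta> l ` {0<..<1}"
        using C comp[OF l(1)] l(2) \<open>C \<noteq> {}\<close> connected_components_of_disjoint
        by (metis disjnt_def inf.orderE)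
      then show "C \<in> (\<lambda>k. \<beta> k ` {0<..<1}) ` {..<n}" using l by auto
    qed
  qed
qed

end

text \<open>The valence of a point is well defined: near \<open>P\<close>, each branch of the second star lies in a branch
of the first and fills it near \<open>P\<close>, so that different branches of the second star, being disjoint,
use different branches of the first.\<close>

lemma star_nbhd_le:
  assumes "star_nbhd X P U n" "star_nbhd X P U' n'"
  shows "n' \<le> n"
proof -
  obtain \<beta> \<rho> where "branch_chart X P U n \<beta> \<rho>" using star_nbhd_imp_branch_chart[OF assms(1)] .
  then interpret b: branch_chart X P U n \<beta> \<rho> .
  obtain \<beta>' \<rho>' where "branch_chart X P U' n' \<beta>' \<rho>'" using star_nbhd_imp_branch_chart[OF assms(2)] .
  then interpret c: branch_chart X P U' n' \<beta>' \<rho>' .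
  have "P \<in> U" using assms(1) by (simp add: star_nbhd_def)
  then obtain eps where eps: "0 < eps" "eps \<le> 1" "c.sball eps \<subseteq> U" using c.small_sball b.open_U by blast
  have "\<exists>k<n. \<exists>\<delta>>0. \<beta> k ` {0<..<\<delta>} \<subseteq> \<beta>' j ` {0<..<eps}" if j: "j < n'" for j
  proof -
    let ?C = "\<beta>' j ` {0<..<eps}"
    have C: "connectedin X ?C" "?C \<subseteq> U - {P}" "?C \<noteq> {}"
      using c.connected_branch[OF j eps(2)] c.branch_subset[OF j eps(2)] eps j by (auto simp: c.sball_def)
    then obtain k where k: "k < n" "?C \<subseteq> \<beta> k ` {0<..<1}" using b.connected_in_branch by blast
    obtain \<delta> where "0 < \<delta>" "\<beta> k ` {0<..<\<delta>} \<subseteq> ?C"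
      using b.germ_in_connected[OF k(1) C(1) k(2) c.branch_at_P[OF j eps(1,2)]] .
    then show ?thesis using k(1) by (intro exI[of _ k] conjI exI[of _ \<delta>])
  qed
  then obtain k where k: "\<And>j. j < n' \<Longrightarrow> k j < n \<and> (\<exists>\<delta>>0. \<beta> (k j) ` {0<..<\<delta>} \<subseteq> \<beta>' j ` {0<..<eps})" by metis
  have "inj_on k {..<n'}"
  proof (rule inj_onI)
    fix i j assume ij: "i \<in> {..<n'}" "j \<in> {..<n'}" "k i = k j"
    obtain d e where d: "d > 0" "\<beta> (k i) ` {0<..<d} \<subseteq> \<beta>' i ` {0<..<eps}"
      and e: "e > 0" "\<beta> (k i) ` {0<..<e} \<subseteq> \<beta>' j ` {0<..<eps}" using k ij by (metis lessThan_iff)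
    define t where "t = min d e / 2"
    have "t \<in> {0<..<d}" "t \<in> {0<..<e}" using d e by (auto simp: t_def)
    then have "\<beta> (k i) t \<in> \<beta>' i ` {0<..<eps} \<inter> \<beta>' j ` {0<..<eps}" using d(2) e(2) by blast
    moreover have "\<beta>' l ` {0<..<eps} \<subseteq> \<beta>' l ` {0<..<1}" for l
      using eps(2) by (intro image_mono) auto
    ultimately have "\<beta> (k i) t \<in> \<beta>' i ` {0<..<1} \<inter> \<beta>' j ` {0<..<1}" by blast
    then show "i = j" using c.disjoint_branches[of i j] ij by (metis emptyE lessThan_iff)
  qed
  moreover have "k ` {..<n'} \<subseteq> {..<n}" using k by auto
  ultimately have "card {..<n'} \<le> card {..<n}" by (intro card_inj_on_le) auto
  then show ?thesis by simp
qed

lemma valence_eq: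
  assumes "star_nbhd X P U n"
  shows "valence X P = n"
  unfolding valence_def
proof (rule the_equality)
  show "\<exists>U. star_nbhd X P U n" using assms by blast
  show "m = n" if "\<exists>U. star_nbhd X P U m" for m
    using that assms star_nbhd_le le_antisym by metis
qed

text \<open>Invariance of domain in dimension one: at a point of valence two, disjoint germs lie in different
branches, so two of them fill a neighbourhood.\<close>

lemma two_germs_nbhd:
  assumes "star_nbhd X P U 2"
    and A: "connectedin X A" "A \<subseteq> U - {P}" "P \<in> X closure_of A"
    and B: "connectedin X B" "B \<subseteq> U - {P}" "P \<in> X closure_of B"
    and "A \<inter> B = {}"
  obtains N where "openin X N" "P \<in> N" "N \<subseteq> insert P (A \<union> B)"
proof -
  obtain \<beta> \<rho> where "branch_chart X P U 2 \<beta> \<rho>" using star_nbhd_imp_branch_chart[OF assms(1)] .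
  then interpret b: branch_chart X P U 2 \<beta> \<rho> .
  have ne: "A \<noteq> {}" "B \<noteq> {}" using A B by auto
  obtain k where k: "k < 2" "A \<subseteq> \<beta> k ` {0<..<1}" using b.connected_in_branch[OF A(1,2) ne(1)] .
  obtain l where l: "l < 2" "B \<subseteq> \<beta> l ` {0<..<1}" using b.connected_in_branch[OF B(1,2) ne(2)] .
  obtain d where d: "0 < d" "d \<le> 1" "\<beta> k ` {0<..<d} \<subseteq> A" using b.germ_in_connected[OF k(1) A(1) k(2) A(3)] .
  obtain e where e: "0 < e" "e \<le> 1" "\<beta> l ` {0<..<e} \<subseteq> B" using b.germ_in_connected[OF l(1) B(1) l(2) B(3)] .
  define t where "t = min d e"
  have t: "0 < t" "t \<le> d" "t \<le> e" using d e by (auto simp: t_def)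
  have "k \<noteq> l"
  proof
    assume "k = l"
    have "t / 2 \<in> {0<..<d}" "t / 2 \<in> {0<..<e}" using t by auto
    then have "\<beta> k (t/2) \<in> A \<inter> B" using d e \<open>k = l\<close> by blast
    then show False using assms by blast
  qed
  then have "{..<2} = {k, l}" using k l by auto
  then have "b.sball t \<subseteq> insert P (A \<union> B)" using d(3) e(3) t unfolding b.sball_def by fastforce
  moreover have "openin X (b.sball t)" using t d by (intro b.open_sball) auto
  ultimately show ?thesis using that by (auto simp: b.sball_def)
qed

section \<open>Edges of a metric graph\<close>

lemma t1_graph: "topological_graph X \<Longrightarrow> t1_space X"
  by (simp add: topological_graph_def Hausdorff_imp_t1_space)

lemma connectedin_finite_t1:
  assumes "t1_space X" "connectedin X S" "finite S" "S \<noteq> {}"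
  shows "\<exists>v. S = {v}"
proof -
  obtain v where v: "v \<in> S" using assms(4) by blast
  have sub: "S \<subseteq> topspace X" using assms(2) by (rule connectedin_subset_topspace)
  then have "closedin X {v}" "closedin X (S - {v})"
    using assms(1,3) v by (auto simp: t1_space_closedin_finite)
  moreover have "S \<subseteq> {v} \<union> (S - {v})" "{v} \<inter> (S - {v}) \<inter> S = {}" "{v} \<inter> S \<noteq> {}" using v by auto
  ultimately have "(S - {v}) \<inter> S = {}" using assms(2) unfolding connectedin_closedin by blast
  then show ?thesis using v by blast
qed

lemma closedin_finite_graph:
  assumes "topological_graph X" "finite S" "S \<subseteq> topspace X"
  shows "closedin X S"
  using t1_graph[OF assms(1)] assms by (simp add: t1_space_closedin_finite)

lemma graph_chart:
  assumes "topological_graph X" "P \<in> topspace X"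
  obtains U n \<beta> \<rho> where "branch_chart X P U n \<beta> \<rho>"
    "directions X P = (\<lambda>k. \<beta> k ` {0<..<1}) ` {..<n}" "star_nbhd X P U n"
proof -
  define U where "U = (SOME U. \<exists>n. star_nbhd X P U n)"
  have "\<exists>U. \<exists>n. star_nbhd X P U n" using assms by (auto simp: topological_graph_def)
  from someI_ex[OF this] obtain n where n: "star_nbhd X P U n" unfolding U_def by blast
  obtain \<beta> \<rho> where b: "branch_chart X P U n \<beta> \<rho>" using star_nbhd_imp_branch_chart[OF n] .
  show ?thesis
    using that[OF b _ n] branch_chart.components_branches[OF b] by (simp add: directions_def U_def)
qed

lemma valence_chart:
  assumes "topological_graph X" "P \<in> topspace X"
  obtains U where "star_nbhd X P U (valence X P)"
  using assms valence_eq unfolding topological_graph_def by metis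

lemma small_connected_nbhd:
  assumes "topological_graph X" "openin X N" "x \<in> N"
  obtains M where "openin X M" "connectedin X M" "x \<in> M" "M \<subseteq> N"
proof -
  have "x \<in> topspace X" using assms openin_subset by blast
  then obtain U n \<beta> \<rho> where "branch_chart X x U n \<beta> \<rho>" using graph_chart[OF assms(1)] by metis
  then interpret b: branch_chart X x U n \<beta> \<rho> .
  obtain eps where "0 < eps" "eps \<le> 1" "b.sball eps \<subseteq> N" using b.small_sball assms by blast
  then show ?thesis using that[of "b.sball eps"] b.open_sball b.connected_sball by (simp add: b.sball_def)
qed

text \<open>An isolated point would be a component of the connected space.\<close>

lemma no_isolated_point:
  assumes "topological_graph X" "openin X N" "x \<in> N" "y \<in> topspace X" "y \<noteq> x"
  obtains z where "z \<in> N" "z \<noteq> x"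
proof -
  have x: "x \<in> topspace X" using assms openin_subset by blast
  have "N \<noteq> {x}"
  proof
    assume "N = {x}"
    moreover have "closedin X {x}" using closedin_finite_graph[OF assms(1), of "{x}"] x by simp
    moreover have "connected_space X" using assms(1) by (simp add: topological_graph_def)
    ultimately have "{x} = topspace X" using assms(2) unfolding connected_space_clopen_in by blast
    then show False using assms by blast
  qed
  then show ?thesis using that assms by blast
qed

lemma edge_connected: "e \<in> edges G V \<Longrightarrow> connectedin (mg_top G) e"
  and edge_nonempty: "e \<in> edges G V \<Longrightarrow> e \<noteq> {}"
  and edge_subset: "e \<in> edges G V \<Longrightarrow> e \<subseteq> points G - V"
  unfolding edges_def points_def
    apply (metis connectedin_connected_components_of connectedin_subtopology)
   apply (erule nonempty_connected_components_of)
  apply (drule connected_components_of_subset)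
  apply auto
  done

lemma edge_unique: "e \<in> edges G V \<Longrightarrow> e' \<in> edges G V \<Longrightarrow> x \<in> e \<Longrightarrow> x \<in> e' \<Longrightarrow> e = e'"
  unfolding edges_def by (metis connected_components_of_disjoint disjnt_iff)

lemma edge_exists: "x \<in> points G - V \<Longrightarrow> \<exists>e\<in>edges G V. x \<in> e"
proof -
  assume "x \<in> points G - V"
  then have "x \<in> topspace (subtopology (mg_top G) (points G - V))" by (auto simp: points_def)
  then show ?thesis unfolding edges_def by (metis Union_connected_components_of UnionE)
qed

lemma edge_maximal:
  assumes "e \<in> edges G V" "connectedin (mg_top G) C" "C \<inter> V = {}" "x \<in> C" "x \<in> e"
  shows "C \<subseteq> e"
proof -
  have "C \<subseteq> points G - V" using assms connectedin_subset_topspace by (fastforce simp: points_def)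
  then have "connectedin (subtopology (mg_top G) (points G - V)) C"
    using assms by (simp add: connectedin_subtopology)
  moreover have "\<not> disjnt e C" using assms by (auto simp: disjnt_def)
  ultimately show ?thesis using assms(1) connected_components_of_maximal unfolding edges_def by metis
qed

lemma edge_closure: "e \<in> edges G V \<Longrightarrow> closed_edge G e - V = e"
proof -
  assume e: "e \<in> edges G V"
  then have "closedin (subtopology (mg_top G) (points G - V)) e"
    unfolding edges_def by (rule closedin_connected_components_of)
  then obtain T where T: "closedin (mg_top G) T" "e = T \<inter> (points G - V)"
    by (auto simp: closedin_subtopology)
  then have "mg_top G closure_of e \<subseteq> T" by (simp add: closure_of_minimal)
  moreover have "e \<subseteq> mg_top G closure_of e" using edge_subset[OF e] by (intro closure_of_subset) (auto simp: points_def)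
  moreover have "mg_top G closure_of e \<subseteq> points G" by (simp add: points_def closure_of_subset_topspace)
  ultimately show ?thesis using T(2) edge_subset[OF e] unfolding closed_edge_def by blast
qed

lemma edge_open:
  assumes "topological_graph (mg_top G)" "finite V" "V \<subseteq> points G" "e \<in> edges G V"
  shows "openin (mg_top G) e"
proof (subst openin_subopen, intro ballI)
  fix x assume x: "x \<in> e"
  have "openin (mg_top G) (points G - V)"
    using closedin_finite_graph[OF assms(1,2)] assms(3) by (auto simp: points_def)
  moreover have "x \<in> points G - V" using edge_subset[OF assms(4)] x by blast
  ultimately obtain M where M: "openin (mg_top G) M" "connectedin (mg_top G) M" "x \<in> M" "M \<subseteq> points G - V"
    by (rule small_connected_nbhd[OF assms(1)])
  then have "M \<subseteq> e" using edge_maximal[OF assms(4) M(2) _ M(3) x] by blast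
  then show "\<exists>T. openin (mg_top G) T \<and> x \<in> T \<and> T \<subseteq> e" using M by blast
qed

lemma metric_graph_top: "metric_graph G \<Longrightarrow> topological_graph (mg_top G)"
  by (simp add: metric_graph_def)

lemma infinite_point_vertex:
  assumes "metric_graph G" "vertex_set G V"
  shows "mg_inf G \<subseteq> V"
proof
  fix P assume "P \<in> mg_inf G"
  then have "P \<in> points G" "valence (mg_top G) P = 1" using assms(1) unfolding metric_graph_def by auto
  then have "P \<in> essential_vertices (mg_top G)" by (simp add: essential_vertices_def points_def)
  then show "P \<in> V" using assms(2) unfolding vertex_set_def by blast
qed

lemma edge_finite_points:
  assumes "metric_graph G" "vertex_set G V" "e \<in> edges G V"
  shows "e \<subseteq> finite_points G"
  using infinite_point_vertex[OF assms(1,2)] edge_subset[OF assms(3)] by (auto simp: finite_points_def)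

lemma vertex_set_edge_open:
  assumes "metric_graph G" "vertex_set G V" "e \<in> edges G V"
  shows "openin (mg_top G) e"
  using assms by (intro edge_open) (auto simp: metric_graph_def vertex_set_def)

lemma dist_pos:
  assumes "metric_graph G" "x \<in> finite_points G" "y \<in> finite_points G" "x \<noteq> y"
  shows "mg_dist G x y > 0"
proof -
  have "Metric_space (finite_points G) (mg_dist G)" using assms(1) by (simp add: metric_graph_def)
  then show ?thesis using assms by (simp add: Metric_space.mdist_pos_less)
qed

text \<open>Near \<open>x\<close> there is a second point of both sets, at a positive distance from \<open>x\<close>, and it determines
the dilation factor.\<close>

lemma dilates_on_unique:
  assumes "metric_graph G'" "openin (mg_top G') A" "openin (mg_top G') B"
    and "A \<subseteq> finite_points G'" "x \<in> A" "x \<in> B" "y \<in> points G'" "y \<noteq> x"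
    and A: "dilates_on G' G \<phi> A k" and B: "dilates_on G' G \<phi> B l"
  shows "k = l"
proof -
  obtain N where N: "openin (mg_top G') N" "x \<in> N"
    "\<And>y z. y \<in> A \<inter> N \<Longrightarrow> z \<in> A \<inter> N \<Longrightarrow> mg_dist G (\<phi> y) (\<phi> z) = real k * mg_dist G' y z"
    using A assms(5) unfolding dilates_on_def by meson
  obtain M where M: "openin (mg_top G') M" "x \<in> M"
    "\<And>y z. y \<in> B \<inter> M \<Longrightarrow> z \<in> B \<inter> M \<Longrightarrow> mg_dist G (\<phi> y) (\<phi> z) = real l * mg_dist G' y z"
    using B assms(6) unfolding dilates_on_def by meson
  have "openin (mg_top G') (A \<inter> B \<inter> (N \<inter> M))" using assms N M by (intro openin_Int)
  then obtain z where z: "z \<in> A \<inter> B \<inter> (N \<inter> M)" "z \<noteq> x"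
    using no_isolated_point[OF metric_graph_top[OF assms(1)], of "A \<inter> B \<inter> (N \<inter> M)" x y] assms N M
    by (auto simp: points_def)
  have "real k * mg_dist G' x z = real l * mg_dist G' x z"
    using N(3)[of x z] M(3)[of x z] z assms N(2) M(2) by auto
  moreover have "mg_dist G' x z > 0" using dist_pos[OF assms(1)] z assms by blast
  ultimately show ?thesis by simp
qed

text \<open>The definition of a morphism restricts only edges whose image lies in one closed edge. An edge \<open>e'\<close>
on which \<open>\<phi>\<close> is not constant is such an edge: being connected, it is not mapped into the finite set
\<open>V\<close>, so one of its points lies over an open edge \<open>e\<close>, and as the part of \<open>G'\<close> over the closure of
\<open>e\<close> is a union of closed edges and vertices, all of \<open>e'\<close> lies over that closure.\<close>

lemma edge_image:
  assumes G: "metric_graph G'" and E: "metric_graph G" and m: "morphism_wrt G' G \<phi> V' V"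
    and e': "e' \<in> edges G' V'" and nc: "\<not> (\<exists>v. \<phi> ` e' = {v})"
  obtains e k where "e \<in> edges G V" "bij_betw \<phi> e' e" "k > 0" "dilates_on G' G \<phi> e' k"
proof -
  have cont: "continuous_map (mg_top G') (mg_top G) \<phi>" and V: "vertex_set G V" "vertex_set G' V'"
    using m by (auto simp: morphism_wrt_def)
  have sp: "e' \<subseteq> topspace (mg_top G')" using edge_subset[OF e'] by (auto simp: points_def)
  have conn: "connectedin (mg_top G) (\<phi> ` e')"
    using connectedin_continuous_map_image[OF cont edge_connected[OF e']] .
  have "\<not> \<phi> ` e' \<subseteq> V"
  proof
    assume "\<phi> ` e' \<subseteq> V"
    then have fin: "finite (\<phi> ` e')" using V finite_subset by (auto simp: vertex_set_def)
    have "\<exists>v. \<phi> ` e' = {v}"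
      using connectedin_finite_t1[OF t1_graph[OF metric_graph_top[OF E]] conn fin] edge_nonempty[OF e'] by (metis image_is_empty)
    then show False using nc by blast
  qed
  then obtain x where x: "x \<in> e'" "\<phi> x \<notin> V" by auto
  have "\<phi> x \<in> points G" using continuous_map_image_subset_topspace[OF cont] x sp by (auto simp: points_def)
  then have "\<phi> x \<in> points G - V" using x(2) by simp
  from edge_exists[OF this] obtain e where e: "e \<in> edges G V" "\<phi> x \<in> e" ..
  have "\<phi> x \<in> closed_edge G e" using edge_closure[OF e(1)] e(2) by blast
  moreover obtain F W where F: "F \<subseteq> edges G' V'" "W \<subseteq> V'"
    "{x \<in> points G'. \<phi> x \<in> closed_edge G e} = (\<Union>e'\<in>F. closed_edge G' e') \<union> W"
    using m e(1) unfolding morphism_wrt_def by meson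
  ultimately have "x \<in> (\<Union>e'\<in>F. closed_edge G' e') \<union> W" using x sp by (auto simp: points_def)
  moreover have xV: "x \<notin> V'" using edge_subset[OF e'] x by blast
  ultimately obtain e'' where e'': "e'' \<in> F" "x \<in> closed_edge G' e''" using F(2) by blast
  then have "x \<in> e''" using edge_closure F(1) xV by blast
  then have "e'' = e'" using edge_unique[of e'' G' V' e' x] e''(1) F(1) e' x(1) by blast
  have "closed_edge G' e' \<subseteq> {x \<in> points G'. \<phi> x \<in> closed_edge G e}"
    using F(3) e''(1) \<open>e'' = e'\<close> by blast
  moreover have "e' \<subseteq> closed_edge G' e'" using edge_closure[OF e'] by blast
  ultimately have "\<phi> ` e' \<subseteq> closed_edge G e" by blast
  then have "(\<exists>v\<in>V. \<phi> ` e' = {v}) \<or> (bij_betw \<phi> e' e \<and> (\<exists>k>0. dilates_on G' G \<phi> e' k))"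
    using m e(1) e' unfolding morphism_wrt_def by meson
  then show ?thesis using nc that e(1) by blast
qed

section \<open>Morphisms of degree two\<close>

text \<open>The vertex sets are the ones that witness the finiteness of \<open>\<phi>\<close>. A second point in \<open>G\<close> ensures
that there is a direction at every point.\<close>

locale degree_two_morphism =
  fixes G :: "'a mgraph" and E :: "'b mgraph" and \<phi> :: "'a \<Rightarrow> 'b" and V' V
  assumes G: "metric_graph G" and E: "metric_graph E"
    and morph: "morphism_wrt G E \<phi> V' V"
    and pos: "\<And>e. e \<in> edges G V' \<Longrightarrow> edge_degree G E \<phi> e > 0"
    and surj: "\<phi> ` points G = points E"
    and harmonic: "\<And>P. P \<in> points G \<Longrightarrow> harmonic_at G E \<phi> P"
    and deg2: "has_degree G E \<phi> 2"
    and two_points: "\<exists>x\<in>points G. \<exists>y\<in>points G. x \<noteq> y"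
begin

abbreviation XG :: "'a topology" where "XG \<equiv> mg_top G"
abbreviation XE :: "'b topology" where "XE \<equiv> mg_top E"

lemma cont: "continuous_map XG XE \<phi>"
  and vG: "vertex_set G V'" and vE: "vertex_set E V" and VV: "\<phi> ` V' \<subseteq> V"
  using morph by (auto simp: morphism_wrt_def)

lemma tG: "topological_graph XG" and tE: "topological_graph XE"
  using G E by (auto intro: metric_graph_top)

lemma another_point: "\<exists>y\<in>points G. y \<noteq> x"
  using two_points by metis

lemma edge_bijection:
  assumes "e' \<in> edges G V'"
  obtains e k where "e \<in> edges E V" "bij_betw \<phi> e' e" "k > 0" "dilates_on G E \<phi> e' k"
proof -
  have "\<not> (\<exists>v. \<phi> ` e' = {v})" using pos[OF assms] by (auto simp: edge_degree_def)
  then show ?thesis using edge_image[OF G E morph assms] that by blast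
qed

lemma edge_degree_dilates:
  assumes e: "e' \<in> edges G V'"
  shows "dilates_on G E \<phi> e' (edge_degree G E \<phi> e')"
proof -
  obtain k where k: "k > 0" "dilates_on G E \<phi> e' k" using edge_bijection[OF e] by metis
  obtain x where x: "x \<in> e'" using edge_nonempty[OF e] by blast
  obtain y where y: "y \<in> points G" "y \<noteq> x" using another_point by blast
  have "l = k" if "dilates_on G E \<phi> e' l" for l
    using dilates_on_unique[OF G _ _ edge_finite_points[OF G vG e] x x y that k(2)]
      vertex_set_edge_open[OF G vG e] by blast
  moreover have "\<not> (\<exists>v. \<phi> ` e' = {v})" using pos[OF e] by (auto simp: edge_degree_def)
  moreover have "(THE k. dilates_on G E \<phi> e' k) = k" using k(2) calculation(1) by (rule the_equality)
  ultimately have "edge_degree G E \<phi> e' = k" unfolding edge_degree_def by (simp only: if_False)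
  then show ?thesis using k(2) by simp
qed

text \<open>Directions get their degree from an arbitrary pair of vertex sets. All pairs give the same degree,
because edges with two common points have the same dilation factor.\<close>

lemma edge_degree_independent:
  assumes m: "morphism_wrt G E \<phi> W' W" and e: "e \<in> edges G W'"
    and e': "e' \<in> edges G V'" and xy: "x \<in> e \<inter> e'" "y \<in> e \<inter> e'" "x \<noteq> y"
  shows "edge_degree G E \<phi> e = edge_degree G E \<phi> e'"
proof -
  have w: "vertex_set G W'" using m by (simp add: morphism_wrt_def)
  have "\<phi> x \<noteq> \<phi> y" using edge_bijection[OF e'] xy by (metis IntE bij_betw_def inj_onD)
  then have nc: "\<not> (\<exists>v. \<phi> ` e = {v})" using xy by (metis IntE image_eqI singletonD)
  have eq: "l = edge_degree G E \<phi> e'" if "dilates_on G E \<phi> e l" for l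
    using dilates_on_unique[OF G vertex_set_edge_open[OF G w e] vertex_set_edge_open[OF G vG e']
        edge_finite_points[OF G w e] _ _ _ _ that edge_degree_dilates[OF e'], of x y]
      xy edge_subset[OF e] by blast
  obtain l where l: "dilates_on G E \<phi> e l" using edge_image[OF G E m e nc] by metis
  have "(THE k. dilates_on G E \<phi> e k) = edge_degree G E \<phi> e'"
    using l eq by (intro the_equality) auto
  then show ?thesis using nc unfolding edge_degree_def[of G E \<phi> e] by simp
qed

text \<open>Near \<open>P\<close> a branch does not return to the fibre of \<open>P\<close>, because \<open>\<phi>\<close> is injective on edges and maps
vertices to vertices. This is what gives the branch an image direction.\<close>

lemma branch_edge:
  assumes "branch_chart XG P U n \<beta> \<rho>" "k < n"
  obtains e eps where "e \<in> edges G V'" "0 < eps" "eps \<le> 1" "\<beta> k ` {0<..<eps} \<subseteq> e"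
    "\<phi> P \<notin> \<phi> ` \<beta> k ` {0<..<eps}"
proof -
  interpret b: branch_chart XG P U n \<beta> \<rho> by fact
  have "closedin XG (V' - {P})"
    using vG by (intro closedin_finite_graph[OF tG]) (auto simp: vertex_set_def points_def)
  then have "openin XG (points G - (V' - {P}))" by (simp add: points_def openin_diff)
  moreover have "P \<in> points G - (V' - {P})" using b.P_space by (simp add: points_def)
  ultimately obtain eps1 where eps1: "0 < eps1" "eps1 \<le> 1" "b.sball eps1 \<subseteq> points G - (V' - {P})"
    by (rule b.small_sball)
  have s: "\<beta> k ` {0<..<eps1} \<subseteq> b.sball eps1" using assms(2) by (auto simp: b.sball_def)
  have c: "connectedin XG (\<beta> k ` {0<..<eps1})" by (rule b.connected_branch) fact+
  have disj: "\<beta> k ` {0<..<eps1} \<inter> V' = {}"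
    using s eps1(3) b.branch_subset[OF assms(2) eps1(2)] by blast
  have h: "\<beta> k (eps1/2) \<in> \<beta> k ` {0<..<eps1}" using eps1 by simp
  have "\<beta> k (eps1/2) \<in> points G - V'" using h s eps1(3) disj by blast
  from edge_exists[OF this] obtain e where e: "e \<in> edges G V'" "\<beta> k (eps1/2) \<in> e" ..
  have sub: "\<beta> k ` {0<..<eps1} \<subseteq> e" using edge_maximal[OF e(1) c disj h e(2)] by blast
  obtain f where f: "f \<in> edges E V" "bij_betw \<phi> e f" using edge_bijection[OF e(1)] by metis
  have "\<phi> P \<notin> \<phi> ` \<beta> k ` {0<..<eps1}"
  proof (cases "P \<in> V'")
    case True
    then have "\<phi> P \<in> V" using VV by blast
    moreover have "\<phi> ` e \<inter> V = {}" using f edge_subset[OF f(1)] by (auto simp: bij_betw_def)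
    ultimately have "\<phi> P \<notin> \<phi> ` e" by blast
    then show ?thesis using sub image_mono[OF sub, of \<phi>] by (metis subsetD)
  next
    case False
    then obtain e1 where e1: "e1 \<in> edges G V'" "P \<in> e1" using edge_exists b.P_space by (metis DiffI points_def)
    from b.small_sball[OF vertex_set_edge_open[OF G vG e1(1)] e1(2)]
    obtain d where d: "0 < d" "d \<le> 1" "b.sball d \<subseteq> e1" .
    define t where "t = min d eps1 / 2"
    have "t \<in> {0<..<d}" "t \<in> {0<..<eps1}" using d eps1 by (auto simp: t_def)
    moreover from this(1) have "\<beta> k t \<in> b.sball d" using assms(2) unfolding b.sball_def by blast
    ultimately have "\<beta> k t \<in> e1" "\<beta> k t \<in> e" using d sub by blast+
    then have "e1 = e" using edge_unique[OF e1(1) e(1)] by simp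
    then have "P \<in> e" using e1 by simp
    moreover have "P \<notin> \<beta> k ` {0<..<eps1}" using b.branch_subset[OF assms(2) eps1(2)] by blast
    moreover have "inj_on \<phi> e" using f by (auto simp: bij_betw_def)
    ultimately show ?thesis using sub inj_on_image_mem_iff by metis
  qed
  then show ?thesis using that e(1) eps1 sub by blast
qed

lemma direction_degree_eq:
  assumes b: "branch_chart XG P U n \<beta> \<rho>" and k: "k < n"
    and e: "e \<in> edges G V'" and eps: "0 < eps" "eps \<le> 1" "\<beta> k ` {0<..<eps} \<subseteq> e"
  shows "direction_degree G E \<phi> P (\<beta> k ` {0<..<1}) = edge_degree G E \<phi> e"
proof -
  interpret b: branch_chart XG P U n \<beta> \<rho> by fact
  let ?v = "\<beta> k ` {0<..<1}"
  have vs: "?v \<inter> b.sball eps \<subseteq> e"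
  proof
    fix x assume x: "x \<in> ?v \<inter> b.sball eps"
    then obtain t where t: "x = \<beta> k t" "0 < t" "t < 1" by auto
    have "\<rho> x < eps" using x b.sball_eq[of eps] eps by simp
    then have "t < eps" using t b.radius_branch[OF k, of t] by simp
    then show "x \<in> e" using eps(3) t by auto
  qed
  have "openin XG (b.sball eps)" "P \<in> b.sball eps" using eps b.open_sball by (auto simp: b.sball_def)
  then have d: "direction_defined_by G P ?v e" unfolding direction_defined_by_def using vs by blast
  show ?thesis unfolding direction_degree_def
  proof (rule the_equality)
    show "\<exists>V' V. morphism_wrt G E \<phi> V' V \<and>
        (\<exists>e'\<in>edges G V'. direction_defined_by G P ?v e' \<and> edge_degree G E \<phi> e = edge_degree G E \<phi> e')"
      using morph e d by blast
    fix d assume "\<exists>V' V. morphism_wrt G E \<phi> V' V \<and>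
        (\<exists>e'\<in>edges G V'. direction_defined_by G P ?v e' \<and> d = edge_degree G E \<phi> e')"
    then obtain W' W e' where m: "morphism_wrt G E \<phi> W' W" and e': "e' \<in> edges G W'"
      "direction_defined_by G P ?v e'" "d = edge_degree G E \<phi> e'" by blast
    obtain N where N: "openin XG N" "P \<in> N" "?v \<inter> N \<subseteq> e'"
      using e'(2) unfolding direction_defined_by_def by blast
    obtain c where c: "0 < c" "c \<le> 1" "b.sball c \<subseteq> N" using b.small_sball[OF N(1,2)] .
    define t where "t = min c eps / 2"
    have t: "0 < t" "t < c" "t < eps" using c eps by (auto simp: t_def)
    have in_both: "\<beta> k s \<in> e' \<inter> e" if s: "0 < s" "s \<le> t" for s
    proof -
      have "s \<in> {0<..<c}" "s \<in> {0<..<eps}" "s \<in> {0<..<1}" using s t c by auto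
      then have "\<beta> k s \<in> b.sball c" "\<beta> k s \<in> ?v" "\<beta> k s \<in> e" using k eps(3) unfolding b.sball_def by blast+
      then show ?thesis using N(3) c(3) by blast
    qed
    have "t \<in> {0..<1}" "t/2 \<in> {0..<1}" "t \<noteq> t/2" using t c by auto
    then have "\<beta> k t \<noteq> \<beta> k (t/2)" using b.branch_inj[OF k] by (meson inj_onD)
    then show "d = edge_degree G E \<phi> e"
      using edge_degree_independent[OF m e'(1) e, of "\<beta> k t" "\<beta> k (t/2)"] in_both[of t] in_both[of "t/2"] t e'(3) by auto
  qed
qed

lemma direction_degree_pos:
  assumes b: "branch_chart XG P U n \<beta> \<rho>" and k: "k < n"
  shows "direction_degree G E \<phi> P (\<beta> k ` {0<..<1}) > 0"
  using branch_edge[OF b k] direction_degree_eq[OF b k] pos by metis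

lemma direction_image:
  assumes b: "branch_chart XG P U n \<beta> \<rho>" and k: "k < n"
  obtains v where "v \<in> directions XE (\<phi> P)" "maps_direction G \<phi> P (\<beta> k ` {0<..<1}) v"
proof -
  interpret b: branch_chart XG P U n \<beta> \<rho> by fact
  have "\<phi> P \<in> topspace XE" using b.P_space cont by (auto simp: continuous_map_def)
  then obtain U1 m \<gamma> \<sigma> where c: "branch_chart XE (\<phi> P) U1 m \<gamma> \<sigma>"
    "directions XE (\<phi> P) = (\<lambda>k. \<gamma> k ` {0<..<1}) ` {..<m}" using graph_chart[OF tE] by metis
  interpret c: branch_chart XE "\<phi> P" U1 m \<gamma> \<sigma> by fact
  obtain e eps where eps: "e \<in> edges G V'" "0 < eps" "eps \<le> 1" "\<beta> k ` {0<..<eps} \<subseteq> e"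
    "\<phi> P \<notin> \<phi> ` \<beta> k ` {0<..<eps}" using branch_edge[OF b k] .
  have "openin XG {x \<in> topspace XG. \<phi> x \<in> U1}"
    using cont c.open_U by (rule openin_continuous_map_preimage)
  moreover have "P \<in> {x \<in> topspace XG. \<phi> x \<in> U1}" using b.P_space c.U_eq by blast
  ultimately obtain d where d: "0 < d" "d \<le> 1" "b.sball d \<subseteq> {x \<in> topspace XG. \<phi> x \<in> U1}"
    by (rule b.small_sball)
  define t where "t = min d eps"
  have t: "0 < t" "t \<le> d" "t \<le> eps" "t \<le> 1" using d eps by (auto simp: t_def)
  have s1: "\<beta> k ` {0<..<t} \<subseteq> \<beta> k ` {0<..<d}" "\<beta> k ` {0<..<t} \<subseteq> \<beta> k ` {0<..<eps}"
    using t by (auto intro!: image_mono)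
  have "\<beta> k ` {0<..<t} \<subseteq> b.sball d" using s1(1) k unfolding b.sball_def by blast
  then have "\<phi> ` \<beta> k ` {0<..<t} \<subseteq> U1" using d(3) by blast
  then have sub: "\<phi> ` \<beta> k ` {0<..<t} \<subseteq> U1 - {\<phi> P}" using eps(5) s1(2) by blast
  have conn: "connectedin XE (\<phi> ` \<beta> k ` {0<..<t})"
    using connectedin_continuous_map_image[OF cont b.connected_branch[OF k t(4)]] .
  have "\<phi> ` \<beta> k ` {0<..<t} \<noteq> {}" using t by simp
  then obtain j where j: "j < m" "\<phi> ` \<beta> k ` {0<..<t} \<subseteq> \<gamma> j ` {0<..<1}"
    using c.connected_in_branch[OF conn sub] by blast
  have "\<beta> k ` {0<..<1} \<inter> b.sball t \<subseteq> \<beta> k ` {0<..<t}"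
  proof
    fix x assume x: "x \<in> \<beta> k ` {0<..<1} \<inter> b.sball t"
    then obtain s where s: "x = \<beta> k s" "0 < s" "s < 1" by auto
    have "\<rho> x < t" using x b.sball_eq[of t] t by simp
    then show "x \<in> \<beta> k ` {0<..<t}" using s b.radius_branch[OF k, of s] by simp
  qed
  then have "\<phi> ` (\<beta> k ` {0<..<1} \<inter> b.sball t) \<subseteq> \<gamma> j ` {0<..<1}" using j(2) by blast
  moreover have "openin XG (b.sball t)" "P \<in> b.sball t" using t b.open_sball by (auto simp: b.sball_def)
  ultimately have "maps_direction G \<phi> P (\<beta> k ` {0<..<1}) (\<gamma> j ` {0<..<1})"
    unfolding maps_direction_def by blast
  then show ?thesis using that[of "\<gamma> j ` {0<..<1}"] c(2) j(1) by auto
qed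

text \<open>Local degrees are defined by a description that is meaningless where the target has no direction.
There is one at \<open>\<phi> P\<close>, namely the image of a direction at \<open>P\<close>.\<close>

lemma local_degree:
  assumes b: "branch_chart XG P U n \<beta> \<rho>" and dir: "directions XG P = (\<lambda>k. \<beta> k ` {0<..<1}) ` {..<n}"
  shows "n > 0" "k < n \<Longrightarrow> direction_degree G E \<phi> P (\<beta> k ` {0<..<1}) \<le> local_degree G E \<phi> P"
    "v \<in> directions XE (\<phi> P) \<Longrightarrow> degree_over G E \<phi> P v = local_degree G E \<phi> P"
proof -
  interpret b: branch_chart XG P U n \<beta> \<rho> by fact
  obtain y where "y \<in> points G" "y \<noteq> P" using another_point by blast
  then obtain z where z: "z \<in> U" "z \<noteq> P"
    using no_isolated_point[OF tG b.open_U, of P y] b.U_eq by (auto simp: points_def)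
  then show n: "n > 0" using b.U_eq by (cases n) auto
  obtain d where d: "\<And>v. v \<in> directions XE (\<phi> P) \<Longrightarrow> degree_over G E \<phi> P v = d"
    using harmonic[of P] b.P_space unfolding harmonic_at_def points_def by blast
  obtain v0 where "v0 \<in> directions XE (\<phi> P)" using direction_image[OF b n] by blast
  then have "local_degree G E \<phi> P = d" unfolding local_degree_def using d by (intro the_equality) metis+
  then show eq: "v \<in> directions XE (\<phi> P) \<Longrightarrow> degree_over G E \<phi> P v = local_degree G E \<phi> P" for v
    using d by simp
  show "direction_degree G E \<phi> P (\<beta> k ` {0<..<1}) \<le> local_degree G E \<phi> P" if k: "k < n"
  proof -
    obtain v where v: "v \<in> directions XE (\<phi> P)" "maps_direction G \<phi> P (\<beta> k ` {0<..<1}) v"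
      using direction_image[OF b k] .
    have "direction_degree G E \<phi> P (\<beta> k ` {0<..<1}) \<le> degree_over G E \<phi> P v"
      unfolding degree_over_def using dir k v
      by (intro member_le_sum[of "\<beta> k ` {0<..<1}" _ "direction_degree G E \<phi> P"]) auto
    then show ?thesis using eq[OF v(1)] by simp
  qed
qed

lemma local_degree_pos:
  assumes "P \<in> points G"
  shows "local_degree G E \<phi> P > 0"
proof -
  obtain U n \<beta> \<rho> where b: "branch_chart XG P U n \<beta> \<rho>"
    "directions XG P = (\<lambda>k. \<beta> k ` {0<..<1}) ` {..<n}"
    using graph_chart[OF tG, of P] assms by (metis points_def)
  have n: "0 < n" by (rule local_degree(1)[OF b])
  show ?thesis using local_degree(2)[OF b n] direction_degree_pos[OF b(1) n] by simp
qed

lemma edge_degree_le: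
  assumes "e \<in> edges G V'" "P \<in> e"
  shows "edge_degree G E \<phi> e \<le> local_degree G E \<phi> P"
proof -
  have "P \<in> topspace XG" using edge_subset[OF assms(1)] assms by (auto simp: points_def)
  then obtain U n \<beta> \<rho> where b: "branch_chart XG P U n \<beta> \<rho>"
    "directions XG P = (\<lambda>k. \<beta> k ` {0<..<1}) ` {..<n}"
    using graph_chart[OF tG] by metis
  interpret b: branch_chart XG P U n \<beta> \<rho> by fact
  have n: "0 < n" by (rule local_degree(1)[OF b])
  obtain d where d: "0 < d" "d \<le> 1" "b.sball d \<subseteq> e"
    using b.small_sball[OF vertex_set_edge_open[OF G vG assms(1)] assms(2)] .
  have "\<beta> 0 ` {0<..<d} \<subseteq> b.sball d" using n unfolding b.sball_def by blast
  then have "direction_degree G E \<phi> P (\<beta> 0 ` {0<..<1}) = edge_degree G E \<phi> e"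
    using direction_degree_eq[OF b(1) n assms(1) d(1,2)] d(3) by blast
  then show ?thesis using local_degree(2)[OF b n] by simp
qed

text \<open>By harmonicity and the positivity of local degrees, every direction at \<open>\<phi> y\<close> is the image of a
direction at \<open>y\<close>. The image of a germ at \<open>y\<close> is a connected part of a branch at \<open>\<phi> y\<close> that comes
arbitrarily close to \<open>\<phi> y\<close>, hence contains a germ of that branch.\<close>

lemma open_phi:
  assumes "openin XG N"
  shows "openin XE (\<phi> ` N)"
proof (subst openin_subopen, intro ballI)
  fix p assume "p \<in> \<phi> ` N"
  then obtain y where y: "y \<in> N" "p = \<phi> y" by blast
  have yG: "y \<in> topspace XG" using assms y openin_subset by blast
  then have py: "\<phi> y \<in> topspace XE" using cont by (auto simp: continuous_map_def)
  obtain U n \<beta> \<rho> where b: "branch_chart XG y U n \<beta> \<rho>"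
    "directions XG y = (\<lambda>k. \<beta> k ` {0<..<1}) ` {..<n}"
    using graph_chart[OF tG yG] by metis
  interpret b: branch_chart XG y U n \<beta> \<rho> by fact
  obtain U1 m \<gamma> \<sigma> where c: "branch_chart XE (\<phi> y) U1 m \<gamma> \<sigma>"
    "directions XE (\<phi> y) = (\<lambda>k. \<gamma> k ` {0<..<1}) ` {..<m}"
    using graph_chart[OF tE py] by metis
  interpret c: branch_chart XE "\<phi> y" U1 m \<gamma> \<sigma> by fact
  have "\<exists>d>0. d \<le> 1 \<and> \<gamma> j ` {0<..<d} \<subseteq> \<phi> ` N" if j: "j < m" for j
  proof -
    let ?v = "\<gamma> j ` {0<..<1}"
    have "degree_over G E \<phi> y ?v > 0"
      using local_degree(3)[OF b, of ?v] local_degree_pos[of y] yG j c(2) by (auto simp: points_def)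
    then have "{v' \<in> directions XG y. maps_direction G \<phi> y v' ?v} \<noteq> {}"
      unfolding degree_over_def by (metis sum.empty less_irrefl)
    then obtain k where k: "k < n" "maps_direction G \<phi> y (\<beta> k ` {0<..<1}) ?v" using b(2) by auto
    obtain M where M: "openin XG M" "y \<in> M" "\<phi> ` (\<beta> k ` {0<..<1} \<inter> M) \<subseteq> ?v"
      using k(2) unfolding maps_direction_def by blast
    have "openin XG (M \<inter> N)" "y \<in> M \<inter> N" using M assms y by auto
    from b.small_sball[OF this] obtain d where d: "0 < d" "d \<le> 1" "b.sball d \<subseteq> M \<inter> N" .
    let ?C = "\<beta> k ` {0<..<d}"
    have C: "?C \<subseteq> b.sball d" using k(1) unfolding b.sball_def by blast
    have "{0<..<d} \<subseteq> {0<..<1}" using d by auto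
    then have "?C \<subseteq> \<beta> k ` {0<..<1}" by (rule image_mono)
    then have sub: "\<phi> ` ?C \<subseteq> ?v" using M(3) C d(3) by blast
    have "\<phi> y \<in> mg_top E closure_of (\<phi> ` ?C)"
      using b.branch_at_P[OF k(1) d(1,2)] cont by (meson continuous_map_image_closure_subset image_subset_iff)
    from c.germ_in_connected[OF j connectedin_continuous_map_image[OF cont b.connected_branch[OF k(1) d(2)]] sub this]
    obtain \<delta> where "0 < \<delta>" "\<delta> \<le> 1" "\<gamma> j ` {0<..<\<delta>} \<subseteq> \<phi> ` ?C" .
    moreover have "\<phi> ` ?C \<subseteq> \<phi> ` N" using C d(3) by blast
    ultimately show ?thesis by blast
  qed
  then obtain d where d: "\<And>j. j < m \<Longrightarrow> 0 < d j \<and> d j \<le> 1 \<and> \<gamma> j ` {0<..<d j} \<subseteq> \<phi> ` N" by metis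
  define eps where "eps = Min (insert 1 (d ` {..<m}))"
  have eps: "0 < eps" "eps \<le> 1" using d by (auto simp: eps_def)
  have "\<gamma> j ` {0<..<eps} \<subseteq> \<phi> ` N" if "j < m" for j
  proof -
    have "eps \<le> d j" using that by (auto simp: eps_def)
    then have "\<gamma> j ` {0<..<eps} \<subseteq> \<gamma> j ` {0<..<d j}" by (intro image_mono) auto
    then show ?thesis using d that by blast
  qed
  then have "c.sball eps \<subseteq> \<phi> ` N" using y unfolding c.sball_def by blast
  moreover have "openin XE (c.sball eps)" "\<phi> y \<in> c.sball eps" using eps c.open_sball by (auto simp: c.sball_def)
  ultimately show "\<exists>T. openin XE T \<and> p \<in> T \<and> T \<subseteq> \<phi> ` N" using y by blast
qed

end

section \<open>The involution that exchanges the points of a fibre\<close>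

context degree_two_morphism
begin

lemma fibre_sum:
  assumes "x \<in> points G"
  shows "(\<Sum>y | y \<in> points G \<and> \<phi> y = \<phi> x. local_degree G E \<phi> y) = 2"
  using deg2 surj assms unfolding has_degree_def by blast

lemma fibre_finite:
  assumes "x \<in> points G"
  shows "finite {y \<in> points G. \<phi> y = \<phi> x}"
  \<comment> \<open>A sum over an infinite set is 0, which differs from 2.\<close>
  using fibre_sum[OF assms] by (rule_tac ccontr) simp

lemma fibre_le:
  assumes "x \<in> points G" "S \<subseteq> {y \<in> points G. \<phi> y = \<phi> x}"
  shows "(\<Sum>y\<in>S. local_degree G E \<phi> y) \<le> 2"
  using sum_mono2[OF fibre_finite[OF assms(1)] assms(2), of "local_degree G E \<phi>"] fibre_sum[OF assms(1)] by simp

lemma fibre_two: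
  assumes "x \<in> points G" "y \<in> points G" "y \<noteq> x" "\<phi> y = \<phi> x"
  shows "local_degree G E \<phi> x = 1" "z \<in> points G \<Longrightarrow> \<phi> z = \<phi> x \<Longrightarrow> z = x \<or> z = y"
proof -
  have "(\<Sum>y\<in>{x, y}. local_degree G E \<phi> y) \<le> 2"
    by (rule fibre_le[OF assms(1)]) (use assms in auto)
  then show "local_degree G E \<phi> x = 1"
    using local_degree_pos[OF assms(1)] local_degree_pos[OF assms(2)] assms(3) by auto
  show "z = x \<or> z = y" if z: "z \<in> points G" "\<phi> z = \<phi> x"
  proof (rule ccontr)
    assume n: "\<not> (z = x \<or> z = y)"
    have "(\<Sum>y\<in>{x, y, z}. local_degree G E \<phi> y) \<le> 2"
      by (rule fibre_le[OF assms(1)]) (use assms z in auto)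
    then show False
      using local_degree_pos[OF assms(1)] local_degree_pos[OF assms(2)] local_degree_pos[OF z(1)] assms(3) n by auto
  qed
qed

definition swap :: "'a \<Rightarrow> 'a" where
  "swap x = (if \<exists>y\<in>points G. y \<noteq> x \<and> \<phi> y = \<phi> x then SOME y. y \<in> points G \<and> y \<noteq> x \<and> \<phi> y = \<phi> x else x)"

lemma swap_other:
  assumes "x \<in> points G" "y \<in> points G" "y \<noteq> x" "\<phi> y = \<phi> x"
  shows "swap x = y"
proof -
  have "\<exists>z. z \<in> points G \<and> z \<noteq> x \<and> \<phi> z = \<phi> x" using assms by blast
  from someI_ex[OF this] have "swap x \<in> points G \<and> swap x \<noteq> x \<and> \<phi> (swap x) = \<phi> x"
    using assms unfolding swap_def by auto
  then show ?thesis using fibre_two(2)[OF assms] by blast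
qed

lemma swap_in [simp]: "x \<in> points G \<Longrightarrow> swap x \<in> points G"
  and phi_swap [simp]: "x \<in> points G \<Longrightarrow> \<phi> (swap x) = \<phi> x"
  using swap_other[of x] by (metis swap_def)+

lemma swap_swap [simp]: "x \<in> points G \<Longrightarrow> swap (swap x) = x"
  by (metis phi_swap swap_in swap_other)

lemma fibre: "x \<in> points G \<Longrightarrow> y \<in> points G \<Longrightarrow> \<phi> y = \<phi> x \<Longrightarrow> y = x \<or> y = swap x"
  using swap_other by blast

lemma swap_local_degree: "x \<in> points G \<Longrightarrow> swap x \<noteq> x \<Longrightarrow> local_degree G E \<phi> x = 1"
  using fibre_two(1)[of x "swap x"] by simp

lemma swap_inj: "inj_on swap (points G)"
  by (rule inj_on_inverseI[of _ swap]) simp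

lemma compact_G: "compact_space XG" and Hausdorff_G: "Hausdorff_space XG"
  and Hausdorff_E: "Hausdorff_space XE"
  using tG tE by (auto simp: topological_graph_def)

text \<open>At a fixed point, continuity holds because \<open>\<phi>\<close> is closed: the fibres near a one-point fibre are
close to it. At a point \<open>x\<close> that is moved it holds because \<open>\<phi>\<close> is open: a point near \<open>x\<close> has in its
fibre a point near \<open>swap x\<close>, and this can only be its image.\<close>

lemma swap_continuous: "continuous_map XG XG swap"
  unfolding continuous_map_def
proof (intro conjI allI impI)
  show "swap \<in> topspace XG \<rightarrow> topspace XG" using swap_in by (auto simp: points_def)
  fix O1 assume O1: "openin XG O1"
  show "openin XG {x \<in> topspace XG. swap x \<in> O1}"
  proof (subst openin_subopen, intro ballI)
    fix x assume "x \<in> {x \<in> topspace XG. swap x \<in> O1}"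
    then have x: "x \<in> points G" "swap x \<in> O1" by (auto simp: points_def)
    show "\<exists>T. openin XG T \<and> x \<in> T \<and> T \<subseteq> {x \<in> topspace XG. swap x \<in> O1}"
    proof (cases "swap x = x")
      case True
      let ?C = "points G - O1"
      have "closedin XG ?C" using O1 unfolding points_def by (rule openin_closedin_eq[THEN iffD1, THEN conjunct2])
      then have cl: "closedin XE (\<phi> ` ?C)"
        using continuous_imp_closed_map[OF cont compact_G Hausdorff_E] by (simp add: closed_map_def)
      let ?T = "{z \<in> topspace XG. \<phi> z \<in> topspace XE - \<phi> ` ?C}"
      have "openin XG ?T"
        by (rule openin_continuous_map_preimage[OF cont]) (use cl in blast)
      moreover have "x \<in> ?T"
      proof -
        have "\<phi> x \<notin> \<phi> ` ?C"
        proof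
          assume "\<phi> x \<in> \<phi> ` ?C"
          then obtain y where y: "y \<in> points G" "y \<notin> O1" "\<phi> y = \<phi> x" by auto
          then have "y = x" using fibre[OF x(1) y(1)] True by auto
          then show False using x True y by auto
        qed
        moreover have "\<phi> x \<in> topspace XE" using x surj by (auto simp: points_def)
        ultimately show ?thesis using x by (simp add: points_def)
      qed
      moreover have "?T \<subseteq> {x \<in> topspace XG. swap x \<in> O1}"
      proof
        fix z assume z: "z \<in> ?T"
        then have zG: "z \<in> points G" by (simp add: points_def)
        have "\<phi> (swap z) \<notin> \<phi> ` ?C" using z phi_swap[OF zG] by simp
        then have "swap z \<in> O1" using swap_in[OF zG] by blast
        then show "z \<in> {x \<in> topspace XG. swap x \<in> O1}" using zG by (simp add: points_def)
      qed
      ultimately show ?thesis by blast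
    next
      case False
      obtain A B where AB: "openin XG A" "openin XG B" "x \<in> A" "swap x \<in> B" "disjnt A B"
        using Hausdorff_G x(1) swap_in[OF x(1)] False unfolding Hausdorff_space_def points_def by metis
      let ?T = "A \<inter> {z \<in> topspace XG. \<phi> z \<in> \<phi> ` (B \<inter> O1)}"
      have "openin XG {z \<in> topspace XG. \<phi> z \<in> \<phi> ` (B \<inter> O1)}"
        by (intro openin_continuous_map_preimage[OF cont] open_phi openin_Int AB O1)
      then have "openin XG ?T" using AB by blast
      moreover have "x \<in> ?T"
        using AB x phi_swap[OF x(1)] by (auto simp: points_def intro!: image_eqI[of _ \<phi> "swap x"])
      moreover have "?T \<subseteq> {x \<in> topspace XG. swap x \<in> O1}"
      proof
        fix z assume z: "z \<in> ?T"
        then obtain w where w: "w \<in> B" "w \<in> O1" "\<phi> w = \<phi> z" by auto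
        have "z \<in> points G" "w \<in> points G" "w \<noteq> z"
          using z w O1 AB openin_subset by (auto simp: points_def disjnt_def)
        then have "swap z = w" using swap_other w by blast
        then show "z \<in> {x \<in> topspace XG. swap x \<in> O1}" using w z by simp
      qed
      ultimately show ?thesis by blast
    qed
  qed
qed

lemma swap_homeomorphic: "homeomorphic_maps XG XG swap swap"
  unfolding homeomorphic_maps_def using swap_continuous by (simp add: points_def[symmetric])

text \<open>At a point that is moved both local degrees are 1, as they add up to 2. So the edges through \<open>x\<close>
and \<open>swap x\<close> have dilation factor 1, and \<open>\<phi>\<close> is a local isometry at both points.\<close>

lemma swap_local_isometry:
  assumes x: "x \<in> points G - V'" "swap x \<notin> V'" "swap x \<noteq> x"
  obtains N where "openin XG N" "x \<in> N"
    "\<And>y z. y \<in> N \<Longrightarrow> z \<in> N \<Longrightarrow> mg_dist G (swap y) (swap z) = mg_dist G y z"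
proof -
  have dil: "\<exists>N. openin XG N \<and> x \<in> N \<and> (\<forall>y\<in>N. \<forall>z\<in>N. mg_dist E (\<phi> y) (\<phi> z) = mg_dist G y z)"
    if x: "x \<in> points G - V'" "swap x \<noteq> x" for x
  proof -
    obtain e where e: "e \<in> edges G V'" "x \<in> e" using edge_exists[OF x(1)] by blast
    have "edge_degree G E \<phi> e \<le> 1" using edge_degree_le[OF e] swap_local_degree x by simp
    then have "edge_degree G E \<phi> e = 1" using pos[OF e(1)] by simp
    then have "dilates_on G E \<phi> e 1" using edge_degree_dilates[OF e(1)] by simp
    then obtain N where "openin XG N" "x \<in> N"
        "\<forall>y\<in>e \<inter> N. \<forall>z\<in>e \<inter> N. mg_dist E (\<phi> y) (\<phi> z) = real 1 * mg_dist G y z"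
      using e(2) unfolding dilates_on_def by meson
    then show ?thesis using vertex_set_edge_open[OF G vG e(1)] e(2)
      by (intro exI[of _ "e \<inter> N"]) auto
  qed
  obtain N where N: "openin XG N" "x \<in> N" "\<forall>y\<in>N. \<forall>z\<in>N. mg_dist E (\<phi> y) (\<phi> z) = mg_dist G y z"
    using dil[OF x(1,3)] by blast
  have "swap x \<in> points G - V'" "swap (swap x) \<noteq> swap x" using x by auto
  from dil[OF this] obtain M where M: "openin XG M" "swap x \<in> M"
    "\<forall>y\<in>M. \<forall>z\<in>M. mg_dist E (\<phi> y) (\<phi> z) = mg_dist G y z" by blast
  let ?N = "N \<inter> {y \<in> topspace XG. swap y \<in> M}"
  have "openin XG ?N" using N(1) openin_continuous_map_preimage[OF swap_continuous M(1)] by blast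
  moreover have "x \<in> ?N" using N M x by (auto simp: points_def)
  moreover have "mg_dist G (swap y) (swap z) = mg_dist G y z" if yz: "y \<in> ?N" "z \<in> ?N" for y z
  proof -
    have "y \<in> points G" "z \<in> points G" using yz by (auto simp: points_def)
    moreover have "mg_dist G (swap y) (swap z) = mg_dist E (\<phi> (swap y)) (\<phi> (swap z))" using M(3) yz by auto
    ultimately show ?thesis using N(3) yz by simp
  qed
  ultimately show ?thesis using that by blast
qed

end

section \<open>Simple closed curves\<close>

definition closed_curve :: "'a topology \<Rightarrow> real \<Rightarrow> (real \<Rightarrow> 'a) \<Rightarrow> bool" where
  "closed_curve X L g \<longleftrightarrow> 0 < L \<and> continuous_map (top_of_set {0..L}) X g \<and> g 0 = g L \<and> inj_on g {0..<L}"

definition simple_closed :: "'a topology \<Rightarrow> 'a set \<Rightarrow> bool" where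
  "simple_closed X K \<longleftrightarrow> (\<exists>L g. closed_curve X L g \<and> K = g ` {0..L})"

lemma simple_closed_image:
  assumes "simple_closed X K" "continuous_map X Y f" "inj_on f K"
  shows "simple_closed Y (f ` K)"
proof -
  obtain L g where g: "closed_curve X L g" "K = g ` {0..L}" using assms(1) by (auto simp: simple_closed_def)
  have "inj_on f (g ` {0..<L})" by (rule inj_on_subset[OF assms(3)]) (use g in auto)
  then have "closed_curve Y L (f \<circ> g)"
    using g(1) continuous_map_compose[OF _ assms(2)] by (auto simp: closed_curve_def intro: comp_inj_on)
  then show ?thesis using g(2) by (auto simp: simple_closed_def image_comp intro!: exI[of _ L] exI[of _ "f \<circ> g"])
qed

lemma simple_closed_subtopology:
  assumes "simple_closed (subtopology X S) K"
  shows "simple_closed X K"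
  using assms unfolding simple_closed_def closed_curve_def continuous_map_in_subtopology by blast

locale circle_curve =
  fixes X :: "'a topology" and L :: real and g :: "real \<Rightarrow> 'a"
  assumes Hausdorff: "Hausdorff_space X" and curve: "closed_curve X L g"
begin

abbreviation K :: "'a set" where "K \<equiv> g ` {0..L}"

lemma L: "0 < L" and cont_g: "continuous_map (top_of_set {0..L}) X g" and ends: "g 0 = g L"
  and inj: "inj_on g {0..<L}"
  using curve by (auto simp: closed_curve_def)

lemma param: 
  assumes "x \<in> K"
  obtains t where "0 \<le> t" "t < L" "x = g t"
proof -
  obtain u where "u \<in> {0..L}" "x = g u" using assms by blast
  then show ?thesis using that[of u] that[of 0] ends L by (cases "u = L") auto
qed

lemma g_eq: "s \<in> {0..L} \<Longrightarrow> t \<in> {0..L} \<Longrightarrow> g s = g t \<Longrightarrow> s = t \<or> (s = 0 \<and> t = L) \<or> (s = L \<and> t = 0)"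
proof -
  assume a: "s \<in> {0..L}" "t \<in> {0..L}" "g s = g t"
  define c where "c u = (if u = L then 0 else u)" for u
  have "g (c s) = g (c t)" "c s \<in> {0..<L}" "c t \<in> {0..<L}" using a L ends by (auto simp: c_def)
  then have "c s = c t" using inj by (simp add: inj_on_eq_iff)
  then show ?thesis by (auto simp: c_def split: if_splits)
qed

lemma closed_piece: "compact T \<Longrightarrow> T \<subseteq> {0..L} \<Longrightarrow> closedin X (g ` T)"
  using image_compactin[of "top_of_set {0..L}" T X g] cont_g compactin_imp_closedin[OF Hausdorff]
  by (simp add: compactin_subtopology)

lemma connected_piece: "connected T \<Longrightarrow> T \<subseteq> {0..L} \<Longrightarrow> connectedin X (g ` T)"
  using connectedin_continuous_map_image[OF cont_g, of T] by (simp add: connectedin_subtopology)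

lemma closed_K: "closedin X K" by (rule closed_piece) auto

lemma connected_K: "connectedin X K" by (rule connected_piece) auto

text \<open>Two points cut the circle into two arcs that are closed except at these points.\<close>

lemma arcs_separate:
  assumes "connectedin X C" "C \<subseteq> K - {g s, g t}" "0 \<le> s" "s < t" "t < L"
  shows "C \<subseteq> g ` {s<..<t} \<or> C \<subseteq> g ` ({0..<s} \<union> {t<..L})"
proof -
  let ?A = "g ` {s..t}" and ?B = "g ` ({0..s} \<union> {t..L})"
  have cl: "closedin X ?A" "closedin X ?B"
    using assms by (auto intro!: closed_piece compact_Un)
  have "{0..L} = {s..t} \<union> ({0..s} \<union> {t..L})" using assms by auto
  then have "K = ?A \<union> ?B" by (metis image_Un)
  moreover have "C \<subseteq> K" using assms(2) by (rule Diff_subset[THEN subset_trans[rotated]])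
  ultimately have cov: "C \<subseteq> ?A \<union> ?B" by (simp only:)
  have AB: "?A \<inter> ?B \<subseteq> {g s, g t}"
  proof
    fix x assume "x \<in> ?A \<inter> ?B"
    then obtain u w where uw: "u \<in> {s..t}" "w \<in> {0..s} \<union> {t..L}" "x = g u" "g u = g w" by (metis IntE imageE)
    then have "u = w \<or> (u = 0 \<and> w = L)" using g_eq[of u w] assms by auto
    then show "x \<in> {g s, g t}" using uw assms by auto
  qed
  then have "?A \<inter> ?B \<inter> C = {}" using assms(2) by blast
  then consider "?A \<inter> C = {}" | "?B \<inter> C = {}"
    using assms(1) cl cov unfolding connectedin_closedin by meson
  then show ?thesis
  proof cases
    case 1
    then have "C \<subseteq> ?B - {g s, g t}" using cov assms(2) by blast
    also have "... \<subseteq> g ` ({0..<s} \<union> {t<..L})"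
    proof
      fix x assume "x \<in> ?B - {g s, g t}"
      then obtain w where w: "w \<in> {0..s} \<union> {t..L}" "x = g w" "w \<noteq> s" "w \<noteq> t"
        by (metis DiffE imageE insertCI)
      then have "w \<in> {0..<s} \<union> {t<..L}" by auto
      then show "x \<in> g ` ({0..<s} \<union> {t<..L})" using w(2) by blast
    qed
    finally show ?thesis by simp
  next
    case 2
    then have "C \<subseteq> ?A - {g s, g t}" using cov assms(2) by blast
    also have "... \<subseteq> g ` {s<..<t}"
    proof
      fix x assume "x \<in> ?A - {g s, g t}"
      then obtain w where w: "w \<in> {s..t}" "x = g w" "w \<noteq> s" "w \<noteq> t"
        by (metis DiffE imageE insertCI)
      then have "w \<in> {s<..<t}" by auto
      then show "x \<in> g ` {s<..<t}" using w(2) by blast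
    qed
    finally show ?thesis by simp
  qed
qed

text \<open>Two points of \<open>K\<close> outside \<open>C\<close> cut \<open>K\<close> into two arcs. The connected set \<open>C\<close> lies in one of them, and
the other one joins the two points outside \<open>C\<close>.\<close>

lemma complement_connected:
  assumes "connectedin X C" "C \<subseteq> K"
  shows "connectedin X (K - C)"
proof -
  have pair: "\<exists>T. connectedin X T \<and> T \<subseteq> K - C \<and> g s \<in> T \<and> g t \<in> T"
    if st: "0 \<le> s" "s < t" "t < L" "g s \<notin> C" "g t \<notin> C" for s t
  proof -
    have sub: "{s..t} \<subseteq> {0..L}" "{0..s} \<subseteq> {0..L}" "{t..L} \<subseteq> {0..L}" using st by auto
    from arcs_separate[OF assms(1) _ st(1-3)] assms(2) st(4,5)
    consider "C \<subseteq> g ` {s<..<t}" | "C \<subseteq> g ` ({0..<s} \<union> {t<..L})" by blast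
    then show ?thesis
    proof cases
      case 1
      have "g 0 \<in> g ` {0..s}" "g L \<in> g ` {t..L}" using st by simp_all
      then have "g 0 \<in> g ` {0..s} \<inter> g ` {t..L}" using ends by simp
      then have "connectedin X (g ` {0..s} \<union> g ` {t..L})"
        using connected_piece[OF _ sub(2)] connected_piece[OF _ sub(3)] by (intro connectedin_Un) auto
      moreover have "(g ` {0..s} \<union> g ` {t..L}) \<inter> g ` {s<..<t} = {}"
      proof (rule ccontr)
        assume "(g ` {0..s} \<union> g ` {t..L}) \<inter> g ` {s<..<t} \<noteq> {}"
        then have "g ` ({0..s} \<union> {t..L}) \<inter> g ` {s<..<t} \<noteq> {}" unfolding image_Un .
        then obtain x where "x \<in> g ` ({0..s} \<union> {t..L})" "x \<in> g ` {s<..<t}" by blast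
        then obtain u w where "u \<in> {0..s} \<union> {t..L}" "w \<in> {s<..<t}" "g u = g w" by (metis imageE)
        then show False using g_eq[of u w] st by auto
      qed
      moreover have "g s \<in> g ` {0..s}" "g t \<in> g ` {t..L}" using st by auto
      moreover have "g ` {0..s} \<union> g ` {t..L} \<subseteq> K" using sub by blast
      moreover have "(g ` {0..s} \<union> g ` {t..L}) \<inter> C = {}" using calculation(2) 1 by blast
      ultimately have "connectedin X (g ` {0..s} \<union> g ` {t..L}) \<and> g ` {0..s} \<union> g ` {t..L} \<subseteq> K - C
          \<and> g s \<in> g ` {0..s} \<union> g ` {t..L} \<and> g t \<in> g ` {0..s} \<union> g ` {t..L}"
        by (simp add: Diff_eq disjoint_eq_subset_Compl)
      then show ?thesis by (rule exI)
    next
      case 2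
      have "connectedin X (g ` {s..t})" using connected_piece[OF _ sub(1)] by simp
      moreover have "g ` {s..t} \<inter> C = {}"
      proof (rule ccontr)
        assume "g ` {s..t} \<inter> C \<noteq> {}"
        then obtain x where x: "x \<in> g ` {s..t}" "x \<in> C" by blast
        then have "x \<in> g ` ({0..<s} \<union> {t<..L})" using 2 by blast
        with x obtain u w where uw: "u \<in> {s..t}" "w \<in> {0..<s} \<union> {t<..L}" "g u = g w" "x = g u"
          by (metis imageE)
        then have "u = s" using g_eq[of u w] st by auto
        then show False using x uw st(4) by simp
      qed
      moreover have "g s \<in> g ` {s..t}" "g t \<in> g ` {s..t}" using st by auto
      moreover have "g ` {s..t} \<subseteq> K" using sub by blast
      ultimately show ?thesis using 2 by (intro exI[of _ "g ` {s..t}"]) blast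
    qed
  qed
  have sp: "K - C \<subseteq> topspace X" using connectedin_subset_topspace[OF connected_K] by blast
  have con2: "\<exists>T. connectedin X T \<and> T \<subseteq> K - C \<and> a \<in> T \<and> b \<in> T" if ab: "a \<in> K - C" "b \<in> K - C" for a b
  proof -
    obtain s where s: "0 \<le> s" "s < L" "a = g s" using ab param by blast
    obtain t where t: "0 \<le> t" "t < L" "b = g t" using ab param by blast
    consider "s < t" | "t < s" | "s = t" by linarith
    then show ?thesis
    proof cases
      case 3
      then have "a = b" using s t by simp
      then show ?thesis using ab sp by (intro exI[of _ "{a}"]) auto
    qed (use pair[of s t] pair[of t s] s t ab in blast)+
  qed
  show ?thesis
  proof (cases "K - C = {}")
    case True
    then show ?thesis by (metis connectedin_empty)
  next
    case False
    then obtain a where a: "a \<in> K - C" by blast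
    have "K - C = \<Union> {T. connectedin X T \<and> T \<subseteq> K - C \<and> a \<in> T}" using con2[OF a] by blast
    moreover have "connectedin X (\<Union> {T. connectedin X T \<and> T \<subseteq> K - C \<and> a \<in> T})"
      by (rule connectedin_Union) blast+
    ultimately show ?thesis by simp
  qed
qed

lemma two_points_separate:
  assumes "a \<in> K" "b \<in> K" "a \<noteq> b"
  shows "\<not> connectedin X (K - {a, b})"
proof -
  have main: "\<not> connectedin X (K - {g s, g t})" if st: "0 \<le> s" "s < t" "t < L" for s t
  proof
    assume c: "connectedin X (K - {g s, g t})"
    have in_rest: "g r \<in> K - {g s, g t}" if "0 < r" "r < L" "r \<noteq> s" "r \<noteq> t" for r
      using g_eq[of r s] g_eq[of r t] that st by auto
    have u: "g ((s+t)/2) \<in> K - {g s, g t}" by (rule in_rest) (use st in auto)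
    have w: "g ((t+L)/2) \<in> K - {g s, g t}" by (rule in_rest) (use st in auto)
    consider "K - {g s, g t} \<subseteq> g ` {s<..<t}" | "K - {g s, g t} \<subseteq> g ` ({0..<s} \<union> {t<..L})"
      using arcs_separate[OF c _ st] by blast
    then show False
    proof cases
      case 1
      then obtain v where "v \<in> {s<..<t}" "g ((t+L)/2) = g v" using w by blast
      then show False using g_eq[of "(t+L)/2" v] st by auto
    next
      case 2
      then obtain v where "v \<in> {0..<s} \<union> {t<..L}" "g ((s+t)/2) = g v" using u by blast
      then show False using g_eq[of "(s+t)/2" v] st by auto
    qed
  qed
  obtain s where s: "0 \<le> s" "s < L" "a = g s" using assms param by blast
  obtain t where t: "0 \<le> t" "t < L" "b = g t" using assms param by blast
  consider "s < t" | "t < s" using s t assms by (metis linorder_neqE_linordered_idom)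
  then show ?thesis using main[of s t] main[of t s] s t by cases (auto simp: insert_commute)
qed

lemma K_not_singleton: "K \<noteq> {v}"
proof -
  have "g 0 \<noteq> g (L/2)" using g_eq[of 0 "L/2"] L by auto
  moreover have "g 0 \<in> K" "g (L/2) \<in> K" using L by (intro imageI; simp)+
  ultimately show ?thesis by (metis singletonD)
qed

lemma end_in_closure:
  assumes "{a<..<b} \<subseteq> {0..L}" "a < b" "t = a \<or> t = b"
  shows "g t \<in> X closure_of (g ` {a<..<b})"
proof -
  have "closure {a<..<b} \<subseteq> {0..L}" using assms(1) by (intro closure_minimal) auto
  then have ab: "{a..b} \<subseteq> {0..L}" using assms(2) by (simp add: closure_greaterThanLessThan)
  have "g ` (top_of_set {0..L} closure_of {a<..<b}) \<subseteq> X closure_of (g ` {a<..<b})"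
    using cont_g by (simp add: continuous_map_image_closure_subset)
  moreover have "top_of_set {0..L} closure_of {a<..<b} = {a..b}"
    using assms ab by (simp add: closure_of_subtopology Int_absorb1 closure_greaterThanLessThan)
  moreover have "t \<in> {a..b}" using assms by auto
  ultimately show ?thesis by blast
qed

text \<open>The curve leaves \<open>p\<close> in two directions, whose germs are disjoint by injectivity; at the base point
these are the beginning and the end of the parametrisation.\<close>

lemma nbhd_on_curve:
  assumes "p \<in> K" "star_nbhd X p U 2"
  obtains N where "openin X N" "p \<in> N" "N \<subseteq> K"
proof -
  obtain t where t: "0 \<le> t" "t < L" "p = g t" using assms(1) param by blast
  have U: "openin X U" "p \<in> U" using assms(2) by (auto simp: star_nbhd_def)
  have near: "\<exists>d>0. \<forall>s\<in>{0..L}. \<bar>s - u\<bar> < d \<longrightarrow> g s \<in> U" if u: "u \<in> {0..L}" "g u = p" for u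
  proof -
    have "openin (top_of_set {0..L}) {s \<in> topspace (top_of_set {0..L}). g s \<in> U}"
      using cont_g U(1) by (rule openin_continuous_map_preimage)
    then obtain T where T: "open T" "{s \<in> {0..L}. g s \<in> U} = {0..L} \<inter> T" by (auto simp: openin_open)
    have "u \<in> {s \<in> {0..L}. g s \<in> U}" using u U by simp
    then have "u \<in> T" unfolding T(2) by simp
    then obtain d where "d > 0" "ball u d \<subseteq> T" using T(1) open_contains_ball by blast
    then have "\<forall>s\<in>{0..L}. \<bar>s - u\<bar> < d \<longrightarrow> g s \<in> U"
      using T(2) by (auto simp: dist_real_def abs_minus_commute subset_iff set_eq_iff)
    then show ?thesis using \<open>d > 0\<close> by blast
  qed
  have piece: "connectedin X (g ` {a<..<b}) \<and> g ` {a<..<b} \<subseteq> U - {p} \<and> p \<in> X closure_of (g ` {a<..<b})"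
    if "0 \<le> a" "a < b" "b \<le> L" "u = a \<or> u = b" "g u = p" "b - a \<le> d" "d > 0"
      "\<forall>s\<in>{0..L}. \<bar>s - u\<bar> < d \<longrightarrow> g s \<in> U" for a b u d
  proof (intro conjI)
    have s: "{a<..<b} \<subseteq> {0..L}" using that by auto
    show "connectedin X (g ` {a<..<b})" using s by (intro connected_piece) auto
    show "p \<in> X closure_of (g ` {a<..<b})" using end_in_closure[OF s that(2,4)] that(5) by simp
    show "g ` {a<..<b} \<subseteq> U - {p}"
    proof
      fix x assume "x \<in> g ` {a<..<b}"
      then obtain r where r: "a < r" "r < b" "x = g r" by auto
      then have "x \<in> U" using that by auto
      moreover have "x \<noteq> p" using g_eq[of r u] that r by auto
      ultimately show "x \<in> U - {p}" by simp
    qed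
  qed
  have disj: "g ` {a<..<b} \<inter> g ` {c<..<d} = {}"
    if "0 \<le> a" "b \<le> c" "d \<le> L" for a b c d
  proof (rule ccontr)
    assume "g ` {a<..<b} \<inter> g ` {c<..<d} \<noteq> {}"
    then obtain x where "x \<in> g ` {a<..<b}" "x \<in> g ` {c<..<d}" by blast
    then obtain r s where "r \<in> {a<..<b}" "s \<in> {c<..<d}" "g r = g s" by (metis imageE)
    then show False using g_eq[of r s] that by auto
  qed
  have "\<exists>A B. connectedin X A \<and> A \<subseteq> U - {p} \<and> p \<in> X closure_of A \<and>
      connectedin X B \<and> B \<subseteq> U - {p} \<and> p \<in> X closure_of B \<and> A \<inter> B = {} \<and> A \<subseteq> K \<and> B \<subseteq> K"
  proof (cases "t = 0")
    case True
    obtain d1 where d1: "d1 > 0" "\<forall>s\<in>{0..L}. \<bar>s - 0\<bar> < d1 \<longrightarrow> g s \<in> U" using near[of 0] True t L by auto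
    obtain d2 where d2: "d2 > 0" "\<forall>s\<in>{0..L}. \<bar>s - L\<bar> < d2 \<longrightarrow> g s \<in> U" using near[of L] True t L ends by auto
    define d where "d = min (min d1 d2) (L/2)"
    have d: "0 < d" "d \<le> d1" "d \<le> d2" "d \<le> L / 2" using d1 d2 L by (auto simp: d_def)
    have "{0<..<d} \<subseteq> {0..L}" "{L-d<..<L} \<subseteq> {0..L}" using d by auto
    then have "g ` {0<..<d} \<subseteq> K" "g ` {L-d<..<L} \<subseteq> K" by blast+
    moreover have "g ` {0<..<d} \<inter> g ` {L-d<..<L} = {}" using d by (intro disj) auto
    moreover note piece[of 0 d 0 d1] piece[of "L-d" L L d2]
    ultimately show ?thesis using d d1 d2 t True ends
      by (intro exI[of _ "g ` {0<..<d}"] exI[of _ "g ` {L-d<..<L}"]) simp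
  next
    case False
    obtain d1 where d1: "d1 > 0" "\<forall>s\<in>{0..L}. \<bar>s - t\<bar> < d1 \<longrightarrow> g s \<in> U" using near[of t] t by auto
    define d where "d = min d1 (min t (L - t))"
    have d: "0 < d" "d \<le> d1" "d \<le> t" "d \<le> L - t" using d1 t False by (auto simp: d_def)
    have "{t-d<..<t} \<subseteq> {0..L}" "{t<..<t+d} \<subseteq> {0..L}" using d t by auto
    then have "g ` {t-d<..<t} \<subseteq> K" "g ` {t<..<t+d} \<subseteq> K" by blast+
    moreover have "g ` {t-d<..<t} \<inter> g ` {t<..<t+d} = {}" using d t by (intro disj) auto
    moreover note piece[of "t-d" t t d1] piece[of t "t+d" t d1]
    ultimately show ?thesis using d d1 t False
      by (intro exI[of _ "g ` {t-d<..<t}"] exI[of _ "g ` {t<..<t+d}"]) simp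
  qed
  then obtain A B where AB: "connectedin X A" "A \<subseteq> U - {p}" "p \<in> X closure_of A"
    "connectedin X B" "B \<subseteq> U - {p}" "p \<in> X closure_of B" "A \<inter> B = {}" "A \<subseteq> K" "B \<subseteq> K" by blast
  obtain N where "openin X N" "p \<in> N" "N \<subseteq> insert p (A \<union> B)"
    using two_germs_nbhd[OF assms(2) AB(1-7)] .
  moreover have "insert p (A \<union> B) \<subseteq> K" using AB(8,9) assms(1) by (intro insert_subsetI Un_least)
  ultimately show ?thesis using that[of N] by (meson subset_trans)
qed

end

lemma simple_closed_curve:
  assumes "Hausdorff_space X" "simple_closed X K"
  obtains L g where "circle_curve X L g" "K = g ` {0..L}"
  using assms unfolding simple_closed_def circle_curve_def by blast

section \<open>Circles in a graph of genus one\<close>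

text \<open>The points of \<open>e\<close> on the circle form a closed subset of \<open>e\<close>. It is open too, because the points of
\<open>e\<close> have valence two. So it is all of the connected set \<open>e\<close>.\<close>

lemma edge_in_circle:
  assumes "metric_graph E" "vertex_set E W" "e \<in> edges E W" "simple_closed (mg_top E) K" "K \<inter> e \<noteq> {}"
  shows "e \<subseteq> K"
proof -
  have tE: "topological_graph (mg_top E)" using assms(1) by (rule metric_graph_top)
  obtain L g where "circle_curve (mg_top E) L g" and K: "K = g ` {0..L}"
    using simple_closed_curve[OF _ assms(4)] tE unfolding topological_graph_def by blast
  then interpret c: circle_curve "mg_top E" L g by simp
  let ?A = "mg_top E interior_of K" and ?B = "topspace (mg_top E) - K"
  have "p \<in> ?A" if p: "p \<in> e" "p \<in> K" for p
  proof -
    have "p \<in> topspace (mg_top E)" "p \<notin> W" using edge_subset[OF assms(3)] p by (auto simp: points_def)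
    then have "valence (mg_top E) p = 2" using assms(2) unfolding vertex_set_def essential_vertices_def by blast
    then obtain U where "star_nbhd (mg_top E) p U 2"
      using valence_chart[OF tE \<open>p \<in> topspace (mg_top E)\<close>] by metis
    then show ?thesis using c.nbhd_on_curve[of p U] p K unfolding interior_of_def by blast
  qed
  moreover have "e \<subseteq> topspace (mg_top E)" using edge_subset[OF assms(3)] by (auto simp: points_def)
  ultimately have "e \<subseteq> ?A \<union> ?B" by blast
  moreover have "?A \<inter> ?B \<inter> e = {}" using interior_of_subset[of "mg_top E" K] by blast
  moreover have "openin (mg_top E) ?A" "openin (mg_top E) ?B" using c.closed_K K by auto
  moreover have "?A \<inter> e \<noteq> {}" using assms(5) \<open>\<And>p. p \<in> e \<Longrightarrow> p \<in> K \<Longrightarrow> p \<in> ?A\<close> by blast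
  ultimately have "?B \<inter> e = {}" using edge_connected[OF assms(3)] unfolding connectedin by meson
  then show ?thesis using \<open>e \<subseteq> topspace (mg_top E)\<close> by blast
qed

text \<open>What \<open>e\<close> joins is still joined by the rest of \<open>K\<close>.\<close>

lemma connected_minus:
  assumes S: "connectedin X S" and e: "openin X e" "e \<subseteq> K" and K: "K \<subseteq> S" "closedin X K"
    and con: "connectedin X (K - e)" and ne: "K - e \<noteq> {}"
  shows "connectedin X (S - e)"
proof (rule ccontr)
  assume "\<not> ?thesis"
  moreover have "S - e \<subseteq> topspace X" using connectedin_subset_topspace[OF S] by blast
  ultimately obtain A B where AB: "closedin X A" "closedin X B" "S - e \<subseteq> A \<union> B" "A \<inter> B \<inter> (S - e) = {}"
    "A \<inter> (S - e) \<noteq> {}" "B \<inter> (S - e) \<noteq> {}"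
    unfolding connectedin_closedin by meson
  have key: False if A: "closedin X A" and B: "closedin X B" and c: "S - e \<subseteq> A \<union> B" "A \<inter> B \<inter> (S - e) = {}"
    "A \<inter> (S - e) \<noteq> {}" "B \<inter> (S - e) \<noteq> {}" "B \<inter> (K - e) = {}" for A B
  proof -
    have "closedin X (A \<union> K)" "closedin X (B - e)"
      using closedin_Un[OF A K(2)] closedin_diff[OF B e(1)] by simp_all
    moreover have "S \<subseteq> (A \<union> K) \<union> (B - e)" using c(1) e(2) by blast
    moreover have "(A \<union> K) \<inter> (B - e) \<inter> S = {}" using c(2,5) K(1) by blast
    moreover have "(A \<union> K) \<inter> S \<noteq> {}" "(B - e) \<inter> S \<noteq> {}" using c(3,4) by blast+
    ultimately show False using S unfolding connectedin_closedin by meson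
  qed
  have "K - e \<subseteq> A \<union> B" "A \<inter> B \<inter> (K - e) = {}" using AB K by blast+
  then consider "A \<inter> (K - e) = {}" | "B \<inter> (K - e) = {}"
    using con AB(1,2) unfolding connectedin_closedin by meson
  then show False
  proof cases
    case 1
    show False by (rule key[of B A]) (use AB 1 in blast)+
  next
    case 2
    show False by (rule key[of A B]) (use AB 2 in blast)+
  qed
qed

text \<open>The values of \<open>f\<close> label the components of the graph with vertices \<open>W\<close> and edges \<open>F\<close>: adding an edge
merges at most two labels.\<close>

lemma few_edges_disconnect:
  fixes en :: "'e \<Rightarrow> 'v set"
  assumes "finite F" "finite W" "\<And>e. e \<in> F \<Longrightarrow> card (en e) = 2" "\<And>e. e \<in> F \<Longrightarrow> en e \<subseteq> W"
  shows "\<exists>f :: 'v \<Rightarrow> 'v. card W \<le> card (f ` W) + card F \<and> (\<forall>e\<in>F. \<forall>x\<in>en e. \<forall>y\<in>en e. f x = f y)"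
  using assms(1,3,4)
proof (induction F)
  case empty
  then show ?case by (intro exI[of _ id]) simp
next
  case (insert e F)
  have "\<exists>f :: 'v \<Rightarrow> 'v. card W \<le> card (f ` W) + card F \<and> (\<forall>e\<in>F. \<forall>x\<in>en e. \<forall>y\<in>en e. f x = f y)"
    by (rule insert.IH) (simp_all add: insert.prems)
  then obtain f :: "'v \<Rightarrow> 'v" where f: "card W \<le> card (f ` W) + card F" "\<forall>e\<in>F. \<forall>x\<in>en e. \<forall>y\<in>en e. f x = f y"
    by meson
  obtain u w where uw: "en e = {u, w}" using insert.prems(1)[of e] by (auto simp: card_2_iff)
  define f' where "f' x = (if f x = f u then f w else f x)" for x
  have "f ` W - {f u} \<subseteq> f' ` W" by (auto simp: f'_def)
  then have "card (f ` W - {f u}) \<le> card (f' ` W)" using assms(2) by (intro card_mono) auto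
  moreover have "card (f ` W) \<le> card (f ` W - {f u}) + 1"
    by (metis add.commute card_Diff1_le card_Diff_singleton_if diff_le_self le_add_diff_inverse2 le_diff_conv order_refl)
  ultimately have "card W \<le> card (f' ` W) + card (insert e F)" using f(1) insert.hyps by simp
  moreover have "\<forall>e\<in>insert e F. \<forall>x\<in>en e. \<forall>y\<in>en e. f' x = f' y"
  proof (intro ballI)
    fix d x y assume d: "d \<in> insert e F" "x \<in> en d" "y \<in> en d"
    show "f' x = f' y"
    proof (cases "d \<in> F")
      case True
      then have "f x = f y" using f(2) d by blast
      then show ?thesis by (simp add: f'_def)
    next
      case False
      then show ?thesis using d uw by (auto simp: f'_def)
    qed
  qed
  ultimately show ?case by blast
qed

text \<open>If there are two labels as in \<open>few_edges_disconnect\<close>, the vertices with one label together with the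
closed edges between them form a closed set, and so does the rest.\<close>

lemma edges_connected_bound:
  assumes E: "metric_graph E" and W: "vertex_set E W" and F: "finite F" "F \<subseteq> edges E W"
    and con: "connectedin (mg_top E) (W \<union> \<Union>F)"
  shows "card W \<le> card F + 1"
proof (rule ccontr)
  assume "\<not> ?thesis"
  then have big: "card F + 1 < card W" by simp
  have tE: "topological_graph (mg_top E)" using E by (rule metric_graph_top)
  have fW: "finite W" and Wp: "W \<subseteq> points E" using W by (auto simp: vertex_set_def)
  let ?en = "end_vertices E"
  have en2: "card (?en e) = 2" if "e \<in> F" for e using W F that by (auto simp: vertex_set_def)
  have enW: "?en e \<subseteq> W" if "e \<in> F" for e
    using edge_closure[of e E W] F that unfolding end_vertices_def by blast
  have ce: "closed_edge E e = e \<union> ?en e" if "e \<in> F" for e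
    using edge_closure[of e E W] F that unfolding end_vertices_def by blast
  obtain f :: "'a \<Rightarrow> 'a" where f: "card W \<le> card (f ` W) + card F"
    "\<forall>e\<in>F. \<forall>x\<in>?en e. \<forall>y\<in>?en e. f x = f y"
    using few_edges_disconnect[of F W ?en, OF F(1) fW en2 enW] by blast
  have "card (f ` W) > 1" using f(1) big by simp
  then obtain w1 w2 where w: "w1 \<in> W" "w2 \<in> W" "f w1 \<noteq> f w2"
  proof -
    have "\<not> card (f ` W) \<le> Suc 0" using \<open>card (f ` W) > 1\<close> by simp
    then obtain a b where "a \<in> f ` W" "b \<in> f ` W" "a \<noteq> b"
      unfolding card_le_Suc0_iff_eq[OF finite_imageI[OF fW]] by blast
    then show thesis using that by blast
  qed
  define A where "A = {x \<in> W. f x = f w1}"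
  define C where "C D = D \<union> \<Union> (closed_edge E ` {e \<in> F. ?en e \<subseteq> D})" for D
  have cl: "closedin (mg_top E) (C D)" if "D \<subseteq> W" for D
  proof -
    have "closedin (mg_top E) D" using closedin_finite_graph[OF tE, of D] fW Wp that finite_subset
      by (auto simp: points_def)
    moreover have "closedin (mg_top E) (\<Union> (closed_edge E ` {e \<in> F. ?en e \<subseteq> D}))"
      using F(1) by (intro closedin_Union) (auto simp: closed_edge_def)
    ultimately show ?thesis unfolding C_def by blast
  qed
  have dich: "?en e \<subseteq> A \<or> ?en e \<subseteq> W - A" if "e \<in> F" for e
  proof (cases "\<exists>x\<in>?en e. f x = f w1")
    case True
    then have "f y = f w1" if "y \<in> ?en e" for y using f(2) \<open>e \<in> F\<close> that by metis
    then show ?thesis using enW[OF that] unfolding A_def by blast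
  next
    case False
    then show ?thesis using enW[OF that] unfolding A_def by blast
  qed
  have "W \<union> \<Union>F \<subseteq> C A \<union> C (W - A)"
  proof
    fix x assume "x \<in> W \<union> \<Union>F"
    then consider "x \<in> W" | e where "e \<in> F" "x \<in> e" by blast
    then show "x \<in> C A \<union> C (W - A)"
    proof cases
      case 2
      then have "x \<in> closed_edge E e" using ce by blast
      then show ?thesis using dich[OF 2(1)] 2(1) unfolding C_def by blast
    qed (auto simp: C_def)
  qed
  moreover have "C A \<inter> C (W - A) = {}"
  proof (rule ccontr)
    assume "\<not> ?thesis"
    then obtain x where x: "x \<in> C A" "x \<in> C (W - A)" by blast
    show False
    proof (cases "x \<in> W")
      case True
      have "x \<in> D" if "x \<in> C D" for D
        using that True ce edge_subset F(2) unfolding C_def by blast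
      then show False using x by blast
    next
      case False
      have ex: "\<exists>e\<in>F. x \<in> e \<and> ?en e \<subseteq> D" if "x \<in> C D" "D \<subseteq> W" for D
        using that False ce enW unfolding C_def by blast
      obtain e1 where e1: "e1 \<in> F" "x \<in> e1" "?en e1 \<subseteq> A" using ex[OF x(1)] A_def by blast
      obtain e2 where e2: "e2 \<in> F" "x \<in> e2" "?en e2 \<subseteq> W - A" using ex[OF x(2)] by blast
      have "e1 = e2" using edge_unique[of e1 E W e2 x] e1 e2 F(2) by blast
      then have "?en e1 = {}" using e1 e2 by blast
      then show False using en2[OF e1(1)] by simp
    qed
  qed
  moreover have "w1 \<in> C A" "w2 \<in> C (W - A)" using w by (auto simp: C_def A_def)
  moreover have "closedin (mg_top E) (C A)" "closedin (mg_top E) (C (W - A))" by (auto intro!: cl simp: A_def)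
  ultimately show False using con w unfolding connectedin_closedin by blast
qed

text \<open>A graph of genus 1 has as many edges as vertices. If the first circle were not contained in the second,
it would contain an edge off the second one. After its removal the graph is connected and still
contains the second circle, of which an edge can be removed as well; but a connected graph has at
most one vertex more than edges.\<close>

lemma genus_one_unique_circle:
  assumes E: "metric_graph E" and genus: "genus E = 1" and V: "vertex_set E V"
    and K1: "simple_closed (mg_top E) K1" and K2: "simple_closed (mg_top E) K2"
  shows "K1 \<subseteq> K2"
proof (rule ccontr)
  assume nsub: "\<not> ?thesis"
  have tE: "topological_graph (mg_top E)" using E by (rule metric_graph_top)
  then have H: "Hausdorff_space (mg_top E)" and con: "connectedin (mg_top E) (points E)"
    by (auto simp: topological_graph_def points_def connectedin_topspace)
  \<comment> \<open>The vertex set that defines the genus; it need not be the given one.\<close>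
  define W where "W = (SOME V. vertex_set E V)"
  have W: "vertex_set E W" unfolding W_def using V by (rule someI)
  then have fW: "finite W" and Wp: "W \<subseteq> points E" by (auto simp: vertex_set_def)
  let ?F = "edges E W"
  have cardF: "card ?F = card W" using genus unfolding genus_def W_def[symmetric] Let_def by simp
  obtain L1 g1 where "circle_curve (mg_top E) L1 g1" and k1: "K1 = g1 ` {0..L1}"
    using simple_closed_curve[OF H K1] .
  then interpret c1: circle_curve "mg_top E" L1 g1 by simp
  obtain L2 g2 where "circle_curve (mg_top E) L2 g2" and k2: "K2 = g2 ` {0..L2}"
    using simple_closed_curve[OF H K2] .
  then interpret c2: circle_curve "mg_top E" L2 g2 by simp
  have K1p: "K1 \<subseteq> points E" and K2p: "K2 \<subseteq> points E"
    using c1.connected_K c2.connected_K connectedin_subset_topspace k1 k2 by (auto simp: points_def)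
  have K1W: "\<not> K1 \<subseteq> W"
    using connectedin_finite_t1[OF t1_graph[OF tE] c1.connected_K] c1.K_not_singleton fW k1 finite_subset
      image_is_empty c1.L by (metis atLeastatMost_empty_iff less_imp_le)
  have K2W: "\<not> K2 \<subseteq> W"
    using connectedin_finite_t1[OF t1_graph[OF tE] c2.connected_K] c2.K_not_singleton fW k2 finite_subset
      image_is_empty c2.L by (metis atLeastatMost_empty_iff less_imp_le)
  have "\<not> K1 - K2 \<subseteq> W"
  proof
    assume s: "K1 - K2 \<subseteq> W"
    then have "closedin (mg_top E) (K1 - K2)"
      using closedin_finite_graph[OF tE, of "K1 - K2"] fW finite_subset K1p by (auto simp: points_def)
    moreover have "closedin (mg_top E) K2" using c2.closed_K k2 by simp
    moreover have "K1 \<subseteq> (K1 - K2) \<union> K2" "(K1 - K2) \<inter> K2 \<inter> K1 = {}" by auto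
    moreover have "(K1 - K2) \<inter> K1 \<noteq> {}" using nsub by blast
    ultimately have "K2 \<inter> K1 = {}" using c1.connected_K k1 unfolding connectedin_closedin by meson
    then show False using s K1W by blast
  qed
  then obtain y1 where y1: "y1 \<in> K1" "y1 \<notin> K2" "y1 \<in> points E - W" using K1p by blast
  obtain y2 where y2: "y2 \<in> K2" "y2 \<in> points E - W" using K2p K2W by blast
  obtain e1 where e1: "e1 \<in> ?F" "y1 \<in> e1" using edge_exists[OF y1(3)] by blast
  obtain e2 where e2: "e2 \<in> ?F" "y2 \<in> e2" using edge_exists[OF y2(2)] by blast
  have s1: "e1 \<subseteq> K1" using edge_in_circle[OF E W e1(1) K1] y1 e1 by blast
  have s2: "e2 \<subseteq> K2" using edge_in_circle[OF E W e2(1) K2] y2 e2 by blast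
  have d: "e1 \<inter> K2 = {}" using edge_in_circle[OF E W e1(1) K2] y1 e1 by blast
  \<comment> \<open>As infinite sets have cardinality 0, this is needed for the finiteness of the set of edges.\<close>
  have W0: "W \<noteq> {}"
  proof
    assume "W = {}"
    have "?F = {points E}"
    proof -
      have "e = points E" if e: "e \<in> ?F" for e
      proof -
        obtain x where x: "x \<in> e" using edge_nonempty[OF e] by blast
        then have "x \<in> points E" using edge_subset[OF e] by blast
        then have "points E \<subseteq> e" using edge_maximal[OF e con _ _ x] \<open>W = {}\<close> by simp
        then show ?thesis using edge_subset[OF e] by blast
      qed
      then show ?thesis using e1(1) by blast
    qed
    then show False using cardF \<open>W = {}\<close> by simp
  qed
  then have finF: "finite ?F" using cardF fW by (metis card_gt_0_iff)
  have ne: "K - e \<noteq> {}" if e: "e \<in> ?F" "closedin (mg_top E) K" "e \<subseteq> K" for e K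
  proof
    assume "K - e = {}"
    then have "closedin (mg_top E) e" using e by (metis Diff_eq_empty_iff subset_antisym)
    moreover have "openin (mg_top E) e" using vertex_set_edge_open[OF E W e(1)] .
    ultimately have "e = points E"
      using tE edge_nonempty[OF e(1)] unfolding topological_graph_def connected_space_clopen_in points_def by blast
    then show False using edge_subset[OF e(1)] W0 Wp by blast
  qed
  have "connectedin (mg_top E) (points E - e1)"
    using c1.closed_K c1.complement_connected[OF edge_connected[OF e1(1)]] s1 k1
    by (intro connected_minus[OF con vertex_set_edge_open[OF E W e1(1)] s1 K1p] ne[OF e1(1)]) auto
  moreover have "K2 \<subseteq> points E - e1" using d K2p by blast
  moreover have "closedin (mg_top E) K2" "connectedin (mg_top E) (K2 - e2)"
    using c2.closed_K c2.complement_connected[OF edge_connected[OF e2(1)]] s2 k2 by simp_all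
  ultimately have "connectedin (mg_top E) (points E - e1 - e2)"
    using connected_minus[OF _ vertex_set_edge_open[OF E W e2(1)] s2 _ _ _ ne[OF e2(1) _ s2]] by blast
  moreover have "points E - e1 - e2 = W \<union> \<Union> (?F - {e1, e2})"
  proof
    show "points E - e1 - e2 \<subseteq> W \<union> \<Union> (?F - {e1, e2})" using edge_exists[of _ E W] by blast
    have "e \<inter> e1 = {} \<and> e \<inter> e2 = {}" if "e \<in> ?F - {e1, e2}" for e
      using edge_unique[of e E W e1] edge_unique[of e E W e2] that e1(1) e2(1) by blast
    then show "W \<union> \<Union> (?F - {e1, e2}) \<subseteq> points E - e1 - e2"
      using Wp edge_subset[of _ E W] edge_subset[OF e1(1)] edge_subset[OF e2(1)] by fast
  qed
  ultimately have "card W \<le> card (?F - {e1, e2}) + 1"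
    using edges_connected_bound[OF E W, of "?F - {e1, e2}"] finF by auto
  moreover have "e1 \<noteq> e2" using d e2 s2 y2 by blast
  then have "card (?F - {e1, e2}) = card ?F - 2" using e1(1) e2(1) by (subst card_Diff_subset) auto
  moreover have "card {e1, e2} \<le> card ?F" using finF e1(1) e2(1) by (intro card_mono) auto
  ultimately show False using cardF \<open>e1 \<noteq> e2\<close> by simp
qed

section \<open>Blocks\<close>

text \<open>Connected sets without cut points and with more than one point; unlike the blocks of graph theory
they need not be maximal.\<close>

definition block :: "'a topology \<Rightarrow> 'a set \<Rightarrow> bool" where
  "block X B \<longleftrightarrow> connectedin X B \<and> (\<forall>p. connectedin X (B - {p})) \<and> (\<exists>x\<in>B. \<exists>y\<in>B. x \<noteq> y)"

lemma block_subtopology: "B \<subseteq> S \<Longrightarrow> block (subtopology X S) B \<longleftrightarrow> block X B"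
  unfolding block_def connectedin_subtopology by blast

lemma block_homeomorphic:
  assumes "homeomorphic_map X Y f" "B \<subseteq> topspace X"
  shows "block Y (f ` B) \<longleftrightarrow> block X B"
proof -
  have inj: "inj_on f B"
    using homeomorphic_imp_injective_map[OF assms(1)] assms(2) inj_on_subset by blast
  have minus: "connectedin Y (f ` B - {f p}) \<longleftrightarrow> connectedin X (B - {p})" if "p \<in> B" for p
  proof -
    have "f ` B - {f p} = f ` (B - {p})" using inj that by (auto simp: inj_on_def)
    moreover have "B - {p} \<subseteq> topspace X" using assms(2) by blast
    ultimately show ?thesis using homeomorphic_map_connectedness[OF assms(1)] by metis
  qed
  have all: "connectedin Z C \<and> (\<forall>p. connectedin Z (C - {p})) \<longleftrightarrow> connectedin Z C \<and> (\<forall>p\<in>C. connectedin Z (C - {p}))"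
    for C and Z :: "'c topology"
    by (metis Diff_empty Diff_insert0)
  have "connectedin Y (f ` B) \<longleftrightarrow> connectedin X B"
    using homeomorphic_map_connectedness[OF assms] .
  moreover have "(\<exists>x\<in>f ` B. \<exists>y\<in>f ` B. x \<noteq> y) \<longleftrightarrow> (\<exists>x\<in>B. \<exists>y\<in>B. x \<noteq> y)"
    using inj by (auto simp: inj_on_def) (metis)
  moreover have "(connectedin Y (f ` B) \<and> (\<forall>p. connectedin Y (f ` B - {p}))) \<longleftrightarrow>
      (connectedin X B \<and> (\<forall>p. connectedin X (B - {p})))"
    unfolding all using minus calculation(1) by simp
  ultimately show ?thesis unfolding block_def by meson
qed

lemma simple_closed_block:
  assumes "Hausdorff_space X" "simple_closed X K"
  shows "block X K"
proof -
  obtain L g where c: "circle_curve X L g" and K: "K = g ` {0..L}" using simple_closed_curve[OF assms] .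
  interpret c: circle_curve X L g by fact
  have sp: "K \<subseteq> topspace X" using connectedin_subset_topspace[OF c.connected_K] K by simp
  have "connectedin X (K - {p})" for p
  proof (cases "p \<in> K")
    case True
    then have "connectedin X {p}" using sp by auto
    then show ?thesis using c.complement_connected[of "{p}"] True K by simp
  next
    case False
    then show ?thesis using c.connected_K K by simp
  qed
  moreover have "\<exists>x\<in>K. \<exists>y\<in>K. x \<noteq> y"
  proof (rule ccontr)
    assume a: "\<not> ?thesis"
    have "g 0 \<in> K" using K c.L by simp
    then have "K = {g 0}" using a by blast
    then show False using c.K_not_singleton K by blast
  qed
  ultimately show ?thesis using c.connected_K K unfolding block_def by blast
qed

text \<open>Removing the point \<open>P\<close> does not disconnect a block, but it separates the two parts.\<close>

lemma block_in_union:
  assumes "block X B" "closedin X A" "closedin X C" "B \<subseteq> A \<union> C" "A \<inter> C = {P}"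
  shows "B \<subseteq> A \<or> B \<subseteq> C"
proof -
  have "B - {P} \<subseteq> A \<union> C" "A \<inter> C \<inter> (B - {P}) = {}" using assms by blast+
  moreover have "connectedin X (B - {P})" using assms(1) by (simp add: block_def)
  ultimately have "A \<inter> (B - {P}) = {} \<or> C \<inter> (B - {P}) = {}"
    using assms(2,3) unfolding connectedin_closedin by meson
  then have "A \<inter> B \<subseteq> {P} \<or> C \<inter> B \<subseteq> {P}" by blast
  moreover have "P \<in> A" "P \<in> C" using assms(5) by auto
  ultimately show ?thesis using assms(4) by fast
qed

lemma no_block_in_line:
  fixes B :: "'a::{linorder_topology, dense_linorder} set"
  shows "\<not> block (top_of_set S) B"
proof
  assume b: "block (top_of_set S) B"
  then obtain x y where "x \<in> B" "y \<in> B" "x \<noteq> y" by (auto simp: block_def)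
  then obtain a b where ab: "a \<in> B" "b \<in> B" "a < b" by (metis linorder_neqE)
  then obtain c where c: "a < c" "c < b" using dense by blast
  have "connected (B - {c})" using b by (auto simp: block_def connectedin_subtopology)
  moreover have "a \<in> B - {c}" "b \<in> B - {c}" using ab c by auto
  ultimately have "c \<in> B - {c}" using c connectedD_interval by (metis less_imp_le)
  then show False by simp
qed

lemma circle_metric:
  assumes "0 < L"
  shows "Metric_space {0..<L} (circle_dist L)"
proof
  show "0 \<le> circle_dist L x y" for x y by (simp add: circle_dist_def)
  show "circle_dist L x y = circle_dist L y x" for x y by (simp add: circle_dist_def abs_minus_commute)
  show "circle_dist L x y = 0 \<longleftrightarrow> x = y" if "x \<in> {0..<L}" "y \<in> {0..<L}" for x y
    using that by (auto simp: circle_dist_def min_def abs_if split: if_splits)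
  show "circle_dist L x z \<le> circle_dist L x y + circle_dist L y z"
    if "x \<in> {0..<L}" "y \<in> {0..<L}" "z \<in> {0..<L}" for x y z
    using that by (auto simp: circle_dist_def min_def abs_if)
qed

lemma points_circle: "0 < L \<Longrightarrow> points (circle L) = {0..<L}"
  by (simp add: points_def circle_def Metric_space.topspace_mtopology[OF circle_metric])

text \<open>The map from the interval that identifies the end points does not increase distances.\<close>

lemma circle_simple_closed:
  assumes "0 < L"
  shows "simple_closed (mg_top (circle L)) (points (circle L))"
proof -
  interpret Metric_space "{0..<L}" "circle_dist L" using circle_metric[OF assms] .
  define g where "g t = (if t = L then 0 else t)" for t
  have gin: "g t \<in> {0..<L}" if "t \<in> {0..L}" for t using that assms by (auto simp: g_def)
  have short: "circle_dist L (g s) (g t) \<le> \<bar>s - t\<bar>" if "s \<in> {0..L}" "t \<in> {0..L}" for s t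
    using that assms by (auto simp: g_def circle_dist_def min_def)
  have "continuous_map (top_of_set {0..L}) mtopology g"
    unfolding continuous_map_to_metric
  proof (intro ballI allI impI)
    fix x \<epsilon> :: real assume x: "x \<in> topspace (top_of_set {0..L})" and "0 < \<epsilon>"
    have "g y \<in> mball (g x) \<epsilon>" if "y \<in> {0..L} \<inter> ball x \<epsilon>" for y
    proof -
      have "circle_dist L (g x) (g y) \<le> \<bar>x - y\<bar>" using short x that by auto
      also have "\<dots> < \<epsilon>" using that by (simp add: dist_real_def)
      finally show ?thesis using gin x that by auto
    qed
    moreover have "openin (top_of_set {0..L}) ({0..L} \<inter> ball x \<epsilon>)" by blast
    ultimately show "\<exists>U. openin (top_of_set {0..L}) U \<and> x \<in> U \<and> (\<forall>y\<in>U. g y \<in> mball (g x) \<epsilon>)"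
      using x \<open>0 < \<epsilon>\<close> by (intro exI[of _ "{0..L} \<inter> ball x \<epsilon>"]) auto
  qed
  moreover have "inj_on g {0..<L}" by (auto simp: g_def inj_on_def)
  moreover have "g 0 = g L" by (simp add: g_def)
  ultimately have "closed_curve (mg_top (circle L)) L g"
    using assms by (simp add: closed_curve_def circle_def)
  moreover have "points (circle L) = g ` {0..L}"
  proof
    show "points (circle L) \<subseteq> g ` {0..L}"
    proof
      fix x assume "x \<in> points (circle L)"
      then have "x \<in> {0..<L}" using points_circle[OF assms] by simp
      then show "x \<in> g ` {0..L}" by (intro image_eqI[of _ _ x]) (auto simp: g_def)
    qed
    show "g ` {0..L} \<subseteq> points (circle L)" using gin points_circle[OF assms] by auto
  qed
  ultimately show ?thesis unfolding simple_closed_def by blast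
qed

section \<open>Gluing loops and infinite edges\<close>

text \<open>What remains of the structure of \<open>G\<^sub>n\<close> while loops and infinite edges are attached: \<open>loop i\<close> is the
loop at \<open>q i\<close>, and the loops and the original graph together contain all blocks.\<close>

definition loop_decomposition ::
    "'a mgraph \<Rightarrow> (nat \<Rightarrow> 'a) \<Rightarrow> nat \<Rightarrow> 'a mgraph \<Rightarrow> (nat \<Rightarrow> 'a set) \<Rightarrow> bool" where
  "loop_decomposition G0 q k G loop \<longleftrightarrow> metric_graph G \<and> points G0 \<subseteq> points G \<and>
     subtopology (mg_top G) (points G0) = mg_top G0 \<and>
     finite_points G0 \<subseteq> finite_points G \<and>
     (\<forall>x\<in>finite_points G0. \<forall>y\<in>finite_points G0. mg_dist G x y = mg_dist G0 x y) \<and>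
     (\<forall>i<k. simple_closed (mg_top G) (loop i) \<and> loop i \<inter> points G0 = {q i}) \<and>
     (\<forall>i<k. \<forall>j<k. i \<noteq> j \<longrightarrow> loop i \<inter> loop j = {}) \<and>
     (\<forall>B. block (mg_top G) B \<longrightarrow> B \<subseteq> points G0 \<or> (\<exists>i<k. B \<subseteq> loop i))"

text \<open>The part of the gluing step that is common to loops and infinite edges.\<close>

lemma attach_loop_decomposition:
  assumes dec: "loop_decomposition G0 q k G loop" and att: "attach G P C c G'"
    and comp: "compact_space (mg_top C)" and c: "c \<in> finite_points C" and inf: "mg_inf C \<subseteq> points C"
  obtains \<kappa> where "embedding_map (mg_top C) (mg_top G') \<kappa>" "points G \<inter> \<kappa> ` points C = {P}"
    "metric_graph G'" "points G0 \<subseteq> points G'" "subtopology (mg_top G') (points G0) = mg_top G0"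
    "finite_points G0 \<subseteq> finite_points G'"
    "\<forall>x\<in>finite_points G0. \<forall>y\<in>finite_points G0. mg_dist G' x y = mg_dist G0 x y"
    "\<forall>i<k. simple_closed (mg_top G') (loop i)" "\<forall>i<k. loop i \<subseteq> points G"
    "\<forall>B. block (mg_top G') B \<longrightarrow> B \<subseteq> points G0 \<or> (\<exists>i<k. B \<subseteq> loop i) \<or> B \<subseteq> \<kappa> ` points C"
proof -
  have G': "metric_graph G'" and sub: "points G \<subseteq> points G'" and top: "subtopology (mg_top G') (points G) = mg_top G"
    and dist: "\<And>x y. x \<in> finite_points G \<Longrightarrow> y \<in> finite_points G \<Longrightarrow> mg_dist G' x y = mg_dist G x y"
    using att unfolding attach_def by auto
  obtain \<kappa> where emb: "embedding_map (mg_top C) (mg_top G') \<kappa>" and un: "points G \<union> \<kappa> ` points C = points G'"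
    and int: "points G \<inter> \<kappa> ` points C = {P}" and \<kappa>c: "\<kappa> c = P" and inf': "mg_inf G' = mg_inf G \<union> \<kappa> ` mg_inf C"
    using att unfolding attach_def by auto
  have G: "metric_graph G" and sub0: "points G0 \<subseteq> points G"
    and top0: "subtopology (mg_top G) (points G0) = mg_top G0"
    and fin0: "finite_points G0 \<subseteq> finite_points G"
    and dist0: "\<And>x y. x \<in> finite_points G0 \<Longrightarrow> y \<in> finite_points G0 \<Longrightarrow> mg_dist G x y = mg_dist G0 x y"
    and scc: "\<And>i. i < k \<Longrightarrow> simple_closed (mg_top G) (loop i)"
    and blocks: "\<And>B. block (mg_top G) B \<Longrightarrow> B \<subseteq> points G0 \<or> (\<exists>i<k. B \<subseteq> loop i)"
    using dec unfolding loop_decomposition_def by auto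
  have H': "Hausdorff_space (mg_top G')" and HG: "Hausdorff_space (mg_top G)"
    and compG: "compact_space (mg_top G)"
    using metric_graph_top[OF G'] metric_graph_top[OF G] by (auto simp: topological_graph_def)
  have \<kappa>cont: "continuous_map (mg_top C) (mg_top G') \<kappa>" and \<kappa>inj: "inj_on \<kappa> (points C)"
    using emb homeomorphic_imp_continuous_map homeomorphic_imp_injective_map
    unfolding embedding_map_def points_def by (blast dest: continuous_map_into_fulltopology)+
  have "closedin (mg_top G') (\<kappa> ` points C)"
    using compactin_imp_closedin[OF H' image_compactin[OF _ \<kappa>cont]] comp
    by (simp add: compact_space_def points_def)
  moreover have "closedin (mg_top G') (points G)"
  proof (rule compactin_imp_closedin[OF H'])
    have "compact_space (subtopology (mg_top G') (points G))" using compG top by simp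
    then show "compactin (mg_top G') (points G)" using sub by (simp add: compactin_subspace points_def)
  qed
  ultimately have bl: "B \<subseteq> points G \<or> B \<subseteq> \<kappa> ` points C" if B: "block (mg_top G') B" for B
  proof -
    have "B \<subseteq> points G'" using B connectedin_subset_topspace unfolding block_def points_def by blast
    then show ?thesis
      using block_in_union[OF B \<open>closedin _ (points G)\<close> \<open>closedin _ (\<kappa> ` points C)\<close> _ int] un by blast
  qed
  have "subtopology (mg_top G') (points G0) = subtopology (subtopology (mg_top G') (points G)) (points G0)"
    using sub0 by (simp add: subtopology_subtopology Int_absorb1)
  then have t: "subtopology (mg_top G') (points G0) = mg_top G0" using top top0 by simp
  have fin: "finite_points G \<subseteq> finite_points G'"
  proof
    fix x assume x: "x \<in> finite_points G"
    have "x \<notin> \<kappa> ` mg_inf C"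
    proof
      assume "x \<in> \<kappa> ` mg_inf C"
      then obtain z where z: "z \<in> mg_inf C" "x = \<kappa> z" by blast
      then have "x = P" using x int inf by (auto simp: finite_points_def)
      then have "z = c" using \<kappa>inj z \<kappa>c c inf by (auto simp: finite_points_def inj_on_def)
      then show False using z c by (simp add: finite_points_def)
    qed
    then show "x \<in> finite_points G'" using x inf' sub by (auto simp: finite_points_def)
  qed
  have loop_sub: "loop i \<subseteq> points G" if "i < k" for i
    using simple_closed_block[OF HG scc[OF that]] connectedin_subset_topspace unfolding block_def points_def by blast
  show ?thesis
  proof (rule that[OF emb int G' _ t])
    show "points G0 \<subseteq> points G'" using sub sub0 by blast
    show "finite_points G0 \<subseteq> finite_points G'" using fin fin0 by blast
    show "\<forall>x\<in>finite_points G0. \<forall>y\<in>finite_points G0. mg_dist G' x y = mg_dist G0 x y"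
      using dist dist0 fin0 by (metis subsetD)
    show "\<forall>i<k. simple_closed (mg_top G') (loop i)"
      using scc top simple_closed_subtopology by metis
    show "\<forall>i<k. loop i \<subseteq> points G" using loop_sub by blast
    show "\<forall>B. block (mg_top G') B \<longrightarrow> B \<subseteq> points G0 \<or> (\<exists>i<k. B \<subseteq> loop i) \<or> B \<subseteq> \<kappa> ` points C"
    proof (intro allI impI)
      fix B assume B: "block (mg_top G') B"
      show "B \<subseteq> points G0 \<or> (\<exists>i<k. B \<subseteq> loop i) \<or> B \<subseteq> \<kappa> ` points C"
      proof (cases "B \<subseteq> \<kappa> ` points C")
        case False
        then have "B \<subseteq> points G" using bl[OF B] by blast
        then have "block (mg_top G) B" using block_subtopology[of B "points G" "mg_top G'"] B top by simp
        then show ?thesis using blocks by blast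
      qed simp
    qed
  qed
qed

lemma compact_circle:
  assumes "0 < L"
  shows "compact_space (mg_top (circle L))"
proof -
  obtain M g where "closed_curve (mg_top (circle L)) M g" "points (circle L) = g ` {0..M}"
    using circle_simple_closed[OF assms] by (auto simp: simple_closed_def)
  then show ?thesis
    using image_compactin[of "top_of_set {0..M}" "{0..M}" "mg_top (circle L)" g]
    by (simp add: closed_curve_def compact_space_def points_def compactin_subtopology)
qed

lemma loops_decomposition:
  assumes "metric_graph G0" "\<And>i. i < k \<Longrightarrow> r i > 0" "inj_on q {..<k}" "\<And>i. i < k \<Longrightarrow> q i \<in> points G0"
    and "attach_loops q r k G0 G"
  shows "\<exists>loop. loop_decomposition G0 q k G loop"
  using assms(2-)
proof (induction k arbitrary: G)
  case 0
  have "B \<subseteq> points G0" if "block (mg_top G0) B" for B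
    using that connectedin_subset_topspace unfolding block_def points_def by blast
  moreover have "G = G0" using 0 by simp
  moreover have "subtopology (mg_top G0) (points G0) = mg_top G0" by (simp add: points_def)
  ultimately show ?case using assms(1) unfolding loop_decomposition_def by simp
next
  case (Suc k)
  then obtain \<Delta> where \<Delta>: "attach_loops q r k G0 \<Delta>" "attach \<Delta> (q k) (circle (r k)) 0 G" by auto
  have "inj_on q {..<k}" using Suc.prems(2) by (rule inj_on_subset) auto
  then obtain loop where loop: "loop_decomposition G0 q k \<Delta> loop"
    using Suc.IH[OF _ _ _ \<Delta>(1)] Suc.prems by (meson less_SucI)
  have r: "r k > 0" using Suc.prems by simp
  have 0: "0 \<in> finite_points (circle (r k))" "mg_inf (circle (r k)) \<subseteq> points (circle (r k))"
    using points_circle[OF r] r by (auto simp: finite_points_def circle_def)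
  obtain \<kappa> where \<kappa>: "embedding_map (mg_top (circle (r k))) (mg_top G) \<kappa>"
    "points \<Delta> \<inter> \<kappa> ` points (circle (r k)) = {q k}"
    "metric_graph G" "points G0 \<subseteq> points G" "subtopology (mg_top G) (points G0) = mg_top G0"
    "finite_points G0 \<subseteq> finite_points G"
    "\<forall>x\<in>finite_points G0. \<forall>y\<in>finite_points G0. mg_dist G x y = mg_dist G0 x y"
    "\<forall>i<k. simple_closed (mg_top G) (loop i)" "\<forall>i<k. loop i \<subseteq> points \<Delta>"
    "\<forall>B. block (mg_top G) B \<longrightarrow> B \<subseteq> points G0 \<or> (\<exists>i<k. B \<subseteq> loop i) \<or> B \<subseteq> \<kappa> ` points (circle (r k))"
    using attach_loop_decomposition[OF loop \<Delta>(2) compact_circle[OF r] 0] .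
  define loop' where "loop' = loop(k := \<kappa> ` points (circle (r k)))"
  have old: "loop' i = loop i" if "i < k" for i using that by (simp add: loop'_def)
  have new: "loop' k = \<kappa> ` points (circle (r k))" by (simp add: loop'_def)
  have int: "\<And>i. i < k \<Longrightarrow> loop i \<inter> points G0 = {q i}" and sub: "points G0 \<subseteq> points \<Delta>"
    and disj: "\<And>i j. i < k \<Longrightarrow> j < k \<Longrightarrow> i \<noteq> j \<Longrightarrow> loop i \<inter> loop j = {}"
    using loop unfolding loop_decomposition_def by auto
  have qk: "q k \<in> points G0" using Suc.prems by simp
  have new_disj: "loop i \<inter> loop' k = {}" if i: "i < k" for i
  proof -
    have "q k \<noteq> q i" using inj_onD[OF Suc.prems(2), of k i] i by auto
    then have "q k \<notin> loop i" using int[OF i] qk by blast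
    moreover have "loop i \<subseteq> points \<Delta>" using \<kappa>(9) i by simp
    ultimately have "x \<notin> loop' k" if "x \<in> loop i" for x
    proof -
      have "x \<in> points \<Delta>" "x \<noteq> q k" using that \<open>q k \<notin> loop i\<close> \<open>loop i \<subseteq> points \<Delta>\<close> by auto
      then show ?thesis using \<kappa>(2) unfolding new by (metis IntI singletonD)
    qed
    then show ?thesis by blast
  qed
  have sc: "simple_closed (mg_top G) (loop' k)"
    unfolding new
  proof (rule simple_closed_image[OF circle_simple_closed[OF r]])
    show "continuous_map (mg_top (circle (r k))) (mg_top G) \<kappa>" "inj_on \<kappa> (points (circle (r k)))"
      using \<kappa>(1) homeomorphic_imp_continuous_map homeomorphic_imp_injective_map
      unfolding embedding_map_def points_def by (blast dest: continuous_map_into_fulltopology)+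
  qed
  have "loop_decomposition G0 q (Suc k) G loop'"
    unfolding loop_decomposition_def
  proof (intro conjI allI impI ballI)
    show "simple_closed (mg_top G) (loop' i)" if "i < Suc k" for i
      using that sc \<kappa>(8) old by (metis less_SucE)
    show "loop' i \<inter> points G0 = {q i}" if "i < Suc k" for i
    proof (cases "i = k")
      case True
      then show ?thesis using \<kappa>(2) new sub qk by blast
    next
      case False
      then show ?thesis using that int old by simp
    qed
    show "loop' i \<inter> loop' j = {}" if "i < Suc k" "j < Suc k" "i \<noteq> j" for i j
      using that new_disj old disj by (metis Int_commute less_SucE)
    show "B \<subseteq> points G0 \<or> (\<exists>i<Suc k. B \<subseteq> loop' i)" if "block (mg_top G) B" for B
      using \<kappa>(10)[rule_format, OF that] new old by (metis less_Suc_eq)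
  qed (use \<kappa> in auto)
  then show ?case by blast
qed

lemma infinite_edge_facts:
  "compact_space (mg_top infinite_edge)" "0 \<in> finite_points infinite_edge"
  "mg_inf infinite_edge \<subseteq> points infinite_edge"
  by (auto simp: infinite_edge_def finite_points_def points_def compact_space_subtopology
      compact_eq_closed)

text \<open>An infinite edge contains no block, so tropical modifications do not change the decomposition.\<close>

lemma tropical_decomposition:
  assumes "tropical_modification G G'" "loop_decomposition G0 q k G loop"
  shows "loop_decomposition G0 q k G' loop"
  using assms(1) unfolding tropical_modification_def
proof (induction rule: rtranclp_induct)
  case base
  then show ?case using assms(2) .
next
  case (step \<Delta> G')
  obtain P where att: "attach \<Delta> P infinite_edge 0 G'"
    using step(2) unfolding elementary_tropical_modification_def by blast
  obtain \<kappa> where \<kappa>: "embedding_map (mg_top infinite_edge) (mg_top G') \<kappa>"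
    "points \<Delta> \<inter> \<kappa> ` points infinite_edge = {P}"
    "metric_graph G'" "points G0 \<subseteq> points G'" "subtopology (mg_top G') (points G0) = mg_top G0"
    "finite_points G0 \<subseteq> finite_points G'"
    "\<forall>x\<in>finite_points G0. \<forall>y\<in>finite_points G0. mg_dist G' x y = mg_dist G0 x y"
    "\<forall>i<k. simple_closed (mg_top G') (loop i)" "\<forall>i<k. loop i \<subseteq> points \<Delta>"
    "\<forall>B. block (mg_top G') B \<longrightarrow> B \<subseteq> points G0 \<or> (\<exists>i<k. B \<subseteq> loop i) \<or> B \<subseteq> \<kappa> ` points infinite_edge"
    using attach_loop_decomposition[OF step(3) att infinite_edge_facts] .
  have no: "\<not> B \<subseteq> \<kappa> ` points infinite_edge" if B: "block (mg_top G') B" for B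
  proof
    assume "B \<subseteq> \<kappa> ` points infinite_edge"
    then obtain D where D: "D \<subseteq> points infinite_edge" "B = \<kappa> ` D" by (rule subset_imageE)
    have "block (subtopology (mg_top G') (\<kappa> ` topspace (mg_top infinite_edge))) (\<kappa> ` D)"
      using B D block_subtopology by (metis image_mono points_def)
    then have "block (mg_top infinite_edge) D"
      using block_homeomorphic \<kappa>(1) D(1) unfolding embedding_map_def points_def by blast
    then have "block (top_of_set {0..\<infinity>}) D" by (simp add: infinite_edge_def)
    with no_block_in_line[of "{0..\<infinity>::ereal}" D] show False by (rule notE)
  qed
  have "B \<subseteq> points G0 \<or> (\<exists>i<k. B \<subseteq> loop i)" if "block (mg_top G') B" for B
    using \<kappa>(10)[rule_format, OF that] no[OF that] by blast
  then show ?case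
    using \<kappa>(3-8) step(3) unfolding loop_decomposition_def by simp
qed

section \<open>Local isometries between intervals\<close>

definition isometric_at :: "real \<Rightarrow> (real \<Rightarrow> real) \<Rightarrow> real \<Rightarrow> bool" where
  "isometric_at a f t \<longleftrightarrow>
     (\<exists>\<epsilon>>0. \<forall>s\<in>{0..a}. \<bar>s - t\<bar> < \<epsilon> \<longrightarrow> \<bar>f s - f t\<bar> = \<bar>s - t\<bar>)"

text \<open>The function \<open>f t - t\<close> is locally constant away from finitely many points.\<close>

lemma increasing_local_isometry:
  fixes f :: "real \<Rightarrow> real"
  assumes "finite S" and cont: "continuous_on {0..a} f" and mono: "strict_mono_on {0..a} f"
    and iso: "\<And>t. t \<in> {0<..<a} - S \<Longrightarrow> isometric_at a f t"
    and "f 0 = 0" "t \<in> {0..a}"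
  shows "f t = t"
proof -
  have "f t - t = 0"
  proof (rule has_derivative_zero_unique_strong_interval[of "S \<union> {0, a}" 0 a "\<lambda>t. f t - t"])
    show "finite (S \<union> {0, a})" using assms(1) by simp
    show "continuous_on {0..a} (\<lambda>t. f t - t)" by (intro continuous_intros cont)
    show "f 0 - 0 = 0" using assms(5) by simp
    show "t \<in> {0..a}" by fact
    fix x assume x: "x \<in> {0..a} - (S \<union> {0, a})"
    then obtain \<epsilon> where \<epsilon>: "\<epsilon> > 0" "\<forall>s\<in>{0..a}. \<bar>s - x\<bar> < \<epsilon> \<longrightarrow> \<bar>f s - f x\<bar> = \<bar>s - x\<bar>"
      using iso[of x] unfolding isometric_at_def by auto
    have "f x - x = f s - s" if s: "s \<in> {0..a}" "dist s x < \<epsilon>" for s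
    proof -
      have e: "\<bar>f s - f x\<bar> = \<bar>s - x\<bar>" using \<epsilon>(2) s by (simp add: dist_real_def)
      consider "s < x" | "s = x" | "x < s" by linarith
      then show ?thesis
      proof cases
        case 1
        then have "f s < f x" using mono s x by (auto simp: strict_mono_on_def)
        then show ?thesis using e 1 by simp
      next
        case 3
        then have "f x < f s" using mono s x by (auto simp: strict_mono_on_def)
        then show ?thesis using e 3 by simp
      qed simp
    qed
    moreover have "x \<in> {0..a}" using x by simp
    ultimately show "((\<lambda>t. f t - t) has_derivative (\<lambda>h. 0)) (at x within {0..a})"
      by (intro has_derivative_transform_within[OF has_derivative_const[of "f x - x"] \<epsilon>(1)])
  qed
  then show ?thesis by simp
qed

lemma local_isometry_of_intervals:
  fixes f :: "real \<Rightarrow> real"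
  assumes "finite S" "0 < a" "0 < b" and cont: "continuous_on {0..a} f" and inj: "inj_on f {0..a}"
    and iso: "\<And>t. t \<in> {0<..<a} - S \<Longrightarrow> isometric_at a f t"
    and ends: "f 0 = 0 \<and> f a = b \<or> f 0 = b \<and> f a = 0"
  shows "a = b" "f 0 = b \<Longrightarrow> t \<in> {0..a} \<Longrightarrow> f t = a - t"
proof -
  have "is_interval {0..a}" by simp
  then have m: "strict_mono_on {0..a} f \<or> strict_antimono_on {0..a} f"
    using injective_eq_monotone_map[of "{0..a}" f] cont inj by blast
  have "a = b \<and> (f 0 = b \<longrightarrow> (\<forall>t\<in>{0..a}. f t = a - t))"
  proof (cases "f 0 = 0")
    case True
    then have "f a = b" using ends assms by auto
    have "strict_mono_on {0..a} f"
      using m monotone_onD[of "{0..a}" "(<)" "(>)" f 0 a] True \<open>f a = b\<close> assms(2,3) by auto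
    then have "f a = a"
      using increasing_local_isometry[OF assms(1) cont _ iso True, of a] assms(2) by simp
    then show ?thesis using \<open>f a = b\<close> True assms(3) by simp
  next
    case False
    then have f: "f 0 = b" "f a = 0" using ends by auto
    then have anti: "strict_antimono_on {0..a} f"
      using m monotone_onD[of "{0..a}" "(<)" "(<)" f 0 a] assms(2,3) by auto
    have "strict_mono_on {0..a} (\<lambda>t. b - f t)"
      using monotone_onD[OF anti] by (intro strict_mono_onI) simp
    moreover have "isometric_at a (\<lambda>t. b - f t) t"
      if "t \<in> {0<..<a} - S" for t
      using iso[OF that] by (auto simp: isometric_at_def abs_minus_commute)
    moreover have "continuous_on {0..a} (\<lambda>t. b - f t)" by (intro continuous_intros cont)
    ultimately have eq: "b - f t = t" if "t \<in> {0..a}" for t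
      using increasing_local_isometry[OF assms(1), of a "\<lambda>t. b - f t" t] f that by simp
    then have "a = b" using f(2) assms(2) eq[of a] by simp
    then show ?thesis using eq by force
  qed
  then show "a = b" "f 0 = b \<Longrightarrow> t \<in> {0..a} \<Longrightarrow> f t = a - t" by auto
qed

section \<open>Involutions of the theta graph\<close>

lemma star_nbhd_involution:
  assumes "homeomorphic_map X X f" "star_nbhd X P U n" "\<And>x. x \<in> topspace X \<Longrightarrow> f (f x) = x"
  shows "star_nbhd X (f P) (f ` U) n"
proof -
  have U: "openin X U" "P \<in> U" "U \<subseteq> topspace X" using assms(2) openin_subset by (auto simp: star_nbhd_def)
  obtain g where g: "homeomorphic_map (subtopology X U) (top_of_set (star n)) g" "g P = 0"
    using assms(2) unfolding star_nbhd_def by blast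
  have "openin X (f ` U)" using assms(1) U homeomorphic_map_openness by metis
  moreover have "f ` f ` U = U" using assms(3) U(3) by (force simp: image_image)
  moreover have "f ` U \<subseteq> topspace X" using calculation(1) openin_subset by blast
  moreover have img: "f ` topspace X = topspace X" using assms(1) homeomorphic_imp_surjective_map by blast
  ultimately have "homeomorphic_map (subtopology X (f ` U)) (subtopology X U) f"
    using homeomorphic_map_subtopologies[OF assms(1), of "f ` U" U] U(3) by (simp add: Int_absorb1)
  from homeomorphic_map_compose[OF this g(1)]
  have "homeomorphic_map (subtopology X (f ` U)) (top_of_set (star n)) (g \<circ> f)" .
  moreover have "(g \<circ> f) (f P) = 0" using g(2) assms(3) U by auto
  ultimately show ?thesis unfolding star_nbhd_def using \<open>openin X (f ` U)\<close> U(2) by blast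
qed

lemma valence_involution:
  assumes "topological_graph X" "homeomorphic_map X X f" "\<And>x. x \<in> topspace X \<Longrightarrow> f (f x) = x" "P \<in> topspace X"
  shows "valence X (f P) = valence X P"
proof -
  obtain U where "star_nbhd X P U (valence X P)" using valence_chart[OF assms(1,4)] .
  then show ?thesis using star_nbhd_involution[OF assms(2) _ assms(3)] valence_eq by metis
qed

locale theta =
  fixes G :: "'a mgraph" and v1 v2 :: 'a and len :: "nat \<Rightarrow> real" and h :: "nat \<Rightarrow> real \<Rightarrow> 'a"
  assumes theta: "theta_graph G v1 v2 len h"
begin

abbreviation X :: "'a topology" where "X \<equiv> mg_top G"
abbreviation I :: "nat set" where "I \<equiv> {0, 1, 2}"
definition open_edge :: "nat \<Rightarrow> 'a set" where "open_edge i = h i ` {0<..<len i}"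
definition edge :: "nat \<Rightarrow> 'a set" where "edge i = h i ` {0..len i}"

lemma mgraph: "metric_graph G" and v12: "v1 \<in> points G" "v2 \<in> points G" "v1 \<noteq> v2"
  and valence_v: "valence X v1 = 3" "valence X v2 = 3"
  and valence_other: "\<And>P. P \<in> points G \<Longrightarrow> P \<noteq> v1 \<Longrightarrow> P \<noteq> v2 \<Longrightarrow> valence X P = 2"
  and bij: "bij_betw open_edge I (edges G {v1, v2})"
  and len_pos: "\<And>i. i \<in> I \<Longrightarrow> len i > 0"
  and param: "\<And>i. i \<in> I \<Longrightarrow> arclength_param G (len i) (h i)"
  and start: "\<And>i. i \<in> I \<Longrightarrow> h i 0 = v1" and finish: "\<And>i. i \<in> I \<Longrightarrow> h i (len i) = v2"
  and len_inj: "inj_on len I"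
  using theta unfolding theta_graph_def open_edge_def[abs_def] by auto

lemma top: "topological_graph X" using mgraph by (rule metric_graph_top)

lemma hom: "i \<in> I \<Longrightarrow> homeomorphic_map (top_of_set {0..len i}) (subtopology X (edge i)) (h i)"
  using param unfolding arclength_param_def edge_def by blast

lemma arclength: "i \<in> I \<Longrightarrow> t \<in> {0..len i} \<Longrightarrow> \<exists>\<epsilon>>0. \<forall>s\<in>{0..len i}. \<bar>s - t\<bar> < \<epsilon> \<longrightarrow> mg_dist G (h i s) (h i t) = \<bar>s - t\<bar>"
proof -
  assume i: "i \<in> I" and t: "t \<in> {0..len i}"
  obtain \<epsilon> where e: "\<epsilon> > 0" "\<forall>s\<in>{0..len i} \<inter> ball t \<epsilon>. \<forall>s'\<in>{0..len i} \<inter> ball t \<epsilon>. mg_dist G (h i s) (h i s') = \<bar>s - s'\<bar>"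
    using param[OF i] t unfolding arclength_param_def by blast
  then have "\<forall>s\<in>{0..len i}. \<bar>s - t\<bar> < \<epsilon> \<longrightarrow> mg_dist G (h i s) (h i t) = \<bar>s - t\<bar>"
    using t by (auto simp: dist_real_def abs_minus_commute)
  then show ?thesis using e(1) by blast
qed

lemma cont_h: "i \<in> I \<Longrightarrow> continuous_map (top_of_set {0..len i}) X (h i)"
  using homeomorphic_imp_continuous_map[OF hom] continuous_map_into_fulltopology by blast

lemma inj_h: "i \<in> I \<Longrightarrow> inj_on (h i) {0..len i}"
  using homeomorphic_imp_injective_map[OF hom] by simp

lemma edge_eq: "i \<in> I \<Longrightarrow> edge i = insert v1 (insert v2 (open_edge i))"
proof -
  assume i: "i \<in> I"
  have "{0..len i} = insert 0 (insert (len i) {0<..<len i})" using len_pos[OF i] by auto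
  then have "edge i = insert (h i 0) (insert (h i (len i)) (open_edge i))" unfolding edge_def open_edge_def by (metis image_insert)
  then show ?thesis using start[OF i] finish[OF i] by simp
qed

lemma open_edge_edges: "i \<in> I \<Longrightarrow> open_edge i \<in> edges G {v1, v2}"
  using bij by (auto simp: bij_betw_def)

lemma edge_is_open_edge: "e \<in> edges G {v1, v2} \<Longrightarrow> \<exists>i\<in>I. e = open_edge i"
  using bij_betw_imp_surj_on[OF bij] by (metis imageE)

lemma open_edge_unique: "i \<in> I \<Longrightarrow> j \<in> I \<Longrightarrow> x \<in> open_edge i \<Longrightarrow> x \<in> open_edge j \<Longrightarrow> i = j"
  using edge_unique[OF open_edge_edges open_edge_edges, of i j x] bij unfolding bij_betw_def by (meson inj_onD)

lemma open_edge_points: "i \<in> I \<Longrightarrow> x \<in> open_edge i \<Longrightarrow> x \<in> points G \<and> x \<noteq> v1 \<and> x \<noteq> v2"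
  using edge_subset[OF open_edge_edges] by blast

lemma open_edge_I: "0 < t \<Longrightarrow> t < len i \<Longrightarrow> h i t \<in> open_edge i"
  by (simp add: open_edge_def)

lemma edge_points: "i \<in> I \<Longrightarrow> edge i \<subseteq> points G"
proof
  fix x assume i: "i \<in> I" and "x \<in> edge i"
  then consider "x = v1" | "x = v2" | "x \<in> open_edge i" using edge_eq[OF i] by blast
  then show "x \<in> points G" using v12 open_edge_points[OF i] by cases auto
qed

lemma points_eq_edges: "points G = edge 0 \<union> edge 1 \<union> edge 2"
proof
  show "points G \<subseteq> edge 0 \<union> edge 1 \<union> edge 2"
  proof
    fix x assume x: "x \<in> points G"
    show "x \<in> edge 0 \<union> edge 1 \<union> edge 2"
    proof (cases "x \<in> {v1, v2}")
      case True
      then show ?thesis using edge_eq[of 0] by auto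
    next
      case False
      then obtain e where "e \<in> edges G {v1, v2}" "x \<in> e" using edge_exists[of x G "{v1, v2}"] x by blast
      then obtain i where "i \<in> I" "x \<in> open_edge i" using edge_is_open_edge by blast
      then show ?thesis using edge_eq[of i] by auto
    qed
  qed
  show "edge 0 \<union> edge 1 \<union> edge 2 \<subseteq> points G" using edge_points by simp
qed

lemma points_cases:
  assumes "x \<in> points G"
  obtains "x = v1" | "x = v2" | i where "i \<in> I" "x \<in> open_edge i"
  using assms points_eq_edges edge_eq[of 0] edge_eq[of 1] edge_eq[of 2] by auto

lemma no_infinite: "finite_points G = points G"
proof -
  have "valence X P \<noteq> 1" if "P \<in> points G" for P
    using valence_v valence_other[OF that] by (cases "P = v1 \<or> P = v2") auto
  moreover have "mg_inf G \<subseteq> {P \<in> points G. valence X P = 1}"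
    using mgraph by (simp add: metric_graph_def)
  ultimately show ?thesis unfolding finite_points_def by blast
qed

lemma connected_piece: "i \<in> I \<Longrightarrow> connected T \<Longrightarrow> T \<subseteq> {0..len i} \<Longrightarrow> connectedin X (h i ` T)"
  using connectedin_continuous_map_image[OF cont_h, of i T] by (simp add: connectedin_subtopology)

lemma connected_edge: "i \<in> I \<Longrightarrow> connectedin X (edge i)"
  unfolding edge_def by (rule connected_piece) auto

lemma ends_in_edge: "i \<in> I \<Longrightarrow> v1 \<in> edge i" "i \<in> I \<Longrightarrow> v2 \<in> edge i"
  using edge_eq by auto

lemma halves:
  assumes "i \<in> I" "x \<in> open_edge i"
  obtains A B where "connectedin X A" "connectedin X B" "v1 \<in> A" "v2 \<in> B" "edge i - {x} = A \<union> B"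
proof -
  obtain s where s: "0 < s" "s < len i" "x = h i s" using assms(2) by (auto simp: open_edge_def)
  have "{0..<s} \<subseteq> {0..len i}" "{s<..len i} \<subseteq> {0..len i}" using s by auto
  then have "connectedin X (h i ` {0..<s})" "connectedin X (h i ` {s<..len i})"
    by (auto intro!: connected_piece assms(1))
  moreover have "v1 \<in> h i ` {0..<s}" using start[OF assms(1)] s by (intro image_eqI[of _ _ 0]) auto
  moreover have "v2 \<in> h i ` {s<..len i}" using finish[OF assms(1)] s by (intro image_eqI[of _ _ "len i"]) auto
  moreover have "edge i - {x} = h i ` {0..<s} \<union> h i ` {s<..len i}"
  proof -
    have "edge i - {x} = h i ` ({0..len i} - {s})"
      using inj_on_image_set_diff[OF inj_h[OF assms(1)], of "{0..len i}" "{s}"] s by (simp add: edge_def)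
    moreover have "{0..len i} - {s} = {0..<s} \<union> {s<..len i}" using s by auto
    ultimately show ?thesis by (simp add: image_Un)
  qed
  ultimately show ?thesis by (rule that)
qed

lemma connected_minus_v:
  assumes "v \<in> {v1, v2}"
  shows "connectedin X (points G - {v})"
proof -
  define w where "w = (if v = v1 then v2 else v1)"
  have w: "w \<in> edge i - {v}" if "i \<in> I" for i using assms ends_in_edge[OF that] v12(3) by (auto simp: w_def)
  have c: "connectedin X (edge i - {v})" if i: "i \<in> I" for i
  proof -
    obtain T where T: "connected T" "T \<subseteq> {0..len i}" "edge i - {v} = h i ` T"
    proof (cases "v = v1")
      case True
      have "edge i - {h i 0} = h i ` ({0..len i} - {0})"
        using inj_on_image_set_diff[OF inj_h[OF i], of "{0..len i}" "{0}"] len_pos[OF i] by (simp add: edge_def)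
      moreover have "{0..len i} - {0} = {0<..len i}" by auto
      moreover have "{0<..len i} \<subseteq> {0..len i}" by auto
      ultimately show ?thesis using that[of "{0<..len i}"] True start[OF i] by simp
    next
      case False
      have "edge i - {h i (len i)} = h i ` ({0..len i} - {len i})"
        using inj_on_image_set_diff[OF inj_h[OF i], of "{0..len i}" "{len i}"] len_pos[OF i] by (simp add: edge_def)
      moreover have "{0..len i} - {len i} = {0..<len i}" by auto
      moreover have "{0..<len i} \<subseteq> {0..len i}" by auto
      ultimately show ?thesis using that[of "{0..<len i}"] False finish[OF i] assms by simp
    qed
    then show ?thesis using connected_piece[OF i] by metis
  qed
  have "points G - {v} = \<Union> {edge 0 - {v}, edge 1 - {v}, edge 2 - {v}}" using points_eq_edges by auto
  moreover have "connectedin X (\<Union> {edge 0 - {v}, edge 1 - {v}, edge 2 - {v}})"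
    using w[of 0] w[of 1] w[of 2] c[of 0] c[of 1] c[of 2] by (intro connectedin_Union) auto
  ultimately show ?thesis by simp
qed

lemma connected_minus_inner:
  assumes "i \<in> I" "x \<in> open_edge i"
  shows "connectedin X (points G - {x})"
proof -
  obtain A B where AB: "connectedin X A" "connectedin X B" "v1 \<in> A" "v2 \<in> B" "edge i - {x} = A \<union> B"
    using halves[OF assms] .
  obtain j k where jk: "j \<in> I" "k \<in> I" "j \<noteq> i" "k \<noteq> i" "I = {i, j, k}"
  proof -
    consider "i = 0" | "i = 1" | "i = 2" using assms(1) by blast
    then show thesis
    proof cases
      case 1
      show thesis by (rule that[of 1 2]) (use 1 in auto)
    next
      case 2
      show thesis by (rule that[of 0 2]) (use 2 in auto)
    next
      case 3
      show thesis by (rule that[of 0 1]) (use 3 in auto)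
    qed
  qed
  have "x \<notin> edge l" if "l \<in> I" "l \<noteq> i" for l
    using edge_eq[OF that(1)] open_edge_unique[OF assms(1) that(1) assms(2)] open_edge_points[OF assms] that(2) by auto
  then have "x \<notin> edge j" "x \<notin> edge k" using jk(1-4) by metis+
  moreover have "points G = (\<Union>l\<in>I. edge l)" unfolding points_eq_edges by auto
  ultimately have "points G - {x} = (edge i - {x}) \<union> edge j \<union> edge k" unfolding jk(5) by auto
  then have "points G - {x} = (edge j \<union> edge k \<union> A) \<union> B" unfolding AB(5) by auto
  moreover have "connectedin X (edge j \<union> edge k)"
    using connected_edge[OF jk(1)] connected_edge[OF jk(2)] ends_in_edge[OF jk(1)] ends_in_edge[OF jk(2)] by (intro connectedin_Un) auto
  then have "connectedin X (edge j \<union> edge k \<union> A)"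
    using AB(1,3) ends_in_edge[OF jk(1)] by (intro connectedin_Un[of _ "edge j \<union> edge k"]) auto
  then have "connectedin X ((edge j \<union> edge k \<union> A) \<union> B)"
    using AB(2,4) ends_in_edge[OF jk(1)] by (intro connectedin_Un[of _ "edge j \<union> edge k \<union> A"]) auto
  ultimately show ?thesis by simp
qed

lemma block_points: "block X (points G)"
proof -
  have c: "connectedin X (points G)"
    using top by (simp add: topological_graph_def points_def connectedin_topspace)
  have "connectedin X (points G - {p})" for p
  proof (cases "p \<in> points G")
    case True
    then show ?thesis
    proof (rule points_cases)
      show ?thesis if "p = v1" using connected_minus_v[of p] that by simp
      show ?thesis if "p = v2" using connected_minus_v[of p] that by simp
      show ?thesis if "i \<in> I" "p \<in> open_edge i" for i using connected_minus_inner[OF that] .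
    qed
  qed (use c in simp)
  then show ?thesis using c v12 unfolding block_def by blast
qed

text \<open>This distinguishes the theta graph from a circle: every remaining half of an edge is still attached
to one of the two branch points, and edge number 2 joins these.\<close>

lemma connected_minus_two:
  assumes "a \<in> open_edge 0" "b \<in> open_edge 1"
  shows "connectedin X (points G - {a, b})"
proof -
  obtain A B where AB: "connectedin X A" "connectedin X B" "v1 \<in> A" "v2 \<in> B" "edge 0 - {a} = A \<union> B"
    using halves[of 0 a] assms by auto
  obtain C D where CD: "connectedin X C" "connectedin X D" "v1 \<in> C" "v2 \<in> D" "edge 1 - {b} = C \<union> D"
    using halves[of 1 b] assms by auto
  have "a \<notin> edge 1" "a \<notin> edge 2" "b \<notin> edge 0" "b \<notin> edge 2"
    using edge_eq[of 0] edge_eq[of 1] edge_eq[of 2] open_edge_unique[of 0 1 a] open_edge_unique[of 0 2 a] open_edge_unique[of 1 0 b] open_edge_unique[of 1 2 b]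
      open_edge_points[of 0 a] open_edge_points[of 1 b] assms by auto
  then have "points G - {a, b} = (edge 0 - {a}) \<union> (edge 1 - {b}) \<union> edge 2" unfolding points_eq_edges by blast
  then have eq: "points G - {a, b} = \<Union> {edge 2, A, C} \<union> \<Union> {edge 2, B, D}" unfolding AB(5) CD(5) by auto
  have c2: "connectedin X (edge 2)" "v1 \<in> edge 2" "v2 \<in> edge 2"
    using connected_edge[of 2] ends_in_edge[of 2] by simp_all
  have "v1 \<in> \<Inter> {edge 2, A, C}" "v2 \<in> \<Inter> {edge 2, B, D}" using AB(3,4) CD(3,4) c2 by simp_all
  then have ne: "\<Inter> {edge 2, A, C} \<noteq> {}" "\<Inter> {edge 2, B, D} \<noteq> {}" by (metis empty_iff)+
  have "connectedin X (\<Union> {edge 2, A, C})" "connectedin X (\<Union> {edge 2, B, D})"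
    by (rule connectedin_Union[OF _ ne(1)], use AB CD c2 in blast,
        rule connectedin_Union[OF _ ne(2)], use AB CD c2 in blast)
  then have "connectedin X (\<Union> {edge 2, A, C} \<union> \<Union> {edge 2, B, D})"
    using c2(2) by (intro connectedin_Un) auto
  then show ?thesis unfolding eq .
qed

lemma not_simple_closed: "\<not> simple_closed X (points G)"
proof
  assume "simple_closed X (points G)"
  moreover have "Hausdorff_space X" using top by (simp add: topological_graph_def)
  ultimately obtain L g where c: "circle_curve X L g" and K: "points G = g ` {0..L}"
    using simple_closed_curve by metis
  interpret c: circle_curve X L g by fact
  have a: "h 0 (len 0 / 2) \<in> open_edge 0" and b: "h 1 (len 1 / 2) \<in> open_edge 1"
    using len_pos[of 0] len_pos[of 1] by (auto intro!: open_edge_I)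
  have "h 0 (len 0 / 2) \<noteq> h 1 (len 1 / 2)" using open_edge_unique[of 0 1] a b by auto
  then show False
    using c.two_points_separate connected_minus_two[OF a b] open_edge_points[OF _ a] open_edge_points[OF _ b] K by auto
qed

text \<open>The cycle runs along edge \<open>i\<close> and returns along edge \<open>j\<close>.\<close>

lemma cycle:
  assumes i: "i \<in> I" and j: "j \<in> I" and "i \<noteq> j"
  shows "simple_closed X (edge i \<union> edge j)"
proof -
  define a b where "a = len i" and "b = len j"
  have ab: "0 < a" "0 < b" using len_pos i j by (auto simp: a_def b_def)
  define g where "g t = (if t \<le> a then h i t else h j (a + b - t))" for t
  have "continuous_map (top_of_set {0..a+b}) X g"
    unfolding g_def
  proof (rule continuous_map_cases_le)
    show "continuous_map (top_of_set {0..a+b}) euclideanreal (\<lambda>t. t)" by (simp add: continuous_on_id)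
    show "continuous_map (top_of_set {0..a+b}) euclideanreal (\<lambda>t. a)" by simp
    have "{0..a+b} \<inter> {x. x \<in> topspace (top_of_set {0..a+b}) \<and> x \<le> a} \<subseteq> {0..a}" by auto
    then show "continuous_map (subtopology (top_of_set {0..a+b}) {x \<in> topspace (top_of_set {0..a+b}). x \<le> a}) X (h i)"
      unfolding subtopology_subtopology
      by (rule continuous_map_from_subtopology_mono[OF cont_h[OF i, folded a_def]])
    have "continuous_map (top_of_set {a..a+b}) (top_of_set {0..b}) (\<lambda>t. a + b - t)"
      by (auto simp: continuous_map_in_subtopology intro!: continuous_intros)
    from continuous_map_compose[OF this cont_h[OF j, folded b_def]]
    have "continuous_map (top_of_set {a..a+b}) X (\<lambda>t. h j (a + b - t))" by (simp add: o_def)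
    moreover have "{0..a+b} \<inter> {x. x \<in> topspace (top_of_set {0..a+b}) \<and> a \<le> x} \<subseteq> {a..a+b}" by auto
    ultimately show "continuous_map (subtopology (top_of_set {0..a+b}) {x \<in> topspace (top_of_set {0..a+b}). a \<le> x}) X (\<lambda>t. h j (a + b - t))"
      unfolding subtopology_subtopology by (rule continuous_map_from_subtopology_mono)
    show "h i x = h j (a + b - x)" if "x = a" for x
      using that finish i j by (simp add: a_def b_def)
  qed
  moreover have "g 0 = g (a + b)" using ab start i j by (simp add: g_def)
  moreover have "inj_on g {0..<a+b}"
  proof (rule inj_onI)
    fix s t assume st: "s \<in> {0..<a+b}" "t \<in> {0..<a+b}" "g s = g t"
    have late: "g u \<in> open_edge j" if "a < u" "u < a + b" for u
      using that open_edge_I[of "a + b - u" j] by (simp add: g_def b_def)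
    have early: "g u \<notin> open_edge j" if "0 \<le> u" "u \<le> a" for u
    proof -
      have "g u \<in> edge i" using that by (simp add: g_def edge_def a_def)
      then show ?thesis using edge_eq[OF i] open_edge_unique[OF i j] open_edge_points[OF j] \<open>i \<noteq> j\<close> by auto
    qed
    consider "s \<le> a" "t \<le> a" | "a < s" "a < t" | "s \<le> a" "a < t" | "a < s" "t \<le> a" by linarith
    then show "s = t"
    proof cases
      case 1
      then show ?thesis using st inj_onD[OF inj_h[OF i], of s t] by (simp add: g_def a_def)
    next
      case 2
      then show ?thesis using st inj_onD[OF inj_h[OF j], of "a+b-s" "a+b-t"] ab by (simp add: g_def b_def)
    next
      case 3
      then show ?thesis using late[of t] early[of s] st by simp
    next
      case 4
      then show ?thesis using late[of s] early[of t] st by simp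
    qed
  qed
  ultimately have "closed_curve X (a + b) g" using ab by (simp add: closed_curve_def)
  moreover have "g ` {0..a+b} = edge i \<union> edge j"
  proof -
    have "{0..a+b} = {0..a} \<union> {a..a+b}" using ab by auto
    then have "g ` {0..a+b} = g ` {0..a} \<union> g ` {a..a+b}" by (metis image_Un)
    moreover have "g ` {0..a} = edge i" by (simp add: g_def edge_def a_def cong: image_cong_simp)
    moreover have "g ` {a..a+b} = (\<lambda>t. h j (a + b - t)) ` {a..a+b}"
    proof (rule image_cong)
      show "g t = h j (a + b - t)" if "t \<in> {a..a+b}" for t
        using that finish[OF i] finish[OF j] by (cases "t = a") (simp_all add: g_def a_def b_def)
    qed simp
    moreover have "(\<lambda>t. a + b - t) ` {a..a+b} = {0..b}" by simp
    then have "(\<lambda>t. h j (a + b - t)) ` {a..a+b} = edge j" unfolding edge_def b_def[symmetric] by (metis image_image)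
    ultimately show ?thesis by simp
  qed
  ultimately show ?thesis unfolding simple_closed_def by metis
qed

lemma edge_coordinate:
  assumes "j \<in> I"
  obtains c where "continuous_map (subtopology X (edge j)) (top_of_set {0..len j}) c"
    "\<And>x. x \<in> edge j \<Longrightarrow> c x \<in> {0..len j} \<and> h j (c x) = x" "\<And>t. t \<in> {0..len j} \<Longrightarrow> c (h j t) = t"
proof -
  obtain c where c: "homeomorphic_maps (top_of_set {0..len j}) (subtopology X (edge j)) (h j) c"
    using hom[OF assms] homeomorphic_map_maps by blast
  have t: "topspace (subtopology X (edge j)) = edge j" using edge_points[OF assms] by (auto simp: points_def)
  show ?thesis
  proof (rule that)
    show cc: "continuous_map (subtopology X (edge j)) (top_of_set {0..len j}) c"
      using c by (simp add: homeomorphic_maps_def)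
    show "c x \<in> {0..len j} \<and> h j (c x) = x" if x: "x \<in> edge j" for x
    proof
      show "c x \<in> {0..len j}" using continuous_map_image_subset_topspace[OF cc] x t
        by (metis image_subset_iff topspace_euclidean_subtopology)
      show "h j (c x) = x" using c x t unfolding homeomorphic_maps_def by metis
    qed
    show "c (h j t) = t" if "t \<in> {0..len j}" for t
      using c that unfolding homeomorphic_maps_def by simp
  qed
qed

text \<open>Valences are preserved, so \<open>\<iota>\<close> permutes \<open>v1\<close> and \<open>v2\<close> as well as the three open edges. If it mapped
an edge to a different one, it would move all points of it, so it would be a local isometry
outside a finite set and the two lengths would be equal. Hence every edge is mapped to itself. If the
ends are fixed, \<open>\<iota>\<close> is increasing on each edge, and an increasing involution is the identity. If the
ends are exchanged, \<open>\<iota>\<close> is decreasing on each edge, so it has at most one fixed point there and is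
again a local isometry outside a finite set, that is, a reflection.\<close>

lemma involution_dichotomy:
  assumes maps: "\<And>x. x \<in> points G \<Longrightarrow> \<iota> x \<in> points G" and inv: "\<And>x. x \<in> points G \<Longrightarrow> \<iota> (\<iota> x) = x"
    and cont: "continuous_map X X \<iota>" and "finite D"
    and iso: "\<And>x. x \<in> points G - D \<Longrightarrow> \<iota> x \<noteq> x \<Longrightarrow> \<exists>N. openin X N \<and> x \<in> N \<and>
        (\<forall>y\<in>N. \<forall>z\<in>N. mg_dist G (\<iota> y) (\<iota> z) = mg_dist G y z)"
  shows "(\<forall>x\<in>points G. \<iota> x = x) \<or> (\<forall>i\<in>I. \<forall>t\<in>{0..len i}. \<iota> (h i t) = h i (len i - t))"
proof -
  have homeo: "homeomorphic_map X X \<iota>"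
    using homeomorphic_maps_map[of X X \<iota> \<iota>] cont inv
    by (simp add: homeomorphic_maps_def points_def)
  have inj: "inj_on \<iota> (points G)" by (rule inj_on_inverseI[of _ \<iota>]) (rule inv)
  have val: "valence X (\<iota> P) = valence X P" if "P \<in> points G" for P
    using valence_involution[OF top homeo] inv that by (simp add: points_def)
  have v: "\<iota> P \<in> {v1, v2}" if "P \<in> {v1, v2}" for P
  proof (rule ccontr)
    assume "\<iota> P \<notin> {v1, v2}"
    moreover have "P \<in> points G" using that v12 by auto
    ultimately show False using val[of P] valence_other[of "\<iota> P"] maps[of P] valence_v that by auto
  qed
  have ends: "\<iota> v1 = v1 \<and> \<iota> v2 = v2 \<or> \<iota> v1 = v2 \<and> \<iota> v2 = v1"
    using v[of v1] v[of v2] inv[of v1] inv[of v2] v12 by auto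
  have avoid: "\<iota> ` C \<inter> {v1, v2} = {}" if "C \<inter> {v1, v2} = {}" "C \<subseteq> points G" for C
  proof (rule ccontr)
    assume "\<not> ?thesis"
    then obtain x where x: "x \<in> C" "\<iota> x \<in> {v1, v2}" by blast
    then have "x \<in> {v1, v2}" using v[OF x(2)] inv[of x] that by auto
    then show False using x that by blast
  qed
  have into: "\<exists>j\<in>I. \<iota> ` open_edge i \<subseteq> open_edge j" if i: "i \<in> I" for i
  proof -
    have p: "open_edge i \<subseteq> points G" "open_edge i \<inter> {v1, v2} = {}" using open_edge_points[OF i] by blast+
    have x: "h i (len i / 2) \<in> open_edge i" using len_pos[OF i] by (intro open_edge_I) auto
    then have "\<iota> (h i (len i / 2)) \<in> points G - {v1, v2}" using avoid[OF p(2,1)] maps p(1) by blast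
    from edge_exists[OF this] obtain e where e: "e \<in> edges G {v1, v2}" "\<iota> (h i (len i / 2)) \<in> e" ..
    have "\<iota> ` open_edge i \<subseteq> e"
      using edge_maximal[OF e(1) connectedin_continuous_map_image[OF cont edge_connected[OF open_edge_edges[OF i]]] avoid[OF p(2,1)] _ e(2)] x
      by blast
    then show ?thesis using edge_is_open_edge[OF e(1)] by blast
  qed
  \<comment> \<open>In arc length coordinates, the restriction of the involution to an edge is a function between intervals.\<close>
  have main: "\<exists>f. continuous_on {0..len i} f \<and> inj_on f {0..len i} \<and> (\<forall>t\<in>{0..len i}. f t \<in> {0..len j} \<and> \<iota> (h i t) = h j (f t)) \<and>
      (f 0 = (if \<iota> v1 = v1 then 0 else len j)) \<and> (f (len i) = (if \<iota> v1 = v1 then len j else 0)) \<and>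
      (\<forall>t\<in>{0..len i}. \<iota> (h i t) \<noteq> h i t \<longrightarrow> h i t \<notin> D \<longrightarrow>
        isometric_at (len i) f t)"
    if i: "i \<in> I" and j: "j \<in> I" and ij: "\<iota> ` open_edge i \<subseteq> open_edge j" for i j
  proof -
    obtain c where c: "continuous_map (subtopology X (edge j)) (top_of_set {0..len j}) c"
      "\<And>x. x \<in> edge j \<Longrightarrow> c x \<in> {0..len j} \<and> h j (c x) = x" "\<And>t. t \<in> {0..len j} \<Longrightarrow> c (h j t) = t"
      using edge_coordinate[OF j] by blast
    define f where "f t = c (\<iota> (h i t))" for t
    have edge: "\<iota> ` edge i \<subseteq> edge j" using ij ends unfolding edge_eq[OF i] edge_eq[OF j] by auto
    have in_ce: "h i t \<in> edge i" if "t \<in> {0..len i}" for t using that by (simp add: edge_def)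
    have fh: "f t \<in> {0..len j} \<and> \<iota> (h i t) = h j (f t)" if "t \<in> {0..len i}" for t
      using c(2)[of "\<iota> (h i t)"] edge in_ce[OF that] unfolding f_def by (metis image_subset_iff)
    have "continuous_map (top_of_set {0..len i}) X (\<iota> \<circ> h i)"
      using continuous_map_compose[OF cont_h[OF i] cont] .
    then have "continuous_map (top_of_set {0..len i}) (subtopology X (edge j)) (\<iota> \<circ> h i)"
      using edge in_ce by (auto simp: continuous_map_in_subtopology)
    from continuous_map_compose[OF this c(1)]
    have contf: "continuous_on {0..len i} f"
      by (simp add: o_def f_def[abs_def] continuous_map_in_subtopology)
    have "inj_on f {0..len i}"
    proof (rule inj_onI)
      fix s t assume st: "s \<in> {0..len i}" "t \<in> {0..len i}" "f s = f t"
      then have "\<iota> (h i s) = \<iota> (h i t)" using fh by metis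
      then have "h i s = h i t" using inj in_ce[OF st(1)] in_ce[OF st(2)] edge_points[OF i] by (meson inj_onD subsetD)
      then show "s = t" using inj_h[OF i] st by (meson inj_onD)
    qed
    moreover have cv: "c v1 = 0" "c v2 = len j"
      using c(3)[of 0] c(3)[of "len j"] len_pos[OF j] start[OF j] finish[OF j] by simp_all
    moreover have "f 0 = c (\<iota> v1)" "f (len i) = c (\<iota> v2)"
      using start[OF i] finish[OF i] by (simp_all add: f_def)
    moreover from this cv have "f 0 = (if \<iota> v1 = v1 then 0 else len j)"
      "f (len i) = (if \<iota> v1 = v1 then len j else 0)"
      using ends v12(3) by metis+
    moreover have "isometric_at (len i) f t"
      if t: "t \<in> {0..len i}" "\<iota> (h i t) \<noteq> h i t" "h i t \<notin> D" for t
    proof -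
      have "h i t \<in> points G - D" using in_ce[OF t(1)] edge_points[OF i] t(3) by blast
      from iso[OF this t(2)] obtain N where N: "openin X N" "h i t \<in> N"
        "\<forall>y\<in>N. \<forall>z\<in>N. mg_dist G (\<iota> y) (\<iota> z) = mg_dist G y z" by blast
      have "openin (top_of_set {0..len i}) {s \<in> topspace (top_of_set {0..len i}). h i s \<in> N}"
        using cont_h[OF i] N(1) by (rule openin_continuous_map_preimage)
      then obtain T where T: "open T" "{s \<in> {0..len i}. h i s \<in> N} = {0..len i} \<inter> T" by (auto simp: openin_open)
      have "t \<in> {s \<in> {0..len i}. h i s \<in> N}" using t N by simp
      then have "t \<in> T" unfolding T(2) by simp
      then obtain e1 where e1: "e1 > 0" "ball t e1 \<subseteq> T" using T(1) open_contains_ball by blast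
      have near1: "h i s \<in> N" if "s \<in> {0..len i}" "\<bar>s - t\<bar> < e1" for s
      proof -
        have "s \<in> {0..len i} \<inter> T" using e1(2) that by (auto simp: dist_real_def abs_minus_commute subset_iff)
        then show ?thesis unfolding T(2)[symmetric] by simp
      qed
      obtain e2 where e2: "e2 > 0" "\<forall>s\<in>{0..len i}. \<bar>s - t\<bar> < e2 \<longrightarrow> mg_dist G (h i s) (h i t) = \<bar>s - t\<bar>"
        using arclength[OF i t(1)] by blast
      obtain e3 where e3: "e3 > 0" "\<forall>u\<in>{0..len j}. \<bar>u - f t\<bar> < e3 \<longrightarrow> mg_dist G (h j u) (h j (f t)) = \<bar>u - f t\<bar>"
        using arclength[OF j] fh[OF t(1)] by blast
      obtain e4 where e4: "e4 > 0" "\<forall>s\<in>{0..len i}. dist s t < e4 \<longrightarrow> dist (f s) (f t) < e3"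
        using contf t(1) e3(1) unfolding continuous_on_iff by blast
      show ?thesis unfolding isometric_at_def
      proof (intro exI[of _ "Min {e1, e2, e4}"] conjI ballI impI)
        show "0 < Min {e1, e2, e4}" using e1 e2 e4 by simp
        fix s assume s: "s \<in> {0..len i}" "\<bar>s - t\<bar> < Min {e1, e2, e4}"
        have "\<bar>f s - f t\<bar> = mg_dist G (h j (f s)) (h j (f t))"
          using e3(2) fh[OF s(1)] e4(2) s by (simp add: dist_real_def)
        also have "\<dots> = mg_dist G (\<iota> (h i s)) (\<iota> (h i t))" using fh[OF s(1)] fh[OF t(1)] by simp
        also have "\<dots> = mg_dist G (h i s) (h i t)" using N(2,3) near1[OF s(1)] s(2) by simp
        also have "\<dots> = \<bar>s - t\<bar>" using e2(2) s by simp
        finally show "\<bar>f s - f t\<bar> = \<bar>s - t\<bar>" .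
      qed
    qed
    ultimately show ?thesis using contf fh by blast
  qed
  have finD: "finite {t \<in> {0..len i}. h i t \<in> D}" if i: "i \<in> I" for i
    using finite_vimage_IntI[OF \<open>finite D\<close> inj_h[OF i]] by (simp add: vimage_def Int_def conj_commute)
  have same: "\<iota> ` open_edge i \<subseteq> open_edge i" if i: "i \<in> I" for i
  proof -
    obtain j where j: "j \<in> I" "\<iota> ` open_edge i \<subseteq> open_edge j" using into[OF i] by blast
    have "j = i"
    proof (rule ccontr)
      assume ne: "j \<noteq> i"
      obtain f where f: "continuous_on {0..len i} f" "inj_on f {0..len i}"
        "f 0 = (if \<iota> v1 = v1 then 0 else len j)" "f (len i) = (if \<iota> v1 = v1 then len j else 0)"
        "\<forall>t\<in>{0..len i}. \<iota> (h i t) \<noteq> h i t \<longrightarrow> h i t \<notin> D \<longrightarrow>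
        isometric_at (len i) f t"
        using main[OF i j] by blast
      have moved: "\<iota> (h i t) \<noteq> h i t" if "t \<in> {0<..<len i}" for t
      proof
        assume "\<iota> (h i t) = h i t"
        moreover have "h i t \<in> open_edge i" using that open_edge_I by simp
        ultimately have "h i t \<in> open_edge j" using j(2) by (metis image_subset_iff)
        then show False using open_edge_unique[OF i j(1)] \<open>h i t \<in> open_edge i\<close> ne by blast
      qed
      have "len i = len j"
      proof (rule local_isometry_of_intervals(1)[OF finD[OF i] len_pos[OF i] len_pos[OF j(1)] f(1,2)])
        show "isometric_at (len i) f t"
          if "t \<in> {0<..<len i} - {t \<in> {0..len i}. h i t \<in> D}" for t
          using f(5) moved[of t] that by auto
        show "f 0 = 0 \<and> f (len i) = len j \<or> f 0 = len j \<and> f (len i) = 0" using f(3,4) by auto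
      qed
      then show False using inj_onD[OF len_inj _ i j(1)] ne by simp
    qed
    then show ?thesis using j by simp
  qed
  show ?thesis
  proof (cases "\<iota> v1 = v1")
    case True
    have fix_ce: "\<iota> x = x" if i: "i \<in> I" and x: "x \<in> edge i" for i x
    proof -
      obtain f where f: "continuous_on {0..len i} f" "inj_on f {0..len i}"
        "\<forall>t\<in>{0..len i}. f t \<in> {0..len i} \<and> \<iota> (h i t) = h i (f t)" "f 0 = 0" "f (len i) = len i"
        using main[OF i i same[OF i]] True by auto
      have mono: "strict_mono_on {0..len i} f"
        using injective_eq_monotone_map[of "{0..len i}" f] f(1,2) monotone_onD[of "{0..len i}" "(<)" "(>)" f 0 "len i"]
          f(4,5) len_pos[OF i] by auto
      have invf: "f (f t) = t" if t: "t \<in> {0..len i}" for t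
      proof -
        have ft: "f t \<in> {0..len i}" "\<iota> (h i t) = h i (f t)" using f(3) t by auto
        have "h i t \<in> points G" using edge_points[OF i] t unfolding edge_def by blast
        then have "h i t = \<iota> (\<iota> (h i t))" using inv by simp
        also have "\<dots> = \<iota> (h i (f t))" using ft by simp
        also have "\<dots> = h i (f (f t))" using f(3) ft(1) by blast
        finally have "h i t = h i (f (f t))" .
        moreover have "f (f t) \<in> {0..len i}" using f(3) ft(1) by blast
        ultimately show ?thesis using inj_onD[OF inj_h[OF i]] t by metis
      qed
      obtain t where t: "t \<in> {0..len i}" "x = h i t" using x by (auto simp: edge_def)
      have ft: "f t \<in> {0..len i}" using f(3) t by blast
      have "f t = t"
      proof (rule ccontr)
        assume "f t \<noteq> t"
        then consider "f t < t" | "t < f t" by linarith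
        then show False
          using strict_mono_onD[OF mono ft t(1)] strict_mono_onD[OF mono t(1) ft] invf[OF t(1)] by cases auto
      qed
      then show ?thesis using f(3) t by metis
    qed
    then have "\<iota> x = x" if "x \<in> points G" for x using that unfolding points_eq_edges by auto
    then show ?thesis by blast
  next
    case False
    have "\<iota> (h i t) = h i (len i - t)" if i: "i \<in> I" and t: "t \<in> {0..len i}" for i t
    proof -
      obtain f where f: "continuous_on {0..len i} f" "inj_on f {0..len i}"
        "\<forall>t\<in>{0..len i}. f t \<in> {0..len i} \<and> \<iota> (h i t) = h i (f t)" "f 0 = len i" "f (len i) = 0"
        "\<forall>t\<in>{0..len i}. \<iota> (h i t) \<noteq> h i t \<longrightarrow> h i t \<notin> D \<longrightarrow>
        isometric_at (len i) f t"
        using main[OF i i same[OF i]] False by auto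
      have anti: "strict_antimono_on {0..len i} f"
        using injective_eq_monotone_map[of "{0..len i}" f] f(1,2) monotone_onD[of "{0..len i}" "(<)" "(<)" f 0 "len i"]
          f(4,5) len_pos[OF i] by auto
      have "s = t" if "s \<in> {0..len i}" "t \<in> {0..len i}" "f s = s" "f t = t" for s t
      proof (rule ccontr)
        assume "s \<noteq> t"
        then consider "s < t" | "t < s" by linarith
        then show False using monotone_onD[OF anti, of s t] monotone_onD[OF anti, of t s] that by cases auto
      qed
      then have "{t \<in> {0..len i}. f t = t} \<subseteq> {SOME s. s \<in> {0..len i} \<and> f s = s}"
        by (smt (verit) mem_Collect_eq singletonI someI_ex subsetI)
      then have "finite {t \<in> {0..len i}. f t = t}" by (rule finite_subset) simp
      then have "finite ({t \<in> {0..len i}. h i t \<in> D} \<union> {t \<in> {0..len i}. f t = t})" using finD[OF i] by simp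
      then have "f t = len i - t"
      proof (rule local_isometry_of_intervals(2)[OF _ len_pos[OF i] len_pos[OF i] f(1,2) _ _ f(4) t])
        show "f 0 = 0 \<and> f (len i) = len i \<or> f 0 = len i \<and> f (len i) = 0" using f(4,5) by auto
        fix s assume s: "s \<in> {0<..<len i} - ({t \<in> {0..len i}. h i t \<in> D} \<union> {t \<in> {0..len i}. f t = t})"
        then have s': "s \<in> {0..len i}" "f s \<noteq> s" "h i s \<notin> D" by auto
        have "\<iota> (h i s) \<noteq> h i s" using f(3) s' inj_onD[OF inj_h[OF i], of "f s" s] by auto
        then show "isometric_at (len i) f s" using f(6) s' by blast
      qed
      then show ?thesis using f(3) t by auto
    qed
    then show ?thesis by blast
  qed
qed

end

section \<open>Morphisms of degree two to graphs of genus one\<close>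

theorem theorem1:
  fixes n :: nat
    and G\<^sub>0 G\<^sub>n :: "'a mgraph"
    and v\<^sub>1 v\<^sub>2 :: 'a
    and len r :: "nat \<Rightarrow> real"
    and h :: "nat \<Rightarrow> real \<Rightarrow> 'a"
    and m q :: "nat \<Rightarrow> 'a"
  assumes "n \<ge> 2"
    and "theta_graph G\<^sub>0 v\<^sub>1 v\<^sub>2 len h"
    and "\<forall>i\<in>{0, 1, 2}. m i = h i (len i / 2)"
    and "q 0 = m 0"
    and "q 1 \<in> h 1 ` {0<..<len 1 / 2}"
    and "q 2 \<in> h 2 ` {len 2 / 2<..<len 2}"
    and "\<forall>i\<in>{3..n}. q i \<in> points G\<^sub>0 - {v\<^sub>1, v\<^sub>2, m 0, m 1, m 2}"
    and "inj_on q {0..n}"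
    and "\<forall>i\<in>{0..n}. r i > 0"
    and "attach_loops q r (Suc n) G\<^sub>0 G\<^sub>n"
  shows "\<not> (\<exists>G'. tropical_modification G\<^sub>n G' \<and>
             (\<exists>(E :: 'b mgraph) \<phi>. metric_graph E \<and> genus E = 1 \<and>
                finite_morphism G' E \<phi> \<and> harmonic_morphism G' E \<phi> \<and> has_degree G' E \<phi> 2))"
proof
  assume "\<exists>G'. tropical_modification G\<^sub>n G' \<and>
             (\<exists>(E :: 'b mgraph) \<phi>. metric_graph E \<and> genus E = 1 \<and>
                finite_morphism G' E \<phi> \<and> harmonic_morphism G' E \<phi> \<and> has_degree G' E \<phi> 2)"
  then obtain G' and E :: "'b mgraph" and \<phi> where trop: "tropical_modification G\<^sub>n G'"
    and E: "metric_graph E" and genus: "genus E = 1" and \<phi>: "finite_morphism G' E \<phi>" "harmonic_morphism G' E \<phi>" "has_degree G' E \<phi> 2"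
    by blast
  interpret theta G\<^sub>0 v\<^sub>1 v\<^sub>2 len h by standard (rule assms(2))
  let ?P = "points G\<^sub>0"
  let ?X = "mg_top G\<^sub>0" and ?Y = "mg_top G'"
  have q1: "\<exists>s. 0 < s \<and> s < len 1 / 2 \<and> q 1 = h 1 s" and q2: "\<exists>s. len 2 / 2 < s \<and> s < len 2 \<and> q 2 = h 2 s"
    using assms(5,6) by auto
  have q1e: "q 1 \<in> open_edge 1" and q2e: "q 2 \<in> open_edge 2"
    using q1 q2 open_edge_I[of _ 1] open_edge_I[of _ 2] len_pos[of 1] len_pos[of 2] by fastforce+
  have "q 0 \<in> open_edge 0" using assms(3,4) open_edge_I[of "len 0 / 2" 0] len_pos[of 0] by simp
  then have q012: "q 0 \<in> ?P" "q 1 \<in> ?P" "q 2 \<in> ?P"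
    using open_edge_points[of 0] open_edge_points[of 1] open_edge_points[of 2] q1e q2e by auto
  have q: "q i \<in> ?P" if i: "i < Suc n" for i
  proof -
    consider "i = 0" | "i = 1" | "i = 2" | "i \<in> {3..n}" using i by fastforce
    then show ?thesis using q012 assms(7) by cases auto
  qed
  have "inj_on q {..<Suc n}" using assms(8) by (simp add: atLeast0AtMost lessThan_Suc_atMost)
  then obtain loop where "loop_decomposition G\<^sub>0 q (Suc n) G\<^sub>n loop"
    using loops_decomposition[of G\<^sub>0 "Suc n" r q G\<^sub>n] mgraph assms(9,10) q by auto
  then have dec: "loop_decomposition G\<^sub>0 q (Suc n) G' loop"
    using tropical_decomposition[OF trop] by blast
  have G': "metric_graph G'" and sub: "?P \<subseteq> points G'" and topsub: "subtopology ?Y (?P) = ?X"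
    and dist: "\<And>x y. x \<in> ?P \<Longrightarrow> y \<in> ?P \<Longrightarrow> mg_dist G' x y = mg_dist G\<^sub>0 x y"
    and scc: "\<And>i. i < Suc n \<Longrightarrow> simple_closed ?Y (loop i)"
    and meet: "\<And>i. i < Suc n \<Longrightarrow> loop i \<inter> ?P = {q i}"
    and disj: "\<And>i j. i < Suc n \<Longrightarrow> j < Suc n \<Longrightarrow> i \<noteq> j \<Longrightarrow> loop i \<inter> loop j = {}"
    and blocks: "\<And>B. block ?Y B \<Longrightarrow> B \<subseteq> ?P \<or> (\<exists>i<Suc n. B \<subseteq> loop i)"
    using dec no_infinite unfolding loop_decomposition_def by auto
  obtain V' V where m: "morphism_wrt G' E \<phi> V' V" "\<forall>e\<in>edges G' V'. edge_degree G' E \<phi> e > 0"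
    using \<phi>(1) unfolding finite_morphism_def by blast
  interpret degree_two_morphism G' E \<phi> V' V
    using G' E m \<phi> v12 sub by unfold_locales (auto simp: harmonic_morphism_def)
  have H: "Hausdorff_space ?Y" by (rule Hausdorff_G)
  have homeo: "homeomorphic_map ?Y ?Y swap"
    using swap_homeomorphic homeomorphic_maps_map by blast
  have block0: "block ?Y (?P)"
    using block_points block_subtopology[of "?P" "?P" ?Y] topsub by simp
  have swap_block: "block ?Y (swap ` B)" if B: "block ?Y B" for B
  proof -
    have "B \<subseteq> topspace ?Y" using B connectedin_subset_topspace unfolding block_def by blast
    then show ?thesis using block_homeomorphic[OF homeo] B by blast
  qed
  have swap2: "swap ` swap ` B = B" if "B \<subseteq> points G'" for B
  proof -
    have "swap (swap x) = x" if "x \<in> B" for x using that \<open>B \<subseteq> points G'\<close> by auto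
    then show ?thesis by (simp add: image_image)
  qed
  have loop_sub: "loop i \<subseteq> points G'" if "i < Suc n" for i
    using simple_closed_block[OF H scc[OF that]] connectedin_subset_topspace unfolding block_def points_def by blast
  have loop_block: "block ?Y (loop i)" if "i < Suc n" for i by (rule simple_closed_block[OF H scc[OF that]])
  have core_not_loop: "\<not> ?P \<subseteq> loop i" if "i < Suc n" for i
  proof
    assume "?P \<subseteq> loop i"
    then have "?P \<subseteq> {q i}" using meet[OF that] by blast
    then show False using v12 by auto
  qed
  \<comment> \<open>Otherwise the theta graph would be mapped onto a loop and would itself be a circle.\<close>
  have core_in: "swap ` ?P \<subseteq> ?P"
  proof (rule ccontr)
    assume "\<not> ?thesis"
    then obtain i where i: "i < Suc n" "swap ` ?P \<subseteq> loop i" using blocks[OF swap_block[OF block0]] by blast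
    then have ge: "?P \<subseteq> swap ` loop i" using swap2[OF sub] image_mono[OF i(2), of swap] by simp
    have "swap ` loop i \<subseteq> ?P"
      using blocks[OF swap_block[OF loop_block[OF i(1)]]] core_not_loop ge by blast
    then have eq: "?P = swap ` loop i" using ge by blast
    have "simple_closed ?Y (swap ` loop i)"
      using simple_closed_image[OF scc[OF i(1)] swap_continuous] swap_inj loop_sub[OF i(1)] inj_on_subset by blast
    then have "simple_closed ?X (?P)"
      using eq topsub unfolding simple_closed_def closed_curve_def by (metis continuous_map_in_subtopology image_subset_iff_funcset topspace_euclidean_subtopology subset_refl)
    then show False using not_simple_closed by blast
  qed
  have core_eq: "swap ` ?P = ?P"
    using core_in image_mono[OF core_in, of swap] swap2[OF sub] by auto
  \<comment> \<open>The attaching point goes to an attaching point, being the only point of the loop that lies in the theta graph.\<close>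
  have loop_to_loop: "\<exists>j<Suc n. swap ` loop i \<subseteq> loop j \<and> swap (q i) = q j" if i: "i < Suc n" for i
  proof -
    have qi: "q i \<in> loop i" using meet[OF i] by blast
    have "\<not> swap ` loop i \<subseteq> ?P"
    proof
      assume "swap ` loop i \<subseteq> ?P"
      then have "loop i \<subseteq> ?P" using image_mono[of "swap ` loop i" "?P" swap] swap2[OF loop_sub[OF i]] core_eq by auto
      then have "loop i = {q i}" using meet[OF i] by blast
      then show False using loop_block[OF i] unfolding block_def by auto
    qed
    then obtain j where j: "j < Suc n" "swap ` loop i \<subseteq> loop j" using blocks[OF swap_block[OF loop_block[OF i]]] by blast
    have "swap (q i) \<in> loop j \<inter> ?P" using j(2) qi core_in q[OF i] by blast
    then show ?thesis using j meet[OF j(1)] by blast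
  qed
  have dich: "(\<forall>x\<in>?P. swap x = x) \<or> (\<forall>i\<in>{0, 1, 2}. \<forall>t\<in>{0..len i}. swap (h i t) = h i (len i - t))"
  proof (rule involution_dichotomy)
    show "swap x \<in> ?P" if "x \<in> ?P" for x using that core_in by blast
    show "swap (swap x) = x" if "x \<in> ?P" for x using that sub by auto
    have "continuous_map (subtopology ?Y (?P)) (subtopology ?Y (?P)) swap"
      using swap_continuous core_in
      by (auto simp: continuous_map_in_subtopology continuous_map_from_subtopology)
    then show "continuous_map ?X ?X swap" using topsub by simp
    \<comment> \<open>The exceptional points are those whose fibre meets the vertex set.\<close>
    show "finite (V' \<union> swap ` V')" using vG by (simp add: vertex_set_def)
    fix x assume x: "x \<in> ?P - (V' \<union> swap ` V')" "swap x \<noteq> x"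
    have xG: "x \<in> points G' - V'" using x sub by blast
    have "swap x \<notin> V'"
    proof
      assume "swap x \<in> V'"
      then have "swap (swap x) \<in> swap ` V'" by blast
      then show False using x xG by simp
    qed
    from swap_local_isometry[OF xG this x(2)] obtain N where N: "openin ?Y N" "x \<in> N"
      "\<And>y z. y \<in> N \<Longrightarrow> z \<in> N \<Longrightarrow> mg_dist G' (swap y) (swap z) = mg_dist G' y z" by metis
    have "openin ?X (N \<inter> ?P)" using N(1) topsub by (metis openin_subtopology_Int)
    moreover have "mg_dist G\<^sub>0 (swap y) (swap z) = mg_dist G\<^sub>0 y z" if yz: "y \<in> N \<inter> ?P" "z \<in> N \<inter> ?P" for y z
    proof -
      have "swap y \<in> ?P" "swap z \<in> ?P" using core_in yz by blast+
      then show ?thesis using N(3)[of y z] dist[of y z] dist[of "swap y" "swap z"] yz by simp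
    qed
    ultimately show "\<exists>N. openin ?X N \<and> x \<in> N \<and> (\<forall>y\<in>N. \<forall>z\<in>N. mg_dist G\<^sub>0 (swap y) (swap z) = mg_dist G\<^sub>0 y z)"
      using N(2) x by (intro exI[of _ "N \<inter> ?P"]) blast
  qed
  have circles: "\<phi> ` K1 \<subseteq> \<phi> ` K2"
    if K: "simple_closed ?Y K1" "simple_closed ?Y K2" "inj_on \<phi> K1" "inj_on \<phi> K2" for K1 K2
    by (rule genus_one_unique_circle[OF E genus vE simple_closed_image[OF K(1) cont K(3)] simple_closed_image[OF K(2) cont K(4)]])
  from dich show False
  proof
    assume id: "\<forall>x\<in>?P. swap x = x"
    have inj: "inj_on \<phi> (?P)"
    proof (rule inj_onI)
      fix x y assume xy: "x \<in> ?P" "y \<in> ?P" "\<phi> x = \<phi> y"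
      then have "y = x \<or> y = swap x" using fibre[of x y] sub by auto
      then show "x = y" using id xy by auto
    qed
    have c: "simple_closed ?Y (edge 0 \<union> edge 1)" "simple_closed ?Y (edge 0 \<union> edge 2)"
      using cycle[of 0 1] cycle[of 0 2] topsub simple_closed_subtopology[of ?Y "?P"] by simp_all
    have s: "edge 0 \<union> edge 1 \<subseteq> ?P" "edge 0 \<union> edge 2 \<subseteq> ?P" using points_eq_edges by auto
    have "\<phi> ` (edge 0 \<union> edge 1) \<subseteq> \<phi> ` (edge 0 \<union> edge 2)"
      by (rule circles[OF c inj_on_subset[OF inj s(1)] inj_on_subset[OF inj s(2)]])
    moreover have "q 1 \<in> edge 0 \<union> edge 1" using edge_eq[of 1] q1e by auto
    ultimately obtain y where y: "y \<in> edge 0 \<union> edge 2" "\<phi> (q 1) = \<phi> y" by blast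
    then have "q 1 = y" using inj_onD[OF inj y(2)] q012 s(2) by blast
    then have "q 1 \<in> edge 0 \<union> edge 2" using y by simp
    then show False using edge_eq[of 0] edge_eq[of 2] open_edge_unique[of 1 0 "q 1"] open_edge_unique[of 1 2 "q 1"] open_edge_points[OF _ q1e] q1e
      by auto
  next
    assume flip: "\<forall>i\<in>{0, 1, 2}. \<forall>t\<in>{0..len i}. swap (h i t) = h i (len i - t)"
    have lt: "1 < Suc n" "2 < Suc n" using assms(1) by auto
    obtain j where j: "j < Suc n" "swap ` loop 1 \<subseteq> loop j" "swap (q 1) = q j" using loop_to_loop[OF lt(1)] by blast
    obtain k where k: "k < Suc n" "swap ` loop 2 \<subseteq> loop k" "swap (q 2) = q k" using loop_to_loop[OF lt(2)] by blast
    have j1: "j \<noteq> 1"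
    proof
      assume "j = 1"
      obtain s where s: "0 < s" "s < len 1 / 2" "q 1 = h 1 s" using q1 by blast
      then have "h 1 (len 1 - s) = h 1 s" using flip j(3) \<open>j = 1\<close> by auto
      then have "len 1 - s = s" using inj_onD[OF inj_h[of 1], of "len 1 - s" s] s by auto
      then show False using s by simp
    qed
    \<comment> \<open>The mirror image of q 2 lies on the edge of q 2, so it cannot be q 1.\<close>
    have k12: "k \<noteq> 2 \<and> k \<noteq> 1"
    proof -
      obtain s where s: "len 2 / 2 < s" "s < len 2" "q 2 = h 2 s" using q2 by blast
      then have e: "q k = h 2 (len 2 - s)" using flip k(3) len_pos[of 2] by auto
      have "k \<noteq> 2"
      proof
        assume "k = 2"
        then have "len 2 - s = s" using inj_onD[OF inj_h[of 2], of "len 2 - s" s] s e len_pos[of 2] by auto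
        then show False using s by simp
      qed
      moreover have "q k \<in> open_edge 2" using e s open_edge_I[of "len 2 - s" 2] len_pos[of 2] by auto
      then have "k \<noteq> 1" using open_edge_unique[of 1 2 "q 1"] q1e by auto
      ultimately show ?thesis by simp
    qed
    have inj: "inj_on \<phi> (loop i)" if i: "i < Suc n" and l: "l < Suc n" "swap ` loop i \<subseteq> loop l" "l \<noteq> i" for i l
    proof (rule inj_onI)
      fix x y assume xy: "x \<in> loop i" "y \<in> loop i" "\<phi> x = \<phi> y"
      have "x \<in> points G'" "y \<in> points G'" using xy loop_sub[OF i] by auto
      then have "y = x \<or> y = swap x" using fibre[of x y] xy by auto
      moreover have "swap x \<notin> loop i" using l xy disj[OF i l(1)] by blast
      ultimately show "x = y" using xy by auto
    qed
    have "\<phi> ` loop 1 \<subseteq> \<phi> ` loop 2"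
      by (rule circles[OF scc[OF lt(1)] scc[OF lt(2)] inj[OF lt(1) j(1,2) j1] inj[OF lt(2) k(1,2)]]) (use k12 in simp)
    moreover have x1: "q 1 \<in> loop 1" using meet[OF lt(1)] by blast
    ultimately obtain y where y: "y \<in> loop 2" "\<phi> (q 1) = \<phi> y" by blast
    have "y \<in> points G'" "q 1 \<in> points G'" using y loop_sub[OF lt(2)] q012 sub by auto
    then have "q 1 = y \<or> q 1 = swap y" using fibre[of y "q 1"] y by auto
    then have "q 1 \<in> loop 2 \<union> loop k" using y k(2) by auto
    then show False using x1 disj[OF lt] disj[OF lt(1) k(1)] k12 by auto
  qed
qed

end
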